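(* Let $\widetilde A\in M_n(\mathbb{C}(x))$ and let $A^{(h)}\in M_n(\mathbb{C}(x))$, $h\in]0,h_0[$, satisfy: (i) each $A^{(h)}(x)=\sum_{s\ge0}A_s^{(h)}x^{-[s]_h}$ belongs to $M_n(\mathcal{O}_{fact}^{(h)})$, the family $(A^{(h)})_h$ is of type $(C,\lambda)$ for some $C,\lambda\ge0$, $\widetilde A(x)=\sum_{s\ge0}\widetilde A_sx^{-s}$ near $\infty$, and $A_s^{(h)}\to\widetilde A_s$ as $h\to0^+$ for every $s\in\mathbb{N}$; (ii) a Jordan reduction of $\widetilde A_0$ unfolds into Jordan reductions of the $A_0^{(h)}$; (iii) $\widetilde A_0$ is non-resonant (no two eigenvalues differ by a nonzero integer); (iv) $A^{(h)}\to\widetilde A$ as $h\to0^+$ uniformly on every compact subset of $\mathbb{C}\setminus\{\text{poles of }\widetilde A\}$ (it is understood that every $x_0\in\mathbb{C}$ that is not a pole of $\widetilde A$ has a neighbourhood on which the $A^{(h)}$ have no pole for $h>0$ small enough). Let $\widetilde\Omega^+$ be $\mathbb{C}$ minus the horizontal closed half-lines issued from $0$ and from each pole of $\widetilde A$ and directed towards $-\infty$. Then, as $h\to0^+$, the canonical solution $e^{(h)+}_{A^{(h)}}$ at $+\infty$ of $\delta_{-h}Y=A^{(h)}Y$ tends on $\widetilde\Omega^+$ to $e_{\widetilde A}$, the continuation to $\widetilde\Omega^+$ of the canonical Frobenius solution at $\infty$ of $x\frac{d}{dx}\widetilde Y=\widetilde A\widetilde Y$.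
   Context: $\|\cdot\|$ is an algebra norm on $M_n(\mathbb{C})$. $\delta_{-h}Y(x)=(x-h)\frac{Y(x)-Y(x-h)}{h}$. $x^{[s]_h}=x(x+h)\cdots(x+(s-1)h)$ ($=1$ for $s=0$), $x^{-[s]_h}=1/x^{[s]_h}$. $\mathcal{O}_{fact}^{(h)}$ is the ring of functions given on some right half-plane by convergent series $\sum_{s\ge0}a_sx^{-[s]_h}$. Type $(C,\lambda)$: there is $h_0'\in]0,h_0[$ with $\|A_s^{(h)}\|\le C\lambda^{[s-1]_h}$ for all $h\in]0,h_0'[$ and $s\ge1$, and $\{\|A_0^{(h)}\|\}_{h\in]0,h_0[}$ is bounded. Unfolding: there exist Jordan reductions $\widetilde A_0=\widetilde Q\widetilde J\widetilde Q^{-1}$ and $A_0^{(h)}=Q^{(h)}J^{(h)}(Q^{(h)})^{-1}$ with $Q^{(h)}\to\widetilde Q$ and $J^{(h)}\to\widetilde J$ as $h\to0^+$. Canonical solution: put $e_c^{(h)+}(x)=h^c\,\Gamma(x/h)/\Gamma(x/h-c)$, $l_c^{(k,h)}=\frac1{k!}\partial_c^ke_c^{(h)+}$. For a Jordan block $cI_\mu+N_\mu$ ($N_\mu$ with ones on the superdiagonal), $e^{(h)+}_{cI_\mu+N_\mu}$ is the upper triangular Toeplitz matrix with $(i,j)$ entry $l_c^{(j-i,h)}$ for $j\ge i$; extend blockwise to Jordan matrices and set $e^{(h)+}_{QJQ^{-1}}=Qe^{(h)+}_JQ^{-1}$ (independent of the reduction). For $h$ small, $A_0^{(h)}=A^{(h)}(\infty)$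 is non-resonant and there is a unique $F^{(h)}\in GL_n(\mathcal{O}_{fact}^{(h)})$ with $F^{(h)}(+\infty)=I$ such that $e^{(h)+}_{A^{(h)}}:=F^{(h)}e^{(h)+}_{A_0^{(h)}}$ is a solution of $\delta_{-h}Y=A^{(h)}Y$; it is meromorphic on $\mathbb{C}$ and is called the canonical solution at $+\infty$. Frobenius solution: $e_{\widetilde A}=\widetilde F(x)\,x^{\widetilde A_0}$ near $\infty$, where $x^{\widetilde A_0}=\exp(\widetilde A_0\log x)$ with the principal logarithm and $\widetilde F$ is the unique convergent power series in $1/x$ with $\widetilde F(\infty)=I$ making this a solution of $x\frac{d}{dx}\widetilde Y=\widetilde A\widetilde Y$. *)

theory Defs
  imports "HOL-Complex_Analysis.Complex_Analysis" "HOL-Computational_Algebra.Computational_Algebra"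
    "HOL-Computational_Algebra.Field_as_Ring"
begin

text \<open>
  \<open>M\<^sub>n(\<complex>)\<close> is \<open>complex ^ 'n ^ 'n\<close> with \<open>n = CARD('n)\<close>. Where the order of the indices matters, the
  finite linearly ordered type \<open>'n\<close> plays the role of \<open>{1, \<dots>, n}\<close>. Note that multiplication is \<open>**\<close>
  and the unit is \<open>mat 1\<close>, whereas \<open>*\<close> and \<open>1\<close> are entrywise.
\<close>

unbundle no fps_syntax

type_synonym 'n cmat = "((complex, 'n) vec, 'n) vec"
type_synonym 'n ratmat = "((complex poly fract, 'n) vec, 'n) vec"

definition csmult :: "complex \<Rightarrow> ('n::finite) cmat \<Rightarrow> 'n cmat"  (infixr \<open>*\<^sub>C\<close> 75)
  where "c *\<^sub>C M = (\<chi> i j. c * M $ i $ j)"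

definition algebra_norm :: "(('n::finite) cmat \<Rightarrow> real) \<Rightarrow> bool" where
  "algebra_norm N \<longleftrightarrow>
     (\<forall>M. N M = 0 \<longleftrightarrow> M = 0) \<and>
     (\<forall>c M. N (c *\<^sub>C M) = cmod c * N M) \<and>
     (\<forall>M M'. N (M + M') \<le> N M + N M') \<and>
     (\<forall>M M'. N (M ** M') \<le> N M * N M')"


subsection \<open>Rational functions\<close>

text \<open>\<open>\<complex>(x)\<close> is the type \<open>complex poly fract\<close>. As \<open>quot_of_fract\<close> yields the reduced fraction, the
  zeros of its denominator are exactly the poles. At a pole \<open>rat_eval\<close> is 0.\<close>

definition rat_eval :: "complex poly fract \<Rightarrow> complex \<Rightarrow> complex" where
  "rat_eval r x = poly (fst (quot_of_fract r)) x / poly (snd (quot_of_fract r)) x"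

definition rat_poles :: "complex poly fract \<Rightarrow> complex set" where
  "rat_poles r = {x. poly (snd (quot_of_fract r)) x = 0}"

definition ratm_eval :: "('n::finite) ratmat \<Rightarrow> complex \<Rightarrow> 'n cmat" where
  "ratm_eval A x = (\<chi> i j. rat_eval (A $ i $ j) x)"

definition ratm_poles :: "('n::finite) ratmat \<Rightarrow> complex set" where
  "ratm_poles A = (\<Union>i j. rat_poles (A $ i $ j))"


subsection \<open>Factorial series\<close>

text \<open>\<open>rising h s x\<close> is \<open>x (x + h) \<cdots> (x + (s - 1) h)\<close>.\<close>

definition rising :: "real \<Rightarrow> nat \<Rightarrow> 'a::real_field \<Rightarrow> 'a" where
  "rising h s x = (\<Prod>k<s. x + of_real (of_nat k * h))"

definition in_O_fact :: "real \<Rightarrow> (complex \<Rightarrow> complex) \<Rightarrow> bool" where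
  "in_O_fact h f \<longleftrightarrow> (\<exists>a R. \<forall>x. Re x > R \<longrightarrow> (\<lambda>s. a s / rising h s x) sums f x)"

definition in_M_fact :: "real \<Rightarrow> (complex \<Rightarrow> ('n::finite) cmat) \<Rightarrow> bool" where
  "in_M_fact h F \<longleftrightarrow> (\<forall>i j. in_O_fact h (\<lambda>x. F x $ i $ j))"

definition in_GL_fact :: "real \<Rightarrow> (complex \<Rightarrow> ('n::finite) cmat) \<Rightarrow> bool" where
  "in_GL_fact h F \<longleftrightarrow> in_M_fact h F \<and>
     (\<exists>G R. in_M_fact h G \<and> (\<forall>x. Re x > R \<longrightarrow> F x ** G x = mat 1 \<and> G x ** F x = mat 1))"

definition fact_expansion ::
    "real \<Rightarrow> ('n::finite) ratmat \<Rightarrow> (nat \<Rightarrow> 'n cmat) \<Rightarrow> bool" where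
  "fact_expansion h A a \<longleftrightarrow>
     (\<exists>R. \<forall>x. Re x > R \<longrightarrow> (\<lambda>s. (1 / rising h s x) *\<^sub>C a s) sums ratm_eval A x)"

definition expansion_at_infinity ::
    "('n::finite) ratmat \<Rightarrow> (nat \<Rightarrow> 'n cmat) \<Rightarrow> bool" where
  "expansion_at_infinity A a \<longleftrightarrow>
     (\<exists>R. \<forall>x. cmod x > R \<longrightarrow> (\<lambda>s. (1 / x ^ s) *\<^sub>C a s) sums ratm_eval A x)"

definition of_type_C_lambda ::
    "(('n::finite) cmat \<Rightarrow> real) \<Rightarrow> real \<Rightarrow> (real \<Rightarrow> nat \<Rightarrow> 'n cmat) \<Rightarrow> real \<Rightarrow> real \<Rightarrow> bool" where
  "of_type_C_lambda N h0 a C l \<longleftrightarrow>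
     (\<exists>h1\<in>{0<..<h0}. \<forall>h\<in>{0<..<h1}. \<forall>s\<ge>1. N (a h s) \<le> C * rising h (s - 1) l) \<and>
     (\<exists>B. \<forall>h\<in>{0<..<h0}. N (a h 0) \<le> B)"


subsection \<open>Jordan reductions\<close>

text \<open>A decomposition of the index set into consecutive blocks is given by a monotone block number
  \<open>b\<close>, and \<open>c\<close> assigns an eigenvalue to each block. Inside a block, \<open>card {i..<j}\<close> is the distance
  of \<open>i \<le> j\<close>, so \<open>block_toeplitz f b c\<close> is block diagonal and its block with eigenvalue
  \<open>\<gamma>\<close> is the upper triangular Toeplitz matrix with \<open>(i, j)\<close> entry \<open>f \<gamma> (j - i)\<close>.\<close>

definition block_toeplitz ::
    "(complex \<Rightarrow> nat \<Rightarrow> complex) \<Rightarrow> ('n::{finite,linorder} \<Rightarrow> nat) \<Rightarrow> (nat \<Rightarrow> complex) \<Rightarrow> ('n::{finite,linorder}) cmat"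
  where
  "block_toeplitz f b c =
     (\<chi> i j. if b i = b j \<and> i \<le> j then f (c (b i)) (card {i..<j}) else 0)"

definition jordan_mat ::
    "('n::{finite,linorder} \<Rightarrow> nat) \<Rightarrow> (nat \<Rightarrow> complex) \<Rightarrow> ('n::{finite,linorder}) cmat" where
  "jordan_mat b c = block_toeplitz (\<lambda>\<gamma> k. if k = 0 then \<gamma> else if k = 1 then 1 else 0) b c"

definition jordan_reduction ::
    "('n::{finite,linorder}) cmat \<Rightarrow> 'n cmat \<Rightarrow> ('n::{finite,linorder} \<Rightarrow> nat) \<Rightarrow> (nat \<Rightarrow> complex) \<Rightarrow> bool"
  where
  "jordan_reduction M Q b c \<longleftrightarrow>
     mono b \<and> invertible Q \<and> M = Q ** jordan_mat b c ** matrix_inv Q"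

definition jordan_unfolding ::
    "real \<Rightarrow> (real \<Rightarrow> ('n::{finite,linorder}) cmat) \<Rightarrow> 'n cmat \<Rightarrow> bool" where
  "jordan_unfolding h0 M Mt \<longleftrightarrow>
     (\<exists>Qt bt ct Q b c.
        jordan_reduction Mt Qt bt ct \<and>
        (\<forall>h\<in>{0<..<h0}. jordan_reduction (M h) (Q h) (b h) (c h)) \<and>
        (Q \<longlongrightarrow> Qt) (at_right 0) \<and>
        ((\<lambda>h. jordan_mat (b h) (c h)) \<longlongrightarrow> jordan_mat bt ct) (at_right 0))"

definition is_eigenvalue :: "('n::finite) cmat \<Rightarrow> complex \<Rightarrow> bool" where
  "is_eigenvalue M c \<longleftrightarrow> (\<exists>v. v \<noteq> 0 \<and> M *v v = c *s v)"

definition non_resonant :: "('n::finite) cmat \<Rightarrow> bool" where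
  "non_resonant M \<longleftrightarrow>
     (\<forall>c d. is_eigenvalue M c \<and> is_eigenvalue M d \<and> c - d \<in> \<int> \<longrightarrow> c = d)"


subsection \<open>The canonical solution of the difference system\<close>

definition delta_minus ::
    "real \<Rightarrow> (complex \<Rightarrow> ('n::finite) cmat) \<Rightarrow> complex \<Rightarrow> 'n cmat" where
  "delta_minus h Y x = ((x - of_real h) / of_real h) *\<^sub>C (Y x - Y (x - of_real h))"

definition e_char :: "real \<Rightarrow> complex \<Rightarrow> complex \<Rightarrow> complex" where
  "e_char h c x = of_real h powr c * (Gamma (x / of_real h) / Gamma (x / of_real h - c))"

definition l_log :: "real \<Rightarrow> complex \<Rightarrow> nat \<Rightarrow> complex \<Rightarrow> complex" where
  "l_log h c k x = (deriv ^^ k) (\<lambda>\<gamma>. e_char h \<gamma> x) c / fact k"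

text \<open>The value does not depend on the Jordan reduction \<open>M = Q J Q\<^sup>-\<^sup>1\<close>.\<close>

definition e_matrix ::
    "real \<Rightarrow> ('n::{finite,linorder}) cmat \<Rightarrow> complex \<Rightarrow> 'n cmat" where
  "e_matrix h M x =
     (THE E. \<exists>Q b c. jordan_reduction M Q b c \<and>
        E = Q ** block_toeplitz (\<lambda>\<gamma> k. l_log h \<gamma> k x) b c ** matrix_inv Q)"

text \<open>\<open>E\<close> is the canonical solution at \<open>+\<infinity>\<close> of \<open>\<delta>\<^bsub>-h\<^esub> Y = A Y\<close>, where \<open>A0 = A(\<infinity>)\<close>. It is defined by
  \<open>F e\<^bsub>A0\<^esub>\<close> on a right half-plane, where \<open>F\<close> is given by its factorial series, and meromorphic on
  \<open>\<complex>\<close>. Working with \<open>nicely_meromorphic_on\<close> fixes the values of \<open>E\<close>: removable singularities are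
  removed, and entries are 0 at their poles. An identity between meromorphic
  functions is one that holds off a sparse set.\<close>

definition canonical_solution ::
    "real \<Rightarrow> ('n::{finite,linorder}) ratmat \<Rightarrow> 'n cmat \<Rightarrow>
       (complex \<Rightarrow> 'n cmat) \<Rightarrow> bool" where
  "canonical_solution h A A0 E \<longleftrightarrow>
     (\<forall>i j. (\<lambda>x. E x $ i $ j) nicely_meromorphic_on UNIV) \<and>
     (\<forall>\<^sub>\<approx>x. delta_minus h E x = ratm_eval A x ** E x) \<and>
     (\<exists>F R. in_GL_fact h F \<and>
        ((\<lambda>t. F (of_real t)) \<longlongrightarrow> mat 1) at_top \<and>
        (\<forall>x. Re x > R \<longrightarrow> E x = F x ** e_matrix h A0 x))"


subsection \<open>The canonical solution of the differential system\<close>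

definition mat_exp :: "('n::finite) cmat \<Rightarrow> 'n cmat" where
  "mat_exp M = (\<Sum>k. (1 / fact k) *\<^sub>C (((**) M) ^^ k) (mat 1))"

definition cpow_mat :: "complex \<Rightarrow> ('n::finite) cmat \<Rightarrow> 'n cmat" where
  "cpow_mat x M = mat_exp (Ln x *\<^sub>C M)"

definition Omega_plus :: "('n::finite) ratmat \<Rightarrow> complex set" where
  "Omega_plus A = UNIV - (\<Union>p\<in>insert 0 (ratm_poles A). {p - of_real t |t. t \<ge> 0})"

text \<open>\<open>F\<close> is the canonical power series in \<open>1/x\<close>, convergent for \<open>\<bar>x\<bar> > R\<close>, for which
  \<open>F x\<^bsup>A0\<^esup>\<close> (principal logarithm) solves \<open>x dY/dx = A Y\<close> for \<open>\<bar>x\<bar> > R\<close> off the negative half-axis;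
  \<open>D\<close> is the entrywise derivative.\<close>

definition frobenius_series ::
    "('n::finite) ratmat \<Rightarrow> 'n cmat \<Rightarrow> real \<Rightarrow> (complex \<Rightarrow> 'n cmat) \<Rightarrow> bool"
  where
  "frobenius_series A A0 R F \<longleftrightarrow> R > 0 \<and>
     (\<exists>a. a 0 = mat 1 \<and> (\<forall>x. cmod x > R \<longrightarrow> (\<lambda>s. (1 / x ^ s) *\<^sub>C a s) sums F x)) \<and>
     (\<forall>x. cmod x > R \<and> x \<notin> \<real>\<^sub>\<le>\<^sub>0 \<longrightarrow> x \<notin> ratm_poles A \<and>
        (\<exists>D. (\<forall>i j. ((\<lambda>z. (F z ** cpow_mat z A0) $ i $ j) has_field_derivative D $ i $ j) (at x)) \<and>
             x *\<^sub>C D = ratm_eval A x ** (F x ** cpow_mat x A0)))"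

text \<open>The continuation is from the right: to the left of two poles at different heights, the
  continuation along horizontal lines differs in general from \<open>F x\<^bsup>A0\<^esup>\<close> by a
  monodromy factor, even for large \<open>\<bar>x\<bar>\<close>.\<close>

definition frobenius_solution ::
    "('n::finite) ratmat \<Rightarrow> 'n cmat \<Rightarrow> (complex \<Rightarrow> 'n cmat) \<Rightarrow> bool" where
  "frobenius_solution A A0 E \<longleftrightarrow>
     (\<forall>i j. (\<lambda>x. E x $ i $ j) holomorphic_on Omega_plus A) \<and>
     (\<exists>R F. frobenius_series A A0 R F \<and> (\<forall>x. Re x > R \<longrightarrow> E x = F x ** cpow_mat x A0))"

end

theory Submission
  imports Defs
begin

text \<open>
  Write \<open>E = F e\<close> with \<open>e = e\<^bsub>A\<^sub>0\<^esub>\<close>. Both \<open>e\<close> and \<open>x\<^bsup>A\<^sub>0\<^esup>\<close> are entire functions of the matrix \<open>A\<^sub>0\<close>, and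
  Euler's product for \<open>\<Gamma>(y) / \<Gamma>(y - c)\<close> shows that \<open>e x\<^bsup>-A\<^sub>0\<^esup> \<rightarrow> 1\<close>, uniformly for \<open>c\<close> bounded, when
  \<open>Re y = Re (x/h)\<close> tends to infinity. The factor \<open>F\<close> satisfies
  \<open>F(x + h) - F(x) = h (A(x + h) F(x + h) - F(x) A\<^sub>0) / x\<close>. Expanding in powers of \<open>1/x\<close>, with
  remainders that the type condition makes uniform in \<open>h\<close>, one obtains a recursion for the coefficients of \<open>F\<close>;
  by non-resonance it can be solved uniformly in \<open>h\<close>, so the coefficients tend to those of the Frobenius series.
  A discrete Gronwall estimate started at infinity bounds the error of the \<open>m\<close>-th truncation by
  \<open>K (Re x)\<^bsup>-m-1\<^esup>\<close> uniformly in \<open>h\<close>. From a vertical strip around \<open>Re x = X\<close>, the difference equation is a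
  consistent Euler scheme for the differential equation, run from right to left, whose errors grow at most like
  \<open>X\<^bsup>b\<^esup>\<close> with \<open>b\<close> independent of \<open>m\<close> and \<open>h\<close>; for \<open>m \<ge> b\<close> this gives convergence on a right half-plane.
  The same scheme, along horizontal segments that avoid \<open>0\<close> and the poles, carries the convergence to all of
  \<open>\<Omega>\<^sup>+\<close>.
\<close>

subsection \<open>Square matrices as a Banach algebra\<close>

text \<open>The obstacle is uniformity in h. For each single h the factor F has an expansion at
  infinity, but on a half-plane and with constants that depend on h. It serves only as a qualitative
  boundary condition: after m terms the remainder is of order m + 1 in 1/x, whereas the difference
  equation, read from right to left, amplifies errors at most like the b-th power of x, b being
  about four times a bound on the coefficients. For m at least b the contribution of infinity tends
  to 0 and takes the h-dependent constants with it; what remains is the residual of the truncation,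
  uniform in h. Dividing by e makes this possible, since F has a limit at infinity while E in
  general has none. Powers of 1/x are preferred to factorial series because they multiply simply,
  and the shift by h is the substitution of X/(1 + hX) for X = 1/x. The difference quotient of a
  power is formed without dividing by h, so that one recursion covers h > 0 and h = 0. Moreover E is
  only known to be meromorphic: boundedness excludes poles far to the right, and the functional
  equation carries analyticity to the left along steps that avoid 0 and the poles of A.\<close>

text \<open>A copy of the type is needed because \<open>*\<close> on \<open>vec\<close> is the entrywise product.\<close>

typedef ('n::finite) malg = "UNIV :: 'n cmat set"
  morphisms mat_of alg_of by simp

setup_lifting type_definition_malg

instantiation malg :: (finite) real_normed_algebra_1
begin

lift_definition zero_malg :: "'a malg" is "0" .
lift_definition one_malg :: "'a malg" is "mat 1" .
lift_definition plus_malg :: "'a malg \<Rightarrow> 'a malg \<Rightarrow> 'a malg" is "(+)" .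
lift_definition minus_malg :: "'a malg \<Rightarrow> 'a malg \<Rightarrow> 'a malg" is "(-)" .
lift_definition uminus_malg :: "'a malg \<Rightarrow> 'a malg" is "uminus" .
lift_definition times_malg :: "'a malg \<Rightarrow> 'a malg \<Rightarrow> 'a malg" is "(**)" .
lift_definition scaleR_malg :: "real \<Rightarrow> 'a malg \<Rightarrow> 'a malg" is "scaleR" .
text \<open>The operator norm is submultiplicative and gives the unit norm 1, as the class requires;
  the Euclidean norm of \<open>mat 1\<close> is the square root of n.\<close>

lift_definition norm_malg :: "'a malg \<Rightarrow> real" is "\<lambda>M. onorm ((*v) M)" .

definition dist_malg :: "'a malg \<Rightarrow> 'a malg \<Rightarrow> real" where
  "dist_malg x y = norm (x - y)"
definition sgn_malg :: "'a malg \<Rightarrow> 'a malg" where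
  "sgn_malg x = inverse (norm x) *\<^sub>R x"
definition uniformity_malg :: "('a malg \<times> 'a malg) filter" where
  "uniformity_malg = (INF e\<in>{0<..}. principal {(x, y). dist x y < e})"
definition open_malg :: "'a malg set \<Rightarrow> bool" where
  "open_malg U \<longleftrightarrow> (\<forall>x\<in>U. \<forall>\<^sub>F (x', y) in uniformity. x' = x \<longrightarrow> y \<in> U)"

instance
proof
  fix x y z :: "'a malg" and a b :: real and U :: "'a malg set"
  show "x + y + z = x + (y + z)" "x + y = y + x" "0 + x = x" "- x + x = 0" "x - y = x + - y"
    "a *\<^sub>R (x + y) = a *\<^sub>R x + a *\<^sub>R y" "(a + b) *\<^sub>R x = a *\<^sub>R x + b *\<^sub>R x"
    "a *\<^sub>R b *\<^sub>R x = (a * b) *\<^sub>R x" "1 *\<^sub>R x = x"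
    by (transfer; simp add: algebra_simps)+
  show "x * y * z = x * (y * z)" by (transfer; simp add: matrix_mul_assoc)
  show "(x + y) * z = x * z + y * z"
    by (transfer; simp add: vec_eq_iff matrix_matrix_mult_def algebra_simps sum.distrib)
  show "x * (y + z) = x * y + x * z"
    by (transfer; simp add: matrix_add_ldistrib)
  show "a *\<^sub>R x * y = a *\<^sub>R (x * y)" "x * a *\<^sub>R y = a *\<^sub>R (x * y)"
    by (transfer; simp add: vec_eq_iff matrix_matrix_mult_def scaleR_sum_right)+
  show "1 * x = x" "x * 1 = x" by (transfer; simp)+
  show "(0::'a malg) \<noteq> 1"
  proof transfer
    have "(0::'a cmat) $ undefined $ undefined \<noteq> mat 1 $ undefined $ undefined"
      by (simp add: mat_def)
    then show "(0::'a cmat) \<noteq> mat 1" by metis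
  qed
  show "dist x y = norm (x - y)" by (rule dist_malg_def)
  show "sgn x = inverse (norm x) *\<^sub>R x" by (rule sgn_malg_def)
  show "uniformity = (INF e\<in>{0<..}. principal {(x, y :: 'a malg). dist x y < e})"
    by (rule uniformity_malg_def)
  show "open U \<longleftrightarrow> (\<forall>x\<in>U. \<forall>\<^sub>F (x', y) in uniformity. x' = x \<longrightarrow> y \<in> U)"
    by (rule open_malg_def)
  show "norm x = 0 \<longleftrightarrow> x = 0"
  proof transfer
    fix x :: "'a cmat"
    show "onorm ((*v) x) = 0 \<longleftrightarrow> x = 0"
      by (subst onorm_eq_0) (auto simp: matrix_eq)
  qed
  show "norm (x + y) \<le> norm x + norm y"
  proof transfer
    fix x y :: "'a cmat"
    have "((*v) (x + y)) = (\<lambda>v. x *v v + y *v v)" by (auto simp: matrix_vector_mult_add_rdistrib)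
    then show "onorm ((*v) (x + y)) \<le> onorm ((*v) x) + onorm ((*v) y)"
      by (simp add: onorm_triangle)
  qed
  show "norm (a *\<^sub>R x) = \<bar>a\<bar> * norm x"
  proof transfer
    fix a and x :: "'a cmat"
    have "((*v) (a *\<^sub>R x)) = (\<lambda>v. a *\<^sub>R (x *v v))"
      by (auto simp: vec_eq_iff matrix_vector_mult_def scaleR_right.sum)
    then show "onorm ((*v) (a *\<^sub>R x)) = \<bar>a\<bar> * onorm ((*v) x)"
      by (simp add: onorm_scaleR)
  qed
  show "norm (x * y) \<le> norm x * norm y"
  proof transfer
    fix x y :: "'a cmat"
    have "((*v) (x ** y)) = ((*v) x \<circ> (*v) y)" by (auto simp: matrix_vector_mul_assoc)
    then show "onorm ((*v) (x ** y)) \<le> onorm ((*v) x) * onorm ((*v) y)"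
      by (simp add: onorm_compose)
  qed
  show "norm (1::'a malg) = 1"
  proof transfer
    have "((*v) (mat 1 :: 'a cmat)) = id" by auto
    moreover have "onorm (id :: complex^'a \<Rightarrow> complex^'a) = 1"
      by (simp add: id_def onorm_id)
    ultimately show "onorm ((*v) (mat 1 :: 'a cmat)) = 1" by simp
  qed
qed

end

section \<open>Entries of a matrix, and convergence entry by entry\<close>

definition ent :: "('n::finite) malg \<Rightarrow> 'n \<Rightarrow> 'n \<Rightarrow> complex" where
  "ent m i j = mat_of m $ i $ j"

lemma malg_eqI: "(\<And>i j. ent x i j = ent y i j) \<Longrightarrow> x = y"
  unfolding ent_def by transfer (simp add: vec_eq_iff)

lemma ent_alg_of [simp]: "ent (alg_of M) i j = M $ i $ j"
  by (simp add: ent_def alg_of_inverse)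

lemma ent_0 [simp]: "ent 0 i j = 0"
  and ent_1: "ent 1 i j = (if i = j then 1 else 0)"
  and ent_add [simp]: "ent (x + y) i j = ent x i j + ent y i j"
  and ent_diff [simp]: "ent (x - y) i j = ent x i j - ent y i j"
  and ent_minus [simp]: "ent (- x) i j = - ent x i j"
  and ent_scaleR [simp]: "ent (r *\<^sub>R x) i j = r *\<^sub>R ent x i j"
  and ent_mult: "ent (x * y) i j = (\<Sum>k\<in>UNIV. ent x i k * ent y k j)"
  by (simp_all add: ent_def zero_malg.rep_eq one_malg.rep_eq plus_malg.rep_eq minus_malg.rep_eq
      uminus_malg.rep_eq scaleR_malg.rep_eq times_malg.rep_eq matrix_matrix_mult_def mat_def)

lemma alg_of_add: "alg_of (M + M') = alg_of M + alg_of M'"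
  and alg_of_diff: "alg_of (M - M') = alg_of M - alg_of M'"
  and alg_of_mult: "alg_of (M ** M') = alg_of M * alg_of M'"
  and alg_of_mat_1 [simp]: "alg_of (mat 1) = 1"
  and alg_of_0 [simp]: "alg_of 0 = 0"
  by (simp_all add: plus_malg.abs_eq minus_malg.abs_eq times_malg.abs_eq one_malg.abs_eq zero_malg.abs_eq)

lemma norm_vec_le_sum: "norm (v :: 'a::real_normed_vector ^ 'n::finite) \<le> (\<Sum>i\<in>UNIV. norm (v $ i))"
  by (simp add: norm_vec_def L2_set_le_sum)

lemma norm_ent_le: "cmod (ent m i j) \<le> norm m"
proof -
  have "cmod (ent m i j) = cmod ((mat_of m *v axis j 1) $ i)"
    by (simp add: ent_def matrix_vector_mult_def axis_def if_distrib [of "\<lambda>x. _ * x"] cong: if_cong)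
  also have "\<dots> \<le> norm (mat_of m *v axis j 1)"
    by (rule Finite_Cartesian_Product.norm_nth_le)
  also have "\<dots> \<le> onorm ((*v) (mat_of m)) * norm (axis j (1::complex))"
    by (rule onorm) auto
  also have "\<dots> = norm m" by (simp add: norm_malg.rep_eq)
  finally show ?thesis .
qed

lemma norm_le_sum_ent: "norm (m :: ('n::finite) malg) \<le> (\<Sum>i\<in>UNIV. \<Sum>j\<in>UNIV. cmod (ent m i j))"
  unfolding norm_malg.rep_eq
proof (rule onorm_bound)
  show "0 \<le> (\<Sum>i\<in>UNIV. \<Sum>j\<in>UNIV. cmod (ent m i j))" by (intro sum_nonneg) auto
  fix v :: "complex^'n"
  have "norm (mat_of m *v v) \<le> (\<Sum>i\<in>UNIV. cmod ((mat_of m *v v) $ i))"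
    by (simp add: norm_vec_def L2_set_le_sum)
  also have "\<dots> \<le> (\<Sum>i\<in>UNIV. \<Sum>j\<in>UNIV. cmod (ent m i j) * norm v)"
    unfolding matrix_vector_mult_def ent_def
    by (simp, intro sum_mono order.trans[OF norm_sum])
      (auto simp: norm_mult intro!: mult_left_mono Finite_Cartesian_Product.norm_nth_le)
  finally show "norm (mat_of m *v v) \<le> (\<Sum>i\<in>UNIV. \<Sum>j\<in>UNIV. cmod (ent m i j)) * norm v"
    by (simp add: sum_distrib_right)
qed

lemma bounded_linear_ent: "bounded_linear (\<lambda>m. ent m i j)"
  by (rule bounded_linear_intro [where K = 1]) (auto simp: norm_ent_le)

text \<open>The norm lies between the modulus of each entry and the sum of all these moduli, so
  limits are entrywise. Completeness, infinite sums and continuity are reduced to scalars in this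
  way.\<close>

lemma tendsto_malg_iff:
  "(f \<longlongrightarrow> l) F \<longleftrightarrow> (\<forall>i j. ((\<lambda>x. ent (f x) i j) \<longlongrightarrow> ent l i j) F)"
proof
  assume *: "\<forall>i j. ((\<lambda>x. ent (f x) i j) \<longlongrightarrow> ent l i j) F"
  have "((\<lambda>x. \<Sum>i\<in>UNIV. \<Sum>j\<in>UNIV. cmod (ent (f x - l) i j)) \<longlongrightarrow>
      (\<Sum>i\<in>UNIV. \<Sum>j\<in>UNIV. cmod (ent l i j - ent l i j))) F"
    unfolding ent_diff by (intro tendsto_intros *[rule_format])
  then have "((\<lambda>x. \<Sum>i\<in>UNIV. \<Sum>j\<in>UNIV. cmod (ent (f x - l) i j)) \<longlongrightarrow> 0) F" by simp
  then have "((\<lambda>x. f x - l) \<longlongrightarrow> 0) F"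
    by (rule Lim_null_comparison [rotated]) (rule always_eventually, rule allI, rule norm_le_sum_ent)
  then show "(f \<longlongrightarrow> l) F" by (simp add: LIM_zero_iff)
qed (auto intro: bounded_linear.tendsto [OF bounded_linear_ent])

instance malg :: (finite) banach
proof
  fix X :: "nat \<Rightarrow> 'a malg"
  assume "Cauchy X"
  then have "Cauchy (\<lambda>n. ent (X n) i j)" for i j
    by (rule bounded_linear.Cauchy [OF bounded_linear_ent])
  then have "(\<lambda>n. ent (X n) i j) \<longlonglongrightarrow> lim (\<lambda>n. ent (X n) i j)" for i j
    by (simp add: Cauchy_convergent_iff convergent_LIMSEQ_iff)
  then have "X \<longlonglongrightarrow> alg_of (\<chi> i j. lim (\<lambda>n. ent (X n) i j))"
    by (simp add: tendsto_malg_iff)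
  then show "convergent X" by (rule convergentI)
qed

lemma ent_sum: "ent (sum f A) i j = (\<Sum>k\<in>A. ent (f k) i j)"
  by (rule bounded_linear.linear [OF bounded_linear_ent, THEN linear_sum])

lemma sums_malg_iff: "f sums l \<longleftrightarrow> (\<forall>i j. (\<lambda>n. ent (f n) i j) sums ent l i j)"
  unfolding sums_def by (subst tendsto_malg_iff) (simp add: ent_sum)

lemma tendsto_alg_of_iff: "((\<lambda>x. alg_of (f x)) \<longlongrightarrow> alg_of l) F \<longleftrightarrow> (f \<longlongrightarrow> l) F"
proof
  assume "((\<lambda>x. alg_of (f x)) \<longlongrightarrow> alg_of l) F"
  then show "(f \<longlongrightarrow> l) F"
    unfolding tendsto_malg_iff ent_alg_of by (intro vec_tendstoI) blast
next
  assume "(f \<longlongrightarrow> l) F"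
  then show "((\<lambda>x. alg_of (f x)) \<longlongrightarrow> alg_of l) F"
    unfolding tendsto_malg_iff ent_alg_of by (simp add: tendsto_vec_nth)
qed

lemma sums_alg_of_iff: "(\<lambda>n. alg_of (f n)) sums alg_of l \<longleftrightarrow> f sums l"
proof -
  have "(\<Sum>k<n. alg_of (f k)) = alg_of (\<Sum>k<n. f k)" for n
    by (induction n) (simp_all add: alg_of_add)
  then show ?thesis unfolding sums_def by (simp add: tendsto_alg_of_iff)
qed

lemma norm_mat_of_le: "norm (mat_of (m :: ('n::finite) malg)) \<le> real (CARD('n))^2 * norm m"
proof -
  have "norm (mat_of m) \<le> (\<Sum>i\<in>UNIV. norm (mat_of m $ i))"
    by (simp add: norm_vec_def L2_set_le_sum)
  also have "\<dots> \<le> (\<Sum>i\<in>(UNIV::'n set). \<Sum>j\<in>(UNIV::'n set). norm m)"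
    by (intro sum_mono order.trans[OF norm_vec_le_sum])
      (auto simp: ent_def [symmetric] norm_ent_le)
  finally show ?thesis by (simp add: power2_eq_square)
qed

text \<open>The type class only provides real scaling; a complex scalar acts as multiplication by a
  central element.\<close>

definition sc :: "complex \<Rightarrow> ('n::finite) malg" where
  "sc c = alg_of (mat c)"

lemma ent_sc: "ent (sc c) i j = (if i = j then c else 0)"
  by (simp add: sc_def mat_def)

lemma ent_sc_mult [simp]: "ent (sc c * x) i j = c * ent x i j"
  unfolding ent_mult ent_sc by (simp add: if_distrib [of "\<lambda>x. x * _"] cong: if_cong)

lemma ent_mult_sc [simp]: "ent (x * sc c) i j = c * ent x i j"
  unfolding ent_mult ent_sc by (simp add: if_distrib [of "\<lambda>x. _ * x"] cong: if_cong)

lemma sc_commute: "x * sc c = sc c * x"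
  by (rule malg_eqI) simp

lemma sc_0 [simp]: "sc 0 = 0" and sc_1 [simp]: "sc 1 = 1"
  and sc_add: "sc (a + b) = sc a + sc b" and sc_diff: "sc (a - b) = sc a - sc b"
  and sc_minus: "sc (- a) = - sc a"
  by (rule malg_eqI; simp add: ent_sc ent_1)+

lemma sc_mult: "sc (a * b) = sc a * sc b"
  by (rule malg_eqI) (simp only: ent_sc_mult, simp add: ent_sc)

lemma sc_power: "sc (a ^ n) = sc a ^ n"
  by (induction n) (simp_all add: sc_mult)

lemma sc_of_real: "sc (of_real r) = of_real r"
  proof -
  have "sc (of_real r) = r *\<^sub>R (1 :: 'a malg)"
    by (rule malg_eqI) (simp only: ent_scaleR, simp add: ent_sc ent_1 scaleR_conv_of_real)
  then show ?thesis by (simp add: of_real_def)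
qed

lemma norm_sc [simp]: "norm (sc c :: ('n::finite) malg) = cmod c"
proof -
  have "mat_of (sc c :: 'n malg) *v v = c *s v" for v
    by (simp add: sc_def alg_of_inverse vec_eq_iff matrix_vector_mult_def mat_def
      if_distrib [of "\<lambda>x. x * _"] cong: if_cong)
  moreover have "norm (c *s v) = cmod c * norm v" for v :: "complex^'n"
    by (simp add: norm_vec_def L2_set_def norm_mult power_mult_distrib sum_distrib_left [symmetric] real_sqrt_mult)
  ultimately have *: "norm (mat_of (sc c :: 'n malg) *v v) = cmod c * norm v" for v by metis
  show ?thesis
  proof (rule antisym)
    show "norm (sc c :: 'n malg) \<le> cmod c"
      unfolding norm_malg.rep_eq using * by (intro onorm_bound) auto
    show "cmod c \<le> norm (sc c :: 'n malg)"
      using norm_ent_le [of "sc c :: 'n malg" undefined undefined] by (simp add: ent_sc)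
  qed
qed

lemma alg_of_csmult: "alg_of (c *\<^sub>C M) = sc c * alg_of M"
  by (rule malg_eqI) (simp add: csmult_def)

lemma norm_sc_mult [simp]: "norm (sc c * x) = cmod c * norm x"
proof (cases "c = 0")
  case False
  have "norm x = norm (sc (1 / c) * (sc c * x))"
    using False by (simp add: mult.assoc [symmetric] sc_mult [symmetric])
  also have "\<dots> \<le> norm (sc (1 / c) :: 'a malg) * norm (sc c * x)" by (rule norm_mult_ineq)
  finally have "cmod c * norm x \<le> norm (sc c * x)" using False by (simp add: norm_divide field_simps)
  moreover have "norm (sc c * x) \<le> cmod c * norm x"
    using norm_mult_ineq [of "sc c" x] by simp
  ultimately show ?thesis by simp
qed simp

subsection \<open>Entire functions of a matrix\<close>

definition powser :: "(nat \<Rightarrow> complex) \<Rightarrow> (complex \<Rightarrow> complex) \<Rightarrow> bool" where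
  "powser a g \<longleftrightarrow> (\<forall>z. (\<lambda>m. a m * z ^ m) sums g z)"

text \<open>Holomorphic functional calculus for entire functions. Its argument is the coefficient
  sequence, which by \<open>powser_coeff\<close> is determined by the function.\<close>

definition fcalc :: "(nat \<Rightarrow> complex) \<Rightarrow> ('n::finite) malg \<Rightarrow> 'n malg" where
  "fcalc a M = (\<Sum>m. sc (a m) * M ^ m)"

lemma powser_entire:
  assumes "g holomorphic_on UNIV"
  shows "powser (\<lambda>m. (deriv ^^ m) g 0 / fact m) g"
  unfolding powser_def
proof
  fix z
  have "g holomorphic_on ball 0 (cmod z + 1)" using assms by (rule holomorphic_on_subset) auto
  then show "(\<lambda>m. (deriv ^^ m) g 0 / fact m * z ^ m) sums g z"
    using holomorphic_power_series [of g 0 "cmod z + 1" z] by simp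
qed

lemma powser_summable_norm:
  assumes "powser a g"
  shows "summable (\<lambda>m. cmod (a m) * r ^ m)"
proof -
  have "summable (\<lambda>m. a m * complex_of_real (\<bar>r\<bar> + 1) ^ m)"
    using assms unfolding powser_def by (meson sums_summable)
  from powser_insidea [OF this, of "complex_of_real r"]
  show ?thesis
    by (intro summable_norm_cancel [of "\<lambda>m. cmod (a m) * r ^ m"])
      (simp add: norm_mult norm_power abs_mult power_abs)
qed

lemma summable_fcalc:
  assumes "powser a g"
  shows "summable (\<lambda>m. norm (sc (a m) * M ^ m))"
proof (rule summable_comparison_test' [OF powser_summable_norm [OF assms, of "norm M"]])
  show "norm (norm (sc (a n) * M ^ n)) \<le> cmod (a n) * norm M ^ n" for n
    by (simp add: norm_power_ineq mult_left_mono)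
qed

lemma fcalc_sums: "powser a g \<Longrightarrow> (\<lambda>m. sc (a m) * M ^ m) sums fcalc a M"
  unfolding fcalc_def by (rule summable_sums [OF summable_norm_cancel [OF summable_fcalc]])

lemma powser_deriv:
  assumes "powser a g"
  shows "powser (diffs a) (deriv g)"
proof -
  have s: "summable (\<lambda>m. a m * z ^ m)" for z
    using assms unfolding powser_def by (meson sums_summable)
  have g: "g = (\<lambda>z. \<Sum>m. a m * z ^ m)"
    using assms unfolding powser_def by (auto simp: sums_iff)
  show ?thesis
    unfolding powser_def
  proof
    fix z
    have "DERIV g z :> (\<Sum>m. diffs a m * z ^ m)"
      unfolding g by (rule termdiffs_strong_converges_everywhere [OF s])
    then have "deriv g z = (\<Sum>m. diffs a m * z ^ m)" by (rule DERIV_imp_deriv)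
    moreover have "summable (\<lambda>m. diffs a m * z ^ m)"
      by (rule termdiff_converges_all [OF s])
    ultimately show "(\<lambda>m. diffs a m * z ^ m) sums deriv g z" by (simp add: sums_iff)
  qed
qed

lemma powser_higher_deriv:
  assumes "powser a g"
  shows "powser (\<lambda>n. fact (n + k) / fact n * a (n + k)) ((deriv ^^ k) g)"
proof (induction k)
  case (Suc k)
  have "diffs (\<lambda>n. fact (n + k) / fact n * a (n + k)) =
      (\<lambda>n. fact (n + Suc k) / fact n * a (n + Suc k))"
  proof
    fix n
    have "of_nat (Suc n) * (y / fact (Suc n) * w) = y / fact n * w" for y w :: complex
      by (simp add: fact_Suc del: of_nat_Suc)
    from this [of "fact (Suc n + k)"]
    show "diffs (\<lambda>n. fact (n + k) / fact n * a (n + k)) n = fact (n + Suc k) / fact n * a (n + Suc k)"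
      unfolding diffs_def by simp
  qed
  then show ?case using powser_deriv [OF Suc] by simp
qed (use assms in simp)

text \<open>The binomial factors are those of the entries at distance k from the diagonal in the
  m-th power of a Jordan block, so that the Taylor coefficients of \<open>g\<close> become the
  entries of \<open>g\<close> applied to that block.\<close>

lemma powser_taylor_sums:
  assumes "powser a g"
  shows "(\<lambda>m. a m * (of_nat (m choose k) * z ^ (m - k))) sums ((deriv ^^ k) g z / fact k)"
proof -
  have "(\<lambda>n. fact (n + k) / fact n * a (n + k) * z ^ n) sums (deriv ^^ k) g z"
    using powser_higher_deriv [OF assms, of k] unfolding powser_def by blast
  then have "(\<lambda>n. fact (n + k) / fact n * a (n + k) * z ^ n / fact k) sums ((deriv ^^ k) g z / fact k)"
    by (rule sums_divide)
  also have "(\<lambda>n. fact (n + k) / fact n * a (n + k) * z ^ n / fact k) =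
      (\<lambda>n. a (n + k) * (of_nat ((n + k) choose k) * z ^ (n + k - k)))"
    by (auto simp: fun_eq_iff binomial_fact field_simps)
  finally have "(\<lambda>n. a (n + k) * (of_nat ((n + k) choose k) * z ^ (n + k - k))) sums ((deriv ^^ k) g z / fact k)" .
  then show ?thesis
    by (subst (asm) sums_zero_iff_shift) (auto simp: binomial_eq_0)
qed

lemma powser_coeff: "powser a g \<Longrightarrow> a k = (deriv ^^ k) g 0 / fact k"
proof -
  assume "powser a g"
  from powser_taylor_sums [OF this, of k 0]
  have "(\<lambda>m. a m * (of_nat (m choose k) * 0 ^ (m - k))) sums ((deriv ^^ k) g 0 / fact k)" .
  moreover have "(\<lambda>m. a m * (of_nat (m choose k) * 0 ^ (m - k))) = (\<lambda>m. if m = k then a m else 0)"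
    by (auto simp: fun_eq_iff power_0_left binomial_eq_0)
  moreover have "(\<lambda>m. if m = k then a m else 0) sums a k" by (rule sums_single)
  ultimately show ?thesis by (metis sums_unique2)
qed

lemma powser_mult:
  assumes "powser a f" "powser b g"
  shows "powser (\<lambda>n. \<Sum>i\<le>n. a i * b (n - i)) (\<lambda>z. f z * g z)"
  unfolding powser_def
proof
  fix z
  have s: "(\<lambda>m. a m * z ^ m) sums f z" "(\<lambda>m. b m * z ^ m) sums g z"
    using assms unfolding powser_def by auto
  have n: "summable (\<lambda>m. cmod (a m * z ^ m))" "summable (\<lambda>m. cmod (b m * z ^ m))"
    using assms [THEN powser_summable_norm, of "cmod z"] by (simp_all add: norm_mult norm_power)
  have "(\<lambda>n. \<Sum>i\<le>n. (a i * z ^ i) * (b (n - i) * z ^ (n - i))) sums (f z * g z)"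
    using Cauchy_product_sums [OF n] s by (simp add: sums_iff)
  also have "(\<lambda>n. \<Sum>i\<le>n. (a i * z ^ i) * (b (n - i) * z ^ (n - i))) =
      (\<lambda>n. (\<Sum>i\<le>n. a i * b (n - i)) * z ^ n)"
    by (auto simp: fun_eq_iff sum_distrib_right power_add [symmetric] intro!: sum.cong)
  finally show "(\<lambda>n. (\<Sum>i\<le>n. a i * b (n - i)) * z ^ n) sums (f z * g z)" .
qed

lemma sum_sc: "sc (sum f A) = (\<Sum>i\<in>A. sc (f i))"
  by (rule malg_eqI) (auto simp: ent_sum ent_sc)

lemma fcalc_mult:
  assumes "powser a f" "powser b g"
  shows "fcalc (\<lambda>n. \<Sum>i\<le>n. a i * b (n - i)) M = fcalc a M * fcalc b M"
proof -
  have "(\<lambda>n. \<Sum>i\<le>n. (sc (a i) * M ^ i) * (sc (b (n - i)) * M ^ (n - i))) sums (fcalc a M * fcalc b M)"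
    using Cauchy_product_sums [OF summable_fcalc [OF assms(1), of M] summable_fcalc [OF assms(2), of M]]
    unfolding fcalc_def by simp
  also have "(\<lambda>n. \<Sum>i\<le>n. (sc (a i) * M ^ i) * (sc (b (n - i)) * M ^ (n - i))) =
      (\<lambda>n. sc (\<Sum>i\<le>n. a i * b (n - i)) * M ^ n)"
  proof
    fix n
    have "(sc (a i) * M ^ i) * (sc (b (n - i)) * M ^ (n - i)) = sc (a i * b (n - i)) * M ^ n" if "i \<le> n" for i
    proof -
      have "(sc (a i) * M ^ i) * (sc (b (n - i)) * M ^ (n - i)) =
          sc (a i) * (M ^ i * sc (b (n - i))) * M ^ (n - i)" by (simp add: mult.assoc)
      also have "\<dots> = (sc (a i) * sc (b (n - i))) * (M ^ i * M ^ (n - i))"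
        by (simp add: sc_commute [of "M ^ i"] mult.assoc)
      finally show ?thesis using that by (simp add: sc_mult power_add [symmetric])
    qed
    then show "(\<Sum>i\<le>n. (sc (a i) * M ^ i) * (sc (b (n - i)) * M ^ (n - i))) =
        sc (\<Sum>i\<le>n. a i * b (n - i)) * M ^ n"
      by (simp add: sum_sc sum_distrib_right)
  qed
  finally show ?thesis unfolding fcalc_def by (simp add: sums_iff)
qed

text \<open>Cauchy's inequalities on the circle of radius 2 r turn the terms into a geometric series
  of ratio 1/2, whence the factor 2. No Jordan form enters, so the bound is uniform over all
  matrices of norm at most r, however close their eigenvalues are.\<close>

lemma fcalc_bound:
  assumes "powser a g" "norm M \<le> r" "r > 0" "\<And>z. cmod z = 2 * r \<Longrightarrow> cmod (g z) \<le> e"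
  shows "norm (fcalc a M) \<le> 2 * e"
proof -
  have g: "g holomorphic_on UNIV"
  proof -
    have "g = (\<lambda>z. \<Sum>m. a m * z ^ m)"
      using assms(1) unfolding powser_def by (auto simp: sums_iff)
    moreover have "summable (\<lambda>m. a m * z ^ m)" for z
      using assms(1) unfolding powser_def by (meson sums_summable)
    ultimately have "DERIV g z :> (\<Sum>m. diffs a m * z ^ m)" for z
      using termdiffs_strong_converges_everywhere by metis
    then show ?thesis by (auto simp: holomorphic_on_def field_differentiable_def intro: has_field_derivative_at_within)
  qed
  have "cmod ((deriv ^^ m) g 0) \<le> fact m * e / (2 * r) ^ m" for m
    by (rule Cauchy_inequality)
      (use assms g in \<open>auto intro: holomorphic_on_subset holomorphic_on_imp_continuous_on\<close>)
  then have a: "cmod (a m) \<le> e / (2 * r) ^ m" for m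
    unfolding powser_coeff [OF assms(1), of m] by (simp add: norm_divide field_simps)
  have "norm (sc (a m) * M ^ m) \<le> e * (1/2) ^ m" for m
  proof -
    have "norm (sc (a m) * M ^ m) \<le> cmod (a m) * norm M ^ m"
      by (simp add: norm_power_ineq mult_left_mono)
    also have "\<dots> \<le> e / (2 * r) ^ m * r ^ m"
      using a [of m] assms by (intro mult_mono power_mono) (auto intro: order.trans [OF norm_ge_zero])
    also have "\<dots> = e * (1/2) ^ m" using assms(3) by (simp add: power_mult_distrib field_simps)
    finally show ?thesis .
  qed
  moreover have "(\<lambda>m. e * (1/2) ^ m) sums (e * 2)"
    using geometric_sums [of "1/2 :: real"] by (intro sums_mult) simp
  ultimately show ?thesis
    unfolding fcalc_def by (metis (no_types, lifting) mult.commute norm_suminf_le sums_iff)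
qed

lemma fcalc_exp: "fcalc (\<lambda>m. w ^ m / fact m) M = exp (sc w * M)"
  and powser_exp: "powser (\<lambda>m. w ^ m / fact m) (\<lambda>z. exp (w * z))"
proof -
  have "(sc w * M) ^ m = sc (w ^ m) * M ^ m" for m
  proof (induction m)
    case (Suc m)
    then show ?case by (simp add: sc_mult mult.assoc) (metis mult.assoc sc_commute)
  qed simp
  moreover have "sc (w ^ m / fact m) * N = (sc (w ^ m) * N) /\<^sub>R fact m" for m and N :: "'a malg"
    by (rule malg_eqI) (simp only: ent_scaleR ent_sc_mult, simp add: scaleR_conv_of_real field_simps)
  ultimately show "fcalc (\<lambda>m. w ^ m / fact m) M = exp (sc w * M)"
    unfolding fcalc_def exp_def by simp
  show "powser (\<lambda>m. w ^ m / fact m) (\<lambda>z. exp (w * z))"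
    unfolding powser_def using exp_converges [of "w * z" for z]
    by (auto simp: scaleR_conv_of_real power_mult_distrib field_simps)
qed

lemma fcalc_conj:
  assumes "powser a g" "Q' * Q = 1" "Q * Q' = 1"
  shows "fcalc a (Q * J * Q') = Q * fcalc a J * Q'"
proof -
  have p: "(Q * J * Q') ^ m = Q * J ^ m * Q'" for m
  proof (induction m)
    case (Suc m)
    have "(Q * J * Q') ^ Suc m = Q * J * (Q' * Q) * J ^ m * Q'" using Suc by (simp add: mult.assoc)
    then show ?case using assms by (simp add: mult.assoc)
  qed (use assms in simp)
  have "(\<lambda>m. Q * (sc (a m) * J ^ m) * Q') sums (Q * fcalc a J * Q')"
    by (intro sums_mult sums_mult2 fcalc_sums [OF assms(1)])
  also have "(\<lambda>m. Q * (sc (a m) * J ^ m) * Q') = (\<lambda>m. sc (a m) * (Q * J * Q') ^ m)"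
    unfolding p by (simp add: fun_eq_iff mult.assoc [symmetric] sc_commute [of Q])
  finally show ?thesis by (rule sums_unique2 [OF fcalc_sums [OF assms(1)]])
qed

subsection \<open>Block Toeplitz matrices\<close>

lemma card_atLeastLessThan_add:
  fixes i k j :: "'n::{finite,linorder}"
  assumes "i \<le> k" "k \<le> j"
  shows "card {i..<k} + card {k..<j} = card {i..<j}"
proof -
  have "{i..<j} = {i..<k} \<union> {k..<j}" using assms by auto
  then show ?thesis by (simp add: card_Un_disjoint ivl_disj_int)
qed

lemma bij_betw_card_atLeastLessThan:
  fixes i j :: "'n::{finite,linorder}"
  assumes "i \<le> j"
  shows "bij_betw (\<lambda>k. card {i..<k}) {i..j} {..card {i..<j}}"
proof -
  have "inj_on (\<lambda>k. card {i..<k}) {i..j}"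
  proof (rule linorder_inj_onI)
    fix x y assume xy: "x < y" "x \<in> {i..j}" "y \<in> {i..j}"
    then have "card {i..<x} + card {x..<y} = card {i..<y}"
      by (intro card_atLeastLessThan_add) auto
    moreover have "card {x..<y} > 0" using xy by (auto simp: card_gt_0_iff)
    ultimately show "card {i..<x} \<noteq> card {i..<y}" by simp
  qed auto
  moreover have "(\<lambda>k. card {i..<k}) ` {i..j} = {..card {i..<j}}"
  proof (rule card_subset_eq)
    show "(\<lambda>k. card {i..<k}) ` {i..j} \<subseteq> {..card {i..<j}}"
      by (auto intro!: card_mono)
    have "{i..j} = insert j {i..<j}" using assms by auto
    then show "card ((\<lambda>k. card {i..<k}) ` {i..j}) = card {..card {i..<j}}"
      using card_image [OF calculation] by simp
  qed auto
  ultimately show ?thesis by (simp add: bij_betw_def)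
qed

text \<open>Inside a block, Toeplitz matrices multiply like their symbols under the Cauchy product.
  Monotonicity of \<open>b\<close> makes blocks convex: an index between two indices of a block
  belongs to that block.\<close>

lemma block_toeplitz_mult:
  fixes b :: "'n::{finite,linorder} \<Rightarrow> nat"
  assumes "mono b"
  shows "block_toeplitz f b c ** block_toeplitz g b c =
    block_toeplitz (\<lambda>\<gamma> d. \<Sum>k\<le>d. f \<gamma> k * g \<gamma> (d - k)) b c" (is "?A ** ?B = ?C")
proof -
  have "(\<Sum>k\<in>UNIV. ?A $ i $ k * ?B $ k $ j) = ?C $ i $ j" for i j
  proof (cases "b i = b j \<and> i \<le> j")
    case True
    have b: "b k = b j" if "k \<in> {i..j}" for k
      using that True monoD [OF assms, of i k] monoD [OF assms, of k j] by auto
    have "(\<Sum>k\<in>UNIV. ?A $ i $ k * ?B $ k $ j) = (\<Sum>k\<in>{i..j}. ?A $ i $ k * ?B $ k $ j)"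
      by (rule sum.mono_neutral_right) (auto simp: block_toeplitz_def)
    also have "\<dots> = (\<Sum>k\<in>{i..j}. f (c (b j)) (card {i..<k}) * g (c (b j)) (card {i..<j} - card {i..<k}))"
    proof (rule sum.cong [OF refl])
      fix k assume k: "k \<in> {i..j}"
      have "card {k..<j} = card {i..<j} - card {i..<k}"
        using card_atLeastLessThan_add [of i k j] k by simp
      then show "?A $ i $ k * ?B $ k $ j =
          f (c (b j)) (card {i..<k}) * g (c (b j)) (card {i..<j} - card {i..<k})"
        using k True b [OF k] by (simp add: block_toeplitz_def)
    qed
    also have "\<dots> = (\<Sum>k\<le>card {i..<j}. f (c (b j)) k * g (c (b j)) (card {i..<j} - k))"
      using True by (intro sum.reindex_bij_betw bij_betw_card_atLeastLessThan) auto
    finally show ?thesis using True by (simp add: block_toeplitz_def)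
  next
    case False
    then have "(\<Sum>k\<in>UNIV. ?A $ i $ k * ?B $ k $ j) = 0"
      by (intro sum.neutral) (auto simp: block_toeplitz_def)
    then show ?thesis using False by (auto simp: block_toeplitz_def)
  qed
  then show ?thesis by (simp add: vec_eq_iff matrix_matrix_mult_def)
qed

text \<open>One more Jordan factor multiplies an entry by \<gamma> and adds the entry one step
  nearer to the diagonal, which is Pascal's rule.\<close>

lemma jordan_mat_power:
  assumes "mono b"
  shows "alg_of (jordan_mat b c) ^ m =
    alg_of (block_toeplitz (\<lambda>\<gamma> d. of_nat (m choose d) * \<gamma> ^ (m - d)) b c)"
proof (induction m)
  case 0
  have "0 < card {i..<j}" if "i \<noteq> j" "i \<le> j" for i j :: 'a
    using that by (simp add: card_gt_0_iff)
  then show ?case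
    by (intro malg_eqI) (auto simp: ent_1 block_toeplitz_def binomial_eq_0_iff)
next
  case (Suc m)
  have *: "(\<Sum>k\<le>d. (if k = 0 then \<gamma> else if k = 1 then 1 else 0) *
      (of_nat (m choose (d - k)) * \<gamma> ^ (m - (d - k)))) = of_nat (Suc m choose d) * \<gamma> ^ (Suc m - d)"
    (is "?l = ?r") for d and \<gamma> :: complex
  proof (cases d)
    case (Suc e)
    have "?l = (\<Sum>k\<in>{0,1}. (if k = 0 then \<gamma> else if k = 1 then 1 else 0) *
        (of_nat (m choose (d - k)) * \<gamma> ^ (m - (d - k))))"
      by (rule sum.mono_neutral_right) (auto simp: Suc)
    also have "\<dots> = of_nat (m choose d) * (\<gamma> * \<gamma> ^ (m - d)) + of_nat (m choose e) * \<gamma> ^ (m - e)"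
      using Suc by simp
    \<comment> \<open>For d > m the truncated subtraction spoils the exponents, but then the
      binomial coefficient is 0.\<close>
    also have "of_nat (m choose d) * (\<gamma> * \<gamma> ^ (m - d)) = of_nat (m choose d) * \<gamma> ^ (m - e)"
    proof (cases "d \<le> m")
      case True
      then have "m - e = Suc (m - d)" using Suc by simp
      then show ?thesis by simp
    qed (simp add: binomial_eq_0)
    finally show ?thesis using Suc by (simp add: algebra_simps)
  qed simp
  show ?case
    unfolding power_Suc Suc alg_of_mult [symmetric]
    unfolding jordan_mat_def block_toeplitz_mult [OF assms] * ..
qed

lemma fcalc_jordan_mat:
  assumes "powser a g" "mono b"
  shows "fcalc a (alg_of (jordan_mat b c)) =
    alg_of (block_toeplitz (\<lambda>\<gamma> k. (deriv ^^ k) g \<gamma> / fact k) b c)"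
proof -
  have "(\<lambda>m. sc (a m) * alg_of (jordan_mat b c) ^ m) sums
      alg_of (block_toeplitz (\<lambda>\<gamma> k. (deriv ^^ k) g \<gamma> / fact k) b c)"
    unfolding sums_malg_iff jordan_mat_power [OF assms(2)]
    using powser_taylor_sums [OF assms(1)] by (auto simp: block_toeplitz_def)
  then show ?thesis by (rule sums_unique2 [OF fcalc_sums [OF assms(1)]])
qed

text \<open>Whatever the Jordan reduction, the resulting matrix is the functional calculus of
  \<open>M\<close> itself. So it does not depend on the reduction, and the definite description in
  \<open>e_matrix\<close> denotes.\<close>

lemma e_matrix_eq_fcalc:
  assumes a: "powser a (\<lambda>\<gamma>. e_char h \<gamma> x)" and "jordan_reduction M Q b c"
  shows "alg_of (e_matrix h M x) = fcalc a (alg_of M)"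
proof -
  have *: "alg_of (Q ** block_toeplitz (\<lambda>\<gamma> k. l_log h \<gamma> k x) b c ** matrix_inv Q) = fcalc a (alg_of M)"
    if "jordan_reduction M Q b c" for Q b c
  proof -
    have M: "mono b" "invertible Q" "M = Q ** jordan_mat b c ** matrix_inv Q"
      using that by (auto simp: jordan_reduction_def)
    have "alg_of (matrix_inv Q) * alg_of Q = 1" "alg_of Q * alg_of (matrix_inv Q) = 1"
      using someI_ex [OF M(2)[unfolded invertible_def]] unfolding matrix_inv_def by (simp_all add: alg_of_mult [symmetric])
    then show ?thesis
      by (simp add: M(3) alg_of_mult fcalc_conj [OF a] fcalc_jordan_mat [OF a M(1)] l_log_def)
  qed
  have "e_matrix h M x = Q ** block_toeplitz (\<lambda>\<gamma> k. l_log h \<gamma> k x) b c ** matrix_inv Q"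
    unfolding e_matrix_def
    by (rule the_equality) (use assms(2) * in \<open>metis alg_of_inject UNIV_I\<close>)+
  then show ?thesis using * [OF assms(2)] by simp
qed

subsection \<open>The ratio of Gamma functions\<close>

text \<open>The quotient of \<open>e_char h \<gamma> x\<close> by the \<gamma>-th power of x, with y
  = x/h; the powers of h cancel. The use of \<open>rGamma\<close> makes it visibly entire in
  \<gamma>.\<close>

definition gamma_factor :: "complex \<Rightarrow> complex \<Rightarrow> complex" where
  "gamma_factor y \<gamma> = Gamma y * rGamma (y - \<gamma>) * exp (- \<gamma> * Ln y)"

lemma Ln_add_1:
  assumes "Re z > 0"
  shows "Ln (z + 1) = Ln z + Ln (1 + 1 / z)"
proof -
  have *: "Re (1 + 1 / z) > 0" using assms by (simp add: Re_divide add_pos_nonneg)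
  have nz: "1 + 1 / z \<noteq> 0" using * by (metis less_irrefl zero_complex.simps(1))
  have "\<bar>Im (Ln z)\<bar> < pi / 2" "\<bar>Im (Ln (1 + 1 / z))\<bar> < pi / 2"
    using Re_Ln_pos_lt_imp assms * by blast+
  then have "Ln (z * (1 + 1 / z)) = Ln z + Ln (1 + 1 / z)"
    using assms * nz by (intro Ln_times_simple) auto
  moreover have "z * (1 + 1 / z) = z + 1" using assms by (auto simp: field_simps)
  ultimately show ?thesis by simp
qed

lemma Ln_times_of_real': "r > 0 \<Longrightarrow> z \<noteq> 0 \<Longrightarrow> Ln (of_real r * z) = of_real (ln r) + Ln z"
  using Ln_times_of_real [of r z] by (simp add: Ln_of_real)

lemma prod_Ln_add_1:
  assumes "Re y > 0"
  shows "(\<Prod>j\<le>n. exp (\<gamma> * Ln (1 + 1 / (y + of_nat j)))) = exp (\<gamma> * (Ln (y + of_nat (Suc n)) - Ln y))"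
proof (induction n)
  case 0
  show ?case using Ln_add_1 [OF assms] by simp
next
  case (Suc n)
  have "Re (y + of_nat (Suc n)) > 0" using assms by simp
  from Ln_add_1 [OF this] show ?case
    using Suc by (simp add: exp_add [symmetric] algebra_simps)
qed

text \<open>The quotient of the two Gauss products leaves the \<gamma>-th power of n. Telescoping
  logarithms distribute this power over the factors, each of which is then 1 + O(1/(y + j)^2), so
  that the product can be estimated uniformly.\<close>

lemma gamma_factor_LIMSEQ:
  assumes "Re y > 0"
  shows "(\<lambda>n. \<Prod>j\<le>n. exp (\<gamma> * Ln (1 + 1 / (y + of_nat j))) * (1 - \<gamma> / (y + of_nat j)))
    \<longlonglongrightarrow> gamma_factor y \<gamma>"
proof -
  have nz: "y + of_nat j \<noteq> 0" for j using assms by (auto simp: complex_eq_iff)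
  have ynp: "y \<notin> \<int>\<^sub>\<le>\<^sub>0" using assms by (auto elim!: nonpos_Ints_cases)
  have "(\<lambda>n. rGamma_series (y - \<gamma>) n / rGamma_series y n) \<longlonglongrightarrow> rGamma (y - \<gamma>) / rGamma y"
    by (intro tendsto_divide rGamma_series_LIMSEQ) (use ynp in \<open>simp add: rGamma_eq_zero_iff\<close>)
  \<comment> \<open>Replacing n by y + n + 1 in the \<gamma>-th power costs a factor that tends to
    1; the term with \<open>Ln y\<close> supplies the remaining factor of
    \<open>gamma_factor\<close>.\<close>
  moreover have "(\<lambda>n. exp (\<gamma> * (Ln (y + of_nat (Suc n)) - of_real (ln (real n)) - Ln y))) \<longlonglongrightarrow>
      exp (\<gamma> * (0 - Ln y))"
  proof (intro tendsto_intros)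
    have "(\<lambda>n. Ln (1 + (y + 1) / of_nat n)) \<longlonglongrightarrow> Ln (1 + 0)"
      by (intro tendsto_intros tendsto_divide_0 [OF tendsto_const] tendsto_of_nat) auto
    moreover have "\<forall>\<^sub>F n in sequentially. Ln (1 + (y + 1) / of_nat n) =
        Ln (y + of_nat (Suc n)) - of_real (ln (real n))"
      using eventually_gt_at_top [of 0]
    proof eventually_elim
      case (elim n)
      have "1 + (y + 1) / of_nat n \<noteq> 0"
        using elim nz [of "Suc n"] by (simp add: field_simps)
      then have "Ln (of_real (real n) * (1 + (y + 1) / of_nat n)) = of_real (ln (real n)) + Ln (1 + (y + 1) / of_nat n)"
        using elim by (intro Ln_times_of_real') auto
      moreover have "of_real (real n) * (1 + (y + 1) / of_nat n) = y + of_nat (Suc n)"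
        using elim by (simp add: field_simps)
      ultimately show ?case by simp
    qed
    ultimately show "(\<lambda>n. Ln (y + of_nat (Suc n)) - of_real (ln (real n))) \<longlonglongrightarrow> 0"
      by (simp add: Lim_transform_eventually)
  qed
  ultimately have "(\<lambda>n. rGamma_series (y - \<gamma>) n / rGamma_series y n *
      exp (\<gamma> * (Ln (y + of_nat (Suc n)) - of_real (ln (real n)) - Ln y))) \<longlonglongrightarrow>
      rGamma (y - \<gamma>) / rGamma y * exp (\<gamma> * (0 - Ln y))"
    by (rule tendsto_mult)
  moreover have "rGamma (y - \<gamma>) / rGamma y * exp (\<gamma> * (0 - Ln y)) = gamma_factor y \<gamma>"
    by (simp add: gamma_factor_def rGamma_inverse_Gamma field_simps)
  moreover have "rGamma_series (y - \<gamma>) n / rGamma_series y n *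
      exp (\<gamma> * (Ln (y + of_nat (Suc n)) - of_real (ln (real n)) - Ln y)) =
      (\<Prod>j\<le>n. exp (\<gamma> * Ln (1 + 1 / (y + of_nat j))) * (1 - \<gamma> / (y + of_nat j)))" for n
  proof -
    have "rGamma_series (y - \<gamma>) n / rGamma_series y n =
        (pochhammer (y - \<gamma>) (n + 1) / pochhammer y (n + 1)) *
        (exp (y * of_real (ln (real n))) / exp ((y - \<gamma>) * of_real (ln (real n))))"
      by (simp add: rGamma_series_def)
    also have "exp (y * of_real (ln (real n))) / exp ((y - \<gamma>) * of_real (ln (real n))) =
        exp (\<gamma> * of_real (ln (real n)))"
      by (simp add: exp_diff [symmetric] algebra_simps)
    also have "pochhammer (y - \<gamma>) (n + 1) / pochhammer y (n + 1) =
        (\<Prod>j\<le>n. 1 - \<gamma> / (y + of_nat j))"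
    proof -
      have "1 - \<gamma> / (y + of_nat j) = (y - \<gamma> + of_nat j) / (y + of_nat j)" for j
        using nz [of j] by (simp add: field_simps)
      then show ?thesis
        by (simp only: pochhammer_prod prod_dividef [symmetric] Suc_eq_plus1 [symmetric]
            atLeast0LessThan lessThan_Suc_atMost)
    qed
    finally have "rGamma_series (y - \<gamma>) n / rGamma_series y n *
        exp (\<gamma> * (Ln (y + of_nat (Suc n)) - of_real (ln (real n)) - Ln y)) =
        (\<Prod>j\<le>n. 1 - \<gamma> / (y + of_nat j)) * (exp (\<gamma> * of_real (ln (real n))) *
        exp (\<gamma> * (Ln (y + of_nat (Suc n)) - of_real (ln (real n)) - Ln y)))"
      by (simp only: mult.assoc)
    also have "exp (\<gamma> * of_real (ln (real n))) *
        exp (\<gamma> * (Ln (y + of_nat (Suc n)) - of_real (ln (real n)) - Ln y)) =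
        exp (\<gamma> * (Ln (y + of_nat (Suc n)) - Ln y))"
      by (simp add: exp_add [symmetric] algebra_simps del: of_nat_Suc)
    finally show ?thesis
      by (simp only: prod.distrib prod_Ln_add_1 [OF assms] mult.commute)
  qed
  ultimately show ?thesis by simp
qed

lemma sum_inverse_squares_le:
  fixes \<xi> :: real
  assumes "\<xi> > 1"
  shows "(\<Sum>j\<le>n. 1 / (\<xi> + real j)\<^sup>2) \<le> 1 / (\<xi> - 1)"
proof -
  have "(\<Sum>j\<le>n. 1 / (\<xi> + real j)\<^sup>2) \<le> 1 / (\<xi> - 1) - 1 / (\<xi> + real n)"
  proof (induction n)
    case 0
    show ?case using assms by (simp add: divide_simps power2_eq_square)
  next
    case (Suc n)
    have "1 / (\<xi> + real (Suc n))\<^sup>2 \<le> 1 / (\<xi> + real n) - 1 / (\<xi> + real (Suc n))"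
      using assms by (simp add: divide_simps power2_eq_square)
    then show ?case using Suc by simp
  qed
  also have "\<dots> \<le> 1 / (\<xi> - 1)" using assms by simp
  finally show ?thesis .
qed

text \<open>The logarithm of the product is a sum of terms of size C/(Re y + j)^2, hence at most
  C/(Re y - 1); the exponential is continuous at 0. Only a bound on \<gamma> enters.\<close>

lemma gamma_factor_tendsto_1:
  assumes "\<rho> \<ge> 0" "\<epsilon> > 0"
  obtains Y where "Y > 0" "\<And>y \<gamma>. Re y \<ge> Y \<Longrightarrow> cmod \<gamma> \<le> \<rho> \<Longrightarrow> cmod (gamma_factor y \<gamma> - 1) \<le> \<epsilon>"
proof -
  \<comment> \<open>\<open>C\<close> collects the quadratic remainders of the two logarithms. In
    \<open>Y\<close> below, 2 and 2 \<rho> keep the arguments of both logarithms within 1/2 of 1,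
    and the last entry makes C/(Re y - 1) smaller than \<open>d\<close>.\<close>
  define C where "C = 2 * \<rho> + 2 * \<rho>\<^sup>2"
  have "C \<ge> 0" using assms by (simp add: C_def)
  obtain d where d: "d > 0" "\<And>S::complex. cmod S < d \<Longrightarrow> cmod (exp S - 1) < \<epsilon>"
    using continuous_at_eps_delta [of "0::complex" exp] assms(2)
    by (auto simp: dist_norm isCont_exp elim!: allE [of _ \<epsilon>])
  define Y where "Y = Max {2, 2 * \<rho>, 1 + (C + 1) / d}"
  have Y: "Y \<ge> 2" "Y \<ge> 2 * \<rho>" "Y \<ge> 1 + (C + 1) / d" by (auto simp: Y_def)
  have main: "cmod (gamma_factor y \<gamma> - 1) \<le> \<epsilon>" if y: "Re y \<ge> Y" and \<gamma>: "cmod \<gamma> \<le> \<rho>" for y \<gamma>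
  proof -
    have pos: "Re y > 1" using y Y by simp
    define t where "t j = \<gamma> * Ln (1 + 1 / (y + of_nat j)) + Ln (1 + - \<gamma> / (y + of_nat j))" for j
    have ny: "cmod (y + of_nat j) \<ge> Re y + real j" "y + of_nat j \<noteq> 0" for j
      using complex_Re_le_cmod [of "y + of_nat j"] pos by auto
    have bound: "cmod (t j) \<le> C * (1 / (Re y + real j)\<^sup>2)"
      and ex: "exp (t j) = exp (\<gamma> * Ln (1 + 1 / (y + of_nat j))) * (1 - \<gamma> / (y + of_nat j))" for j
    proof -
      define w where "w = 1 / (y + of_nat j)"
      have w: "cmod w \<le> 1 / (Re y + real j)"
        using ny [of j] pos by (simp add: w_def norm_divide frac_le)
      also have "\<dots> \<le> 1 / 2" using pos y Y by (intro frac_le) auto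
      finally have w2: "cmod w \<le> 1 / 2" .
      have "cmod (\<gamma> * w) \<le> \<rho> * (1 / (Re y + real j))"
        unfolding norm_mult using w \<gamma> by (intro mult_mono) (auto simp: assms)
      also have "\<dots> \<le> 1 / 2" using pos y Y by (simp add: field_simps)
      finally have gw: "cmod (\<gamma> * w) \<le> 1 / 2" .
      have lin: "cmod (Ln (1 + z) - z) \<le> 2 * (cmod z)\<^sup>2" if "cmod z \<le> 1 / 2" for z
      proof -
        have "cmod (Ln (1 + z) - z) \<le> (cmod z)\<^sup>2 / (1 - cmod z)"
          using that by (intro Ln_approx_linear) auto
        also have "\<dots> \<le> (cmod z)\<^sup>2 / (1 / 2)" using that by (intro divide_left_mono) auto
        finally show ?thesis by simp
      qed
      \<comment> \<open>The first-order terms \<gamma> w and - \<gamma> w cancel; this is why the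
        factors were paired.\<close>
      have t: "t j = \<gamma> * (Ln (1 + w) - w) + (Ln (1 + - (\<gamma> * w)) - - (\<gamma> * w))"
        by (simp add: t_def w_def algebra_simps)
      have "cmod (t j) \<le> cmod \<gamma> * (2 * (cmod w)\<^sup>2) + 2 * (cmod (\<gamma> * w))\<^sup>2"
        unfolding t using lin [OF w2] lin [of "- (\<gamma> * w)"] gw
        by (intro norm_triangle_mono) (auto simp: norm_mult intro!: mult_left_mono)
      also have "\<dots> = (2 * cmod \<gamma> + 2 * (cmod \<gamma>)\<^sup>2) * (cmod w)\<^sup>2"
        by (simp add: norm_mult power_mult_distrib algebra_simps)
      also have "\<dots> \<le> C * (1 / (Re y + real j))\<^sup>2"
        unfolding C_def using w \<gamma> assms by (intro mult_mono add_mono power_mono mult_left_mono) auto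
      finally show "cmod (t j) \<le> C * (1 / (Re y + real j)\<^sup>2)" by (simp add: power_divide)
      have "1 + - (\<gamma> * w) \<noteq> 0" using gw by auto
      then show "exp (t j) = exp (\<gamma> * Ln (1 + 1 / (y + of_nat j))) * (1 - \<gamma> / (y + of_nat j))"
        by (simp add: t_def w_def exp_add)
    qed
    have "cmod ((\<Prod>j\<le>n. exp (\<gamma> * Ln (1 + 1 / (y + of_nat j))) * (1 - \<gamma> / (y + of_nat j))) - 1) \<le> \<epsilon>" for n
    proof -
      have "cmod (\<Sum>j\<le>n. t j) \<le> (\<Sum>j\<le>n. C * (1 / (Re y + real j)\<^sup>2))"
        by (rule order.trans [OF norm_sum sum_mono]) (rule bound)
      also have "\<dots> \<le> C * (1 / (Re y - 1))"
        unfolding sum_distrib_left [symmetric]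
        using sum_inverse_squares_le [OF pos] \<open>C \<ge> 0\<close> by (rule mult_left_mono)
      also have "\<dots> < d"
      proof -
        have "(C + 1) / d \<le> Re y - 1" using y Y(3) by simp
        then have "C + 1 \<le> (Re y - 1) * d" using d(1) by (simp add: pos_divide_le_eq)
        then show ?thesis using pos by (simp add: field_simps)
      qed
      finally have "cmod (exp (\<Sum>j\<le>n. t j) - 1) < \<epsilon>" by (rule d(2))
      then show ?thesis by (simp add: exp_sum ex)
    qed
    then show ?thesis
      using pos by (intro Lim_norm_ubound [OF _ tendsto_diff [OF gamma_factor_LIMSEQ tendsto_const]]) auto
  qed
  show ?thesis by (rule that [of Y]) (use Y main in auto)
qed

subsection \<open>The matrix function attached to the constant system\<close>

lemma powser_e_char: 
  assumes "h > 0"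
  shows "powser (\<lambda>m. (deriv ^^ m) (\<lambda>\<gamma>. e_char h \<gamma> x) 0 / fact m) (\<lambda>\<gamma>. e_char h \<gamma> x)"
proof (rule powser_entire)
  have "(\<lambda>\<gamma>. e_char h \<gamma> x) = (\<lambda>\<gamma>. exp (\<gamma> * Ln (of_real h)) * (Gamma (x / of_real h) * rGamma (x / of_real h - \<gamma>)))"
    using assms by (auto simp: e_char_def powr_def rGamma_inverse_Gamma field_simps)
  then show "(\<lambda>\<gamma>. e_char h \<gamma> x) holomorphic_on UNIV"
    by (auto intro!: holomorphic_intros)
qed

text \<open>\<open>fcalc_bound\<close> is applied to the small function \<open>gamma_factor\<close>
  minus 1; here the 1 is put back.\<close>

lemma powser_add_1:
  assumes "powser a (\<lambda>z. g z - 1)"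
  shows "powser (\<lambda>m. a m + (if m = 0 then 1 else 0)) g"
    and "fcalc (\<lambda>m. a m + (if m = 0 then 1 else 0)) M = fcalc a M + 1"
proof -
  have e: "(if m = 0 then 1 else 0) * z ^ m = (if m = 0 then 1 else 0)" for m and z :: complex by simp
  show "powser (\<lambda>m. a m + (if m = 0 then 1 else 0)) g"
    unfolding powser_def
  proof
    fix z
    have "(\<lambda>m. a m * z ^ m + (if m = 0 then 1 else 0)) sums (g z - 1 + 1)"
      using assms unfolding powser_def by (intro sums_add) (auto simp: sums_single [of 0 "\<lambda>_. 1"])
    then show "(\<lambda>m. (a m + (if m = 0 then 1 else 0)) * z ^ m) sums g z"
      by (simp add: distrib_right e)
  qed
  have "(\<lambda>m. sc (a m) * M ^ m + (if m = 0 then 1 else 0)) sums (fcalc a M + 1)"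
    by (intro sums_add fcalc_sums [OF assms] sums_single [of 0 "\<lambda>_. 1"])
  also have "(\<lambda>m. sc (a m) * M ^ m + (if m = 0 then 1 else 0)) =
      (\<lambda>m. sc (a m + (if m = 0 then 1 else 0)) * M ^ m)"
    by (auto simp: fun_eq_iff sc_add)
  finally show "fcalc (\<lambda>m. a m + (if m = 0 then 1 else 0)) M = fcalc a M + 1"
    unfolding fcalc_def by (simp add: sums_iff)
qed

text \<open>\<open>e_char\<close> is the product of exp(\<gamma> Ln x) and
  \<open>gamma_factor\<close>, and the functional calculus is multiplicative, so \<open>K\<close> is
  the calculus of \<open>gamma_factor\<close>. The threshold concerns Re x / h only and is common to
  all matrices of norm at most \<rho>.\<close>

lemma e_matrix_asymp:
  assumes "\<rho> > 0" "\<epsilon> > 0"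
  obtains Y where "Y > 0" "\<And>h x M Q b c. h > 0 \<Longrightarrow> Re x \<ge> Y * h \<Longrightarrow> jordan_reduction M Q b c \<Longrightarrow>
    norm (alg_of M) \<le> \<rho> \<Longrightarrow>
    \<exists>K. alg_of (e_matrix h M x) = exp (sc (Ln x) * alg_of M) * K \<and> norm (K - 1) \<le> \<epsilon>"
proof -
  \<comment> \<open>The radius 2 \<rho> and the tolerance \<epsilon> / 2 are dictated by
    \<open>fcalc_bound\<close>.\<close>
  obtain Y where Y: "Y > 0" "\<And>y \<gamma>. Re y \<ge> Y \<Longrightarrow> cmod \<gamma> \<le> 2 * \<rho> \<Longrightarrow> cmod (gamma_factor y \<gamma> - 1) \<le> \<epsilon> / 2"
    using gamma_factor_tendsto_1 [of "2 * \<rho>" "\<epsilon> / 2"] assms by auto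
  show ?thesis
  proof (rule that [OF Y(1)])
    fix h x and M :: "'a cmat" and Q b c
    assume h: "h > 0" "Re x \<ge> Y * h" and J: "jordan_reduction M Q b c" "norm (alg_of M) \<le> \<rho>"
    define y where "y = x / of_real h"
    have y: "Re y \<ge> Y" using h by (simp add: y_def field_simps)
    have "Re x > 0" using h Y(1) by (smt (verit) mult_pos_pos)
    have "(\<lambda>\<gamma>. gamma_factor y \<gamma> - 1) holomorphic_on UNIV"
      unfolding gamma_factor_def by (auto intro!: holomorphic_intros)
    then obtain a where a: "powser a (\<lambda>\<gamma>. gamma_factor y \<gamma> - 1)" using powser_entire by blast
    define K where "K = fcalc a (alg_of M) + 1"
    have "x = of_real h * y" using h by (simp add: y_def)
    then have Lnx: "Ln x = of_real (ln h) + Ln y"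
      using h \<open>Re x > 0\<close> by (subst \<open>x = _\<close>, subst Ln_times_of_real') auto
    have "exp (Ln x * \<gamma>) * gamma_factor y \<gamma> = e_char h \<gamma> x" for \<gamma>
      unfolding Lnx using h
      by (simp add: gamma_factor_def e_char_def rGamma_inverse_Gamma powr_def y_def [symmetric] exp_add exp_minus
          distrib_right Ln_of_real field_simps)
    then have *: "powser (\<lambda>n. \<Sum>i\<le>n. Ln x ^ i / fact i * (a (n - i) + (if n - i = 0 then 1 else 0)))
        (\<lambda>\<gamma>. e_char h \<gamma> x)"
      using powser_mult [OF powser_exp powser_add_1(1) [OF a], of "Ln x"] by simp
    have "alg_of (e_matrix h M x) = exp (sc (Ln x) * alg_of M) * K"
      unfolding e_matrix_eq_fcalc [OF * J(1)] fcalc_mult [OF powser_exp powser_add_1(1) [OF a]]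
        fcalc_exp powser_add_1(2) [OF a] K_def ..
    moreover have "norm (K - 1) \<le> 2 * (\<epsilon> / 2)"
      unfolding K_def using fcalc_bound [OF a J(2) assms(1), of "\<epsilon> / 2"] Y(2) [OF y] by simp
    ultimately show "\<exists>K. alg_of (e_matrix h M x) = exp (sc (Ln x) * alg_of M) * K \<and> norm (K - 1) \<le> \<epsilon>"
      by auto
  qed
qed

text \<open>For scalars this is the functional equation of \<Gamma>. The factor 1 - h \<gamma> / x
  is a polynomial in \<gamma>, so multiplicativity of the functional calculus carries the identity
  over to \<open>M\<close>.\<close>

lemma e_matrix_step:
  assumes h: "h > 0" "Re x > 0" and J: "jordan_reduction M Q b c"
  shows "alg_of (e_matrix h M x) =
    (1 - sc (of_real h / x) * alg_of M) * alg_of (e_matrix h M (x + of_real h))"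
proof -
  define y where "y = x / of_real h"
  have y: "Re y > 0" using h by (simp add: y_def)
  then have ynp: "y \<notin> \<int>\<^sub>\<le>\<^sub>0" "y \<noteq> 0" by (auto elim!: nonpos_Ints_cases)
  have y1: "(x + of_real h) / of_real h = y + 1" using h by (simp add: y_def field_simps)
  define p where "p m = (if m = 0 then 1 else if m = 1 then - (of_real h / x) else 0 :: complex)" for m :: nat
  have p: "powser p (\<lambda>\<gamma>. 1 - of_real h / x * \<gamma>)"
    unfolding powser_def
  proof
    fix z :: complex
    have "(\<lambda>m. p m * z ^ m) sums (\<Sum>m\<in>{0,1}. p m * z ^ m)"
      by (rule sums_finite) (auto simp: p_def)
    then show "(\<lambda>m. p m * z ^ m) sums (1 - of_real h / x * z)" by (simp add: p_def)
  qed
  have pM: "fcalc p (alg_of M) = 1 - sc (of_real h / x) * alg_of M"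
  proof -
    have "(\<lambda>m. sc (p m) * alg_of M ^ m) sums (\<Sum>m\<in>{0,1}. sc (p m) * alg_of M ^ m)"
      by (rule sums_finite) (auto simp: p_def)
    then show ?thesis unfolding fcalc_def by (simp add: p_def sc_minus sums_iff)
  qed
  note a = powser_e_char [OF h(1), of "x + of_real h"]
  have "(1 - of_real h / x * \<gamma>) * e_char h \<gamma> (x + of_real h) = e_char h \<gamma> x" for \<gamma>
  proof -
    have "(y - \<gamma>) * rGamma (y + 1 - \<gamma>) = rGamma (y - \<gamma>)"
      using rGamma_plus1 [of "y - \<gamma>"] by (simp add: algebra_simps)
    moreover have "Gamma (y + 1) = y * Gamma y" using ynp by (simp add: Gamma_plus1)
    moreover have "1 - of_real h / x * \<gamma> = (y - \<gamma>) / y"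
      using ynp h by (auto simp: y_def field_simps)
    ultimately have "(1 - of_real h / x * \<gamma>) * (Gamma (y + 1) * rGamma (y + 1 - \<gamma>)) = Gamma y * rGamma (y - \<gamma>)"
      using ynp by simp
    then show ?thesis
      unfolding e_char_def y1 y_def [symmetric] by (simp add: rGamma_inverse_Gamma divide_inverse)
  qed
  with powser_mult [OF p a] have
    "powser (\<lambda>n. \<Sum>i\<le>n. p i * ((deriv ^^ (n - i)) (\<lambda>\<gamma>. e_char h \<gamma> (x + of_real h)) 0 / fact (n - i)))
      (\<lambda>\<gamma>. e_char h \<gamma> x)" by simp
  from e_matrix_eq_fcalc [OF this J] show ?thesis
    unfolding fcalc_mult [OF p a] pM e_matrix_eq_fcalc [OF a J] .
qed

lemma invertible_near_1:
  fixes K :: "'a::{real_normed_algebra_1,banach}"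
  assumes "norm (K - 1) < 1"
  obtains K' where "K * K' = 1" "K' * K = 1"
proof -
  define x where "x = 1 - K"
  have "norm x < 1" using assms by (simp add: x_def norm_minus_commute)
  then have s: "summable (\<lambda>n. x ^ n)" by (rule complete_algebra_summable_geometric)
  define S where "S = (\<Sum>n. x ^ n)"
  have "x * S = S - 1" "S * x = S - 1"
    using suminf_mult [OF s, of x] suminf_mult2 [OF s, of x] suminf_split_head [OF s]
    by (simp_all add: S_def power_Suc2 [symmetric] del: power_Suc) (simp_all add: power_Suc2 [symmetric])
  then have "K * S = 1" "S * K = 1" by (simp_all add: x_def algebra_simps)
  then show ?thesis by (rule that)
qed

subsection \<open>Uniform asymptotic expansions\<close>

abbreviation trunc :: "nat \<Rightarrow> ('n::finite) malg fps \<Rightarrow> complex \<Rightarrow> 'n malg" where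
  "trunc m c x \<equiv> \<Sum>s\<le>m. fps_nth c s * sc (1 / x) ^ s"

text \<open>Asymptotic expansions in 1/x whose remainder bounds are common to all h in
  \<open>H\<close>; half-plane and constant may depend on the order m. A singleton \<open>H\<close>
  describes one function for fixed h, and the limit functions are treated as families constant in
  h.\<close>

definition uexp ::
  "real set \<Rightarrow> (real \<Rightarrow> complex \<Rightarrow> ('n::finite) malg) \<Rightarrow> (real \<Rightarrow> 'n malg fps) \<Rightarrow> bool" where
  "uexp H g c \<longleftrightarrow>
    (\<forall>m. \<exists>K R. \<forall>h\<in>H. \<forall>x. Re x \<ge> R \<longrightarrow>
      norm (g h x - trunc m (c h) x) \<le> K / Re x ^ (m + 1)) \<and>
    (\<forall>s. \<exists>B. \<forall>h\<in>H. norm (fps_nth (c h) s) \<le> B)"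

lemma norm_sc_inverse_le: "Re x \<ge> r \<Longrightarrow> r > 0 \<Longrightarrow> norm (sc (1 / x)) \<le> 1 / r"
  using complex_Re_le_cmod [of x] by (simp add: norm_divide frac_le)

lemma norm_sc_inverse_power_le:
  assumes "Re x > 0"
  shows "norm (sc (1 / x) ^ s :: ('n::finite) malg) \<le> 1 / Re x ^ s"
proof -
  have "norm (sc (1 / x) ^ s :: 'n malg) \<le> norm (sc (1 / x) :: 'n malg) ^ s" by (rule norm_power_ineq)
  also have "\<dots> \<le> (1 / Re x) ^ s"
    by (intro power_mono norm_sc_inverse_le) (use assms in auto)
  finally show ?thesis by (simp add: power_divide)
qed

lemma uexp_coeff_bounded:
  assumes "uexp H g c"
  obtains B where "B \<ge> 0" "\<And>h s. h \<in> H \<Longrightarrow> s \<le> m \<Longrightarrow> norm (fps_nth (c h) s) \<le> B"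
proof -
  have "\<forall>s. \<exists>B. \<forall>h\<in>H. norm (fps_nth (c h) s) \<le> B" using assms by (simp add: uexp_def)
  then obtain B where B: "\<And>s h. h \<in> H \<Longrightarrow> norm (fps_nth (c h) s) \<le> B s" by metis
  show ?thesis
  proof (rule that [of "\<Sum>s\<le>m. \<bar>B s\<bar>"])
    fix h s assume "h \<in> H" "s \<le> m"
    then have "norm (fps_nth (c h) s) \<le> \<bar>B s\<bar>" using B by (meson abs_ge_self order.trans)
    also have "\<dots> \<le> (\<Sum>s\<le>m. \<bar>B s\<bar>)" using \<open>s \<le> m\<close> by (intro member_le_sum) auto
    finally show "norm (fps_nth (c h) s) \<le> (\<Sum>s\<le>m. \<bar>B s\<bar>)" .
  qed (auto intro: sum_nonneg)
qed

lemma uexpD: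
  assumes "uexp H g c"
  obtains K R where "K \<ge> 0" "R \<ge> 1" "\<And>h x. h \<in> H \<Longrightarrow> Re x \<ge> R \<Longrightarrow>
    norm (g h x - trunc m (c h) x) \<le> K / Re x ^ (m + 1)"
proof -
  obtain K R where KR: "\<And>h x. h \<in> H \<Longrightarrow> Re x \<ge> R \<Longrightarrow>
    norm (g h x - trunc m (c h) x) \<le> K / Re x ^ (m + 1)"
    using assms unfolding uexp_def by blast
  show ?thesis
  proof (rule that [of "\<bar>K\<bar>" "max R 1"])
    fix h x assume *: "h \<in> H" "Re x \<ge> max R 1"
    then have "K / Re x ^ (m + 1) \<le> \<bar>K\<bar> / Re x ^ (m + 1)" by (intro divide_right_mono) auto
    with KR [of h x] * show "norm (g h x - trunc m (c h) x) \<le> \<bar>K\<bar> / Re x ^ (m + 1)"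
      by auto
  qed auto
qed

lemma uexp_polynomial_bound:
  assumes "\<And>s. s \<le> m \<Longrightarrow> norm (c s) \<le> B" "Re x \<ge> 1" "B \<ge> 0"
  shows "norm (\<Sum>s\<le>m. c s * sc (1 / x) ^ s) \<le> real (Suc m) * B"
proof -
  have "norm (c s * sc (1 / x) ^ s) \<le> B" if "s \<le> m" for s
  proof -
    have "norm (c s * sc (1 / x) ^ s) \<le> B * (1 / Re x ^ s)"
      by (rule order.trans [OF norm_mult_ineq mult_mono])
        (use assms that norm_sc_inverse_power_le [of x s] in auto)
    also have "\<dots> \<le> B * 1" using assms by (intro mult_left_mono) (auto simp: divide_simps one_le_power)
    finally show ?thesis by simp
  qed
  then have "norm (\<Sum>s\<le>m. c s * sc (1 / x) ^ s) \<le> (\<Sum>s\<le>m. B)"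
    by (intro order.trans [OF norm_sum sum_mono]) auto
  then show ?thesis by simp
qed

lemma uexp_bounded:
  assumes "uexp H g c"
  obtains K R where "K \<ge> 0" "R \<ge> 1" "\<And>h x. h \<in> H \<Longrightarrow> Re x \<ge> R \<Longrightarrow> norm (g h x) \<le> K"
proof -
  obtain K R where KR: "K \<ge> 0" "R \<ge> 1" "\<And>h x. h \<in> H \<Longrightarrow> Re x \<ge> R \<Longrightarrow>
    norm (g h x - trunc 0 (c h) x) \<le> K / Re x ^ (0 + 1)"
    by (rule uexpD [OF assms, of 0]) blast
  obtain B where B: "B \<ge> 0" "\<And>h s. h \<in> H \<Longrightarrow> s \<le> 0 \<Longrightarrow> norm (fps_nth (c h) s) \<le> B"
    by (rule uexp_coeff_bounded [OF assms, of 0]) blast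
  show ?thesis
  proof (rule that [of "K + B" R])
    fix h x assume *: "h \<in> H" "Re x \<ge> R"
    have "norm (g h x - fps_nth (c h) 0) \<le> K / Re x" using KR(3) [OF *] by simp
    also have "\<dots> \<le> K / 1" using KR(1,2) * by (intro divide_left_mono) auto
    finally show "norm (g h x) \<le> K + B"
      using B(2) [OF *(1), of 0] norm_triangle_sub [of "g h x" "fps_nth (c h) 0"] by simp
  qed (use KR B in auto)
qed

text \<open>For the order m it suffices to expand any family that has the same coefficients up to m
  and differs by O(x^-(m+1)); thus infinite sums and compositions are reduced to finite
  ones.\<close>

lemma uexp_approx:
  assumes "\<And>m. \<exists>g' c' K R. uexp H g' c' \<and> (\<forall>h\<in>H. \<forall>s\<le>m. fps_nth (c' h) s = fps_nth (c h) s) \<and>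
    (\<forall>h\<in>H. \<forall>x. Re x \<ge> R \<longrightarrow> norm (g h x - g' h x) \<le> K / Re x ^ (m + 1))"
  shows "uexp H g c"
  unfolding uexp_def
proof (intro conjI allI)
  fix m
  obtain g' c' K R where *: "uexp H g' c'" "\<forall>h\<in>H. \<forall>s\<le>m. fps_nth (c' h) s = fps_nth (c h) s"
    "\<forall>h\<in>H. \<forall>x. Re x \<ge> R \<longrightarrow> norm (g h x - g' h x) \<le> K / Re x ^ (m + 1)"
    using assms [of m] by blast
  obtain K' R' where **: "K' \<ge> 0" "R' \<ge> 1" "\<And>h x. h \<in> H \<Longrightarrow> Re x \<ge> R' \<Longrightarrow>
    norm (g' h x - trunc m (c' h) x) \<le> K' / Re x ^ (m + 1)"
    by (rule uexpD [OF *(1), of m]) blast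
  show "\<exists>K R. \<forall>h\<in>H. \<forall>x. Re x \<ge> R \<longrightarrow>
      norm (g h x - trunc m (c h) x) \<le> K / Re x ^ (m + 1)"
  proof (rule exI [of _ "K + K'"], rule exI [of _ "max R R'"], intro ballI allI impI)
    fix h x assume h: "h \<in> H" "max R R' \<le> Re x"
    have "trunc m (c h) x = trunc m (c' h) x"
      using * h by (intro sum.cong) auto
    then have "g h x - trunc m (c h) x =
        (g h x - g' h x) + (g' h x - trunc m (c' h) x)" by simp
    moreover have "norm \<dots> \<le> K / Re x ^ (m + 1) + K' / Re x ^ (m + 1)"
      using *(3) **(3) h by (intro norm_triangle_mono) auto
    ultimately show "norm (g h x - trunc m (c h) x) \<le> (K + K') / Re x ^ (m + 1)"
      by (simp only: add_divide_distrib)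
  qed
  show "\<exists>B. \<forall>h\<in>H. norm (fps_nth (c h) m) \<le> B"
    using * unfolding uexp_def by (metis order_refl)
qed

lemma uexp_cong:
  assumes "uexp H g c" "\<And>h x. h \<in> H \<Longrightarrow> Re x \<ge> R \<Longrightarrow> g h x = g' h x" "\<And>h. h \<in> H \<Longrightarrow> c h = c' h"
  shows "uexp H g' c'"
  by (rule uexp_approx, rule exI [of _ g], rule exI [of _ c], rule exI [of _ 0], rule exI [of _ R])
    (use assms in auto)

lemma uexp_subset: "uexp H g c \<Longrightarrow> H' \<subseteq> H \<Longrightarrow> uexp H' g c"
  unfolding uexp_def by (meson subsetD)

lemma uexp_const:
  assumes "\<And>h. h \<in> H \<Longrightarrow> norm (a h) \<le> B"
  shows "uexp H (\<lambda>h x. a h) (\<lambda>h. fps_const (a h))"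
  unfolding uexp_def
proof (intro conjI allI)
  fix m
  have "trunc m (fps_const (a h)) x = a h" for h x
    by (subst sum.mono_neutral_right [of _ "{0}"]) auto
  then show "\<exists>K R. \<forall>h\<in>H. \<forall>x. Re x \<ge> R \<longrightarrow>
      norm (a h - trunc m (fps_const (a h)) x) \<le> K / Re x ^ (m + 1)"
    by (intro exI [of _ 0]) auto
  show "\<exists>B. \<forall>h\<in>H. norm (fps_nth (fps_const (a h)) m) \<le> B"
    using assms by (intro exI [of _ "\<bar>B\<bar>"]) (auto intro: order.trans [OF _ abs_ge_self])
qed

lemma uexp_add:
  assumes "uexp H f c" "uexp H g d"
  shows "uexp H (\<lambda>h x. f h x + g h x) (\<lambda>h. c h + d h)"
  unfolding uexp_def
proof (intro conjI allI)
  fix m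
  obtain K R where 1: "K \<ge> 0" "R \<ge> 1" "\<And>h x. h \<in> H \<Longrightarrow> Re x \<ge> R \<Longrightarrow>
    norm (f h x - trunc m (c h) x) \<le> K / Re x ^ (m + 1)"
    by (rule uexpD [OF assms(1), of m]) blast
  obtain K' R' where 2: "K' \<ge> 0" "R' \<ge> 1" "\<And>h x. h \<in> H \<Longrightarrow> Re x \<ge> R' \<Longrightarrow>
    norm (g h x - trunc m (d h) x) \<le> K' / Re x ^ (m + 1)"
    by (rule uexpD [OF assms(2), of m]) blast
  show "\<exists>K R. \<forall>h\<in>H. \<forall>x. Re x \<ge> R \<longrightarrow>
      norm (f h x + g h x - trunc m (c h + d h) x) \<le> K / Re x ^ (m + 1)"
  proof (rule exI [of _ "K + K'"], rule exI [of _ "max R R'"], intro ballI allI impI)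
    fix h x assume h: "h \<in> H" "max R R' \<le> Re x"
    have "f h x + g h x - trunc m (c h + d h) x =
       (f h x - trunc m (c h) x) + (g h x - trunc m (d h) x)"
      by (simp add: sum.distrib distrib_right)
    moreover have "norm \<dots> \<le> K / Re x ^ (m + 1) + K' / Re x ^ (m + 1)"
      using 1(3) 2(3) h by (intro norm_triangle_mono) auto
    ultimately show "norm (f h x + g h x - trunc m (c h + d h) x) \<le> (K + K') / Re x ^ (m + 1)"
      by (simp only: add_divide_distrib)
  qed
  obtain B where "\<And>h. h \<in> H \<Longrightarrow> norm (fps_nth (c h) m) \<le> B"
    using assms(1) unfolding uexp_def by blast
  moreover obtain B' where "\<And>h. h \<in> H \<Longrightarrow> norm (fps_nth (d h) m) \<le> B'"
    using assms(2) unfolding uexp_def by blast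
  ultimately show "\<exists>B. \<forall>h\<in>H. norm (fps_nth (c h + d h) m) \<le> B"
    by (intro exI [of _ "B + B'"]) (auto intro: norm_triangle_mono)
qed

lemma uexp_mult:
  assumes "uexp H f c" "uexp H g d"
  shows "uexp H (\<lambda>h x. f h x * g h x) (\<lambda>h. c h * d h)"
  unfolding uexp_def
proof (intro conjI allI)
  fix m
  obtain K R where 1: "K \<ge> 0" "R \<ge> 1" "\<And>h x. h \<in> H \<Longrightarrow> Re x \<ge> R \<Longrightarrow>
    norm (f h x - trunc m (c h) x) \<le> K / Re x ^ (m + 1)"
    by (rule uexpD [OF assms(1), of m]) blast
  obtain K' R' where 2: "K' \<ge> 0" "R' \<ge> 1" "\<And>h x. h \<in> H \<Longrightarrow> Re x \<ge> R' \<Longrightarrow>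
    norm (g h x - trunc m (d h) x) \<le> K' / Re x ^ (m + 1)"
    by (rule uexpD [OF assms(2), of m]) blast
  obtain B where B: "B \<ge> 0" "\<And>h s. h \<in> H \<Longrightarrow> s \<le> m \<Longrightarrow> norm (fps_nth (c h) s) \<le> B"
    by (rule uexp_coeff_bounded [OF assms(1), of m]) blast
  obtain B' where B': "B' \<ge> 0" "\<And>h s. h \<in> H \<Longrightarrow> s \<le> m \<Longrightarrow> norm (fps_nth (d h) s) \<le> B'"
    by (rule uexp_coeff_bounded [OF assms(2), of m]) blast
  obtain G R'' where G: "G \<ge> 0" "R'' \<ge> 1" "\<And>h x. h \<in> H \<Longrightarrow> Re x \<ge> R'' \<Longrightarrow> norm (g h x) \<le> G"
    by (rule uexp_bounded [OF assms(2)]) blast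
  define L where "L = K * G + real (Suc m) * B * K' + real (Suc m) * (real (Suc m) * (B * B'))"
  show "\<exists>K R. \<forall>h\<in>H. \<forall>x. Re x \<ge> R \<longrightarrow>
      norm (f h x * g h x - trunc m (c h * d h) x) \<le> K / Re x ^ (m + 1)"
  proof (rule exI [of _ L], rule exI [of _ "max (max R R') R''"], intro ballI allI impI)
    fix h x assume h: "h \<in> H" and x: "max (max R R') R'' \<le> Re x"
    have x1: "Re x \<ge> 1" using 1 x by simp
    define z where "z = (sc (1 / x) :: 'a malg)"
    define \<epsilon> where "\<epsilon> = 1 / Re x ^ (m + 1)"
    have \<epsilon>: "\<epsilon> \<ge> 0" using x1 by (simp add: \<epsilon>_def)
    define P where "P = (\<Sum>s\<le>m. fps_nth (c h) s * z ^ s)"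
    define Q where "Q = (\<Sum>s\<le>m. fps_nth (d h) s * z ^ s)"
    have P: "norm P \<le> real (Suc m) * B"
      unfolding P_def z_def using B h x1 by (intro uexp_polynomial_bound) auto
    have fP: "norm (f h x - P) \<le> K * \<epsilon>" and gQ: "norm (g h x - Q) \<le> K' * \<epsilon>"
      using 1(3) [of h x] 2(3) [of h x] h x by (auto simp: P_def Q_def z_def \<epsilon>_def)
    have comm: "(a * z ^ i) * (b * z ^ j) = (a * b) * z ^ (i + j)" for a b i j
    proof -
      have "z ^ i * b = b * z ^ i"
        unfolding z_def sc_power [symmetric] by (rule sc_commute [symmetric])
      then show ?thesis by (metis mult.assoc power_add)
    qed
    \<comment> \<open>The monomials of P Q of degree beyond m: at most (m + 1)^2 many, each of the
      size of the remainder.\<close>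
    define T where "T = {(i, j). i \<le> m \<and> j \<le> m \<and> i + j > m}"
    have "finite T" by (rule finite_subset [of _ "{..m} \<times> {..m}"]) (auto simp: T_def)
    have "P * Q = (\<Sum>(i, j)\<in>{..m} \<times> {..m}. fps_nth (c h) i * fps_nth (d h) j * z ^ (i + j))"
      unfolding P_def Q_def sum_product comm by (rule sum.cartesian_product)
    also have "\<dots> = (\<Sum>(i, j)\<in>T \<union> {(i, j). i + j \<le> m}. fps_nth (c h) i * fps_nth (d h) j * z ^ (i + j))"
      by (rule sum.cong) (auto simp: T_def)
    also have "\<dots> = (\<Sum>(i, j)\<in>T. fps_nth (c h) i * fps_nth (d h) j * z ^ (i + j)) +
        (\<Sum>(i, j)\<in>{(i, j). i + j \<le> m}. fps_nth (c h) i * fps_nth (d h) j * z ^ (i + j))"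
    proof (rule sum.union_disjoint)
      show "finite {(i, j). i + j \<le> m}"
        by (rule finite_subset [of _ "{..m} \<times> {..m}"]) auto
    qed (use \<open>finite T\<close> in \<open>auto simp: T_def\<close>)
    also have "(\<Sum>(i, j)\<in>{(i, j). i + j \<le> m}. fps_nth (c h) i * fps_nth (d h) j * z ^ (i + j)) =
        (\<Sum>s\<le>m. \<Sum>i\<le>s. fps_nth (c h) i * fps_nth (d h) (s - i) * z ^ (i + (s - i)))"
      by (rule sum.triangle_reindex_eq)
    also have "\<dots> = (\<Sum>s\<le>m. fps_nth (c h * d h) s * z ^ s)"
      by (auto simp: fps_mult_nth sum_distrib_right atLeast0AtMost intro!: sum.cong)
    finally have PQ: "P * Q - (\<Sum>s\<le>m. fps_nth (c h * d h) s * z ^ s) =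
        (\<Sum>(i, j)\<in>T. fps_nth (c h) i * fps_nth (d h) j * z ^ (i + j))" by simp
    have "norm (\<Sum>(i, j)\<in>T. fps_nth (c h) i * fps_nth (d h) j * z ^ (i + j)) \<le> (\<Sum>(i, j)\<in>T. B * B' * \<epsilon>)"
    proof (rule order.trans [OF norm_sum sum_mono], clarify)
      fix i j assume ij: "(i, j) \<in> T"
      have "norm (z ^ (i + j)) \<le> 1 / Re x ^ (i + j)"
        unfolding z_def using x1 by (intro norm_sc_inverse_power_le) auto
      also have "\<dots> \<le> \<epsilon>"
        unfolding \<epsilon>_def using ij x1 by (intro divide_left_mono power_increasing) (auto simp: T_def)
      finally have "norm (z ^ (i + j)) \<le> \<epsilon>" .
      moreover have "norm (fps_nth (c h) i * fps_nth (d h) j) \<le> B * B'"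
        by (rule order.trans [OF norm_mult_ineq mult_mono]) (use ij B B' h in \<open>auto simp: T_def\<close>)
      ultimately show "norm (fps_nth (c h) i * fps_nth (d h) j * z ^ (i + j)) \<le> B * B' * \<epsilon>"
        using B(1) B'(1) by (rule_tac order.trans [OF norm_mult_ineq mult_mono]) auto
    qed
    also have "\<dots> \<le> real (Suc m) * (real (Suc m) * (B * B')) * \<epsilon>"
    proof -
      have "card T \<le> card ({..m} \<times> {..m})" by (rule card_mono) (auto simp: T_def)
      then have "real (card T) \<le> real (Suc m) * real (Suc m)"
        by (simp add: card_cartesian_product flip: of_nat_mult of_nat_Suc)
      then have "real (card T) * (B * B' * \<epsilon>) \<le> real (Suc m) * real (Suc m) * (B * B' * \<epsilon>)"
        using B B' \<epsilon> by (intro mult_right_mono) auto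
      then show ?thesis by (simp add: case_prod_unfold mult.assoc)
    qed
    finally have T: "norm (P * Q - (\<Sum>s\<le>m. fps_nth (c h * d h) s * z ^ s)) \<le>
        real (Suc m) * (real (Suc m) * (B * B')) * \<epsilon>" by (simp add: PQ)
    have "f h x * g h x - (\<Sum>s\<le>m. fps_nth (c h * d h) s * z ^ s) =
        (f h x - P) * g h x + P * (g h x - Q) + (P * Q - (\<Sum>s\<le>m. fps_nth (c h * d h) s * z ^ s))"
      by (simp add: algebra_simps)
    also have "norm \<dots> \<le> K * \<epsilon> * G + real (Suc m) * B * (K' * \<epsilon>) + real (Suc m) * (real (Suc m) * (B * B')) * \<epsilon>"
      by (intro norm_triangle_mono T order.trans [OF norm_mult_ineq mult_mono] fP gQ P G)
        (use h x B G 1 2 \<epsilon> in auto)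
    also have "\<dots> = L / Re x ^ (m + 1)"
      by (simp add: L_def \<epsilon>_def add_divide_distrib)
    finally show "norm (f h x * g h x - trunc m (c h * d h) x) \<le> L / Re x ^ (m + 1)"
      by (simp add: z_def)
  qed
  show "\<exists>B. \<forall>h\<in>H. norm (fps_nth (c h * d h) m) \<le> B"
  proof (intro exI ballI)
    fix h assume h: "h \<in> H"
    have "norm (fps_nth (c h * d h) m) \<le> (\<Sum>i=0..m. B * B')"
      unfolding fps_mult_nth
      by (intro order.trans [OF norm_sum sum_mono] order.trans [OF norm_mult_ineq mult_mono])
        (use h B B' in auto)
    then show "norm (fps_nth (c h * d h) m) \<le> (\<Sum>i=0..m. B * B')" .
  qed
qed

lemma uexp_diff:
  assumes "uexp H f c" "uexp H g d"
  shows "uexp H (\<lambda>h x. f h x - g h x) (\<lambda>h. c h - d h)"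
proof -
  have "uexp H (\<lambda>h x. f h x + (-1) * g h x) (\<lambda>h. c h + fps_const (-1) * d h)"
    by (intro uexp_add uexp_mult assms uexp_const [where B = 1]) auto
  then show ?thesis
    by (rule uexp_cong) (auto simp: fps_eq_iff)
qed

lemma uexp_sum:
  "(\<And>i. i \<in> I \<Longrightarrow> uexp H (f i) (c i)) \<Longrightarrow> uexp H (\<lambda>h x. \<Sum>i\<in>I. f i h x) (\<lambda>h. \<Sum>i\<in>I. c i h)"
proof (induction I rule: infinite_finite_induct)
  case (insert i I)
  then show ?case by (simp add: uexp_add)
qed (use uexp_const [of H "\<lambda>_. 0" 0] in auto)

lemma uexp_power:
  "uexp H f c \<Longrightarrow> uexp H (\<lambda>h x. f h x ^ j) (\<lambda>h. c h ^ j)"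
proof (induction j)
  case 0
  show ?case using uexp_const [of H "\<lambda>_. 1" 1] by simp
qed (simp add: uexp_mult)

text \<open>The series X/(1 + tX), which is 1/(x + t) for X = 1/x. Substituting it for X is the
  shift of x by t.\<close>

definition recip_fps :: "real \<Rightarrow> ('n::finite) malg fps" where
  "recip_fps t = Abs_fps (\<lambda>n. if n = 0 then 0 else of_real ((- t) ^ (n - 1)))"

lemma uexp_recip:
  assumes "H \<subseteq> {0..1}"
  shows "uexp H (\<lambda>h x. sc (1 / (x + of_real (of_nat k * h)))) (\<lambda>h. recip_fps (of_nat k * h))"
  unfolding uexp_def
proof (intro conjI allI)
  fix m
  \<comment> \<open>The exact remainder of the finite geometric sum. With t = k h and h \<le> 1 it
    is bounded independently of h.\<close>
  have rem: "sc (1 / (x + of_real t)) - trunc m (recip_fps t) x =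
      (sc ((- of_real t / x) ^ m / (x + of_real t)) :: 'a malg)" if "x \<noteq> 0" "x + of_real t \<noteq> 0" for x t
  proof (induction m)
    case (Suc m)
    have "(\<Sum>s\<le>Suc m. fps_nth (recip_fps t) s * sc (1 / x) ^ s) =
        trunc m (recip_fps t) x + (sc ((- of_real t) ^ m * (1 / x) ^ Suc m) :: 'a malg)"
    proof -
      have "sc ((- of_real t) ^ m * (1 / x) ^ Suc m) = (sc (of_real ((- t) ^ m)) * sc (1 / x) ^ Suc m :: 'a malg)"
        by (simp only: sc_mult sc_power of_real_power of_real_minus)
      moreover have "fps_nth (recip_fps t) (Suc m) = (of_real ((- t) ^ m) :: 'a malg)"
        by (simp add: recip_fps_def)
      ultimately show ?thesis by (simp only: sum.atMost_Suc sc_of_real)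
    qed
    moreover have "(- of_real t / x) ^ m / (x + of_real t) - (- of_real t) ^ m * (1 / x) ^ Suc m =
        (- of_real t / x) ^ Suc m / (x + of_real t)"
    proof -
      have "(- of_real t) ^ m * (1 / x) ^ Suc m = (- of_real t / x) ^ m / x"
        by (simp only: power_divide power_one power_Suc) (simp add: mult.commute)
      moreover have "p / (x + of_real t) - p / x = (- of_real t / x * p) / (x + of_real t)" for p
        using that by (simp add: divide_simps) (simp add: algebra_simps)
      ultimately show ?thesis by (simp only: power_Suc [of "- of_real t / x"])
    qed
    ultimately show ?case using Suc
      by (simp only: diff_diff_eq [symmetric] sc_diff [symmetric])
  qed (simp add: recip_fps_def)
  show "\<exists>K R. \<forall>h\<in>H. \<forall>x. Re x \<ge> R \<longrightarrow>
      norm (sc (1 / (x + of_real (of_nat k * h))) - trunc m (recip_fps (of_nat k * h) :: 'a malg fps) x) \<le> K / Re x ^ (m + 1)"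
  proof (rule exI [of _ "real k ^ m"], rule exI [of _ 1], intro ballI allI impI)
    fix h x assume h: "h \<in> H" and x: "1 \<le> Re x"
    define t where "t = real k * h"
    have t: "0 \<le> t" "t \<le> real k"
      using assms h by (auto simp: t_def mult_left_le)
    have nz: "x \<noteq> 0" "x + of_real t \<noteq> 0" using x t by (auto simp: complex_eq_iff)
    have "cmod (x + of_real t) \<ge> Re x" using complex_Re_le_cmod [of "x + of_real t"] t by simp
    moreover have "cmod x \<ge> Re x" by (rule complex_Re_le_cmod)
    ultimately have "cmod ((- of_real t / x) ^ m / (x + of_real t)) \<le> (real k / Re x) ^ m / Re x"
      using x t unfolding norm_divide norm_power norm_minus_cancel norm_of_real
      by (intro frac_le power_mono) auto
    also have "\<dots> = real k ^ m / Re x ^ (m + 1)" by (simp add: power_divide)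
    finally show "norm (sc (1 / (x + of_real (of_nat k * h))) - trunc m (recip_fps (of_nat k * h) :: 'a malg fps) x) \<le> real k ^ m / Re x ^ (m + 1)"
      using rem [OF nz] by (simp add: t_def)
  qed
  show "\<exists>B. \<forall>h\<in>H. norm (fps_nth (recip_fps (of_nat k * h) :: 'a malg fps) m) \<le> B"
  proof (intro exI [of _ "real k ^ (m - 1)"] ballI)
    fix h assume "h \<in> H"
    then have "\<bar>real k * h\<bar> \<le> real k" using assms by (auto simp: abs_mult mult_left_le)
    then have "\<bar>(- (real k * h)) ^ (m - 1)\<bar> \<le> real k ^ (m - 1)"
      unfolding power_abs abs_minus_cancel by (intro power_mono) auto
    moreover have "fps_nth (recip_fps (of_nat k * h) :: 'a malg fps) m = 0 \<or>
        fps_nth (recip_fps (of_nat k * h) :: 'a malg fps) m = of_real ((- (real k * h)) ^ (m - 1))"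
      unfolding recip_fps_def by (simp only: fps_nth_Abs_fps split: if_split) blast
    ultimately show "norm (fps_nth (recip_fps (of_nat k * h) :: 'a malg fps) m) \<le> real k ^ (m - 1)"
      by (metis norm_of_real norm_zero of_nat_0_le_iff zero_le_power)
  qed
qed

lemma recip_fps_0: "recip_fps 0 = fps_X"
  by (auto simp: fps_eq_iff recip_fps_def power_0_left)

text \<open>For a family constant in h one index decides. In this way such families escape the
  restriction of \<open>H\<close> to the unit interval in \<open>uexp_recip\<close>.\<close>

lemma uexp_h_indep: "uexp {h} (\<lambda>h x. g x) (\<lambda>h. c) \<Longrightarrow> uexp H (\<lambda>h x. g x) (\<lambda>h. c)"
  unfolding uexp_def by blast

lemma uexp_inverse: "uexp H (\<lambda>h x. sc (1 / x)) (\<lambda>h. fps_X)"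
proof -
  have "uexp {0} (\<lambda>h x. sc (1 / (x + of_real (of_nat 0 * h)))) (\<lambda>h. recip_fps (of_nat 0 * h))"
    by (rule uexp_recip) auto
  then have "uexp {0} (\<lambda>h x. sc (1 / x) :: 'a malg) (\<lambda>h. fps_X)"
    by (rule uexp_cong) (auto simp: recip_fps_0)
  then show ?thesis by (rule uexp_h_indep)
qed

lemma fps_power_prefix:
  fixes u :: "('a::ring_1) fps"
  assumes "fps_nth u 0 = 0" "n < j"
  shows "fps_nth (u ^ j) n = 0"
  using assms(2)
proof (induction j arbitrary: n)
  case (Suc j)
  have "fps_nth u i * fps_nth (u ^ j) (n - i) = 0" if "i \<le> n" for i
    using Suc that assms(1) by (cases "i = 0") auto
  then show ?case by (simp add: fps_mult_nth)
qed simp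

lemma recip_fps_nth_0 [simp]: "fps_nth (recip_fps t) 0 = 0"
  by (simp add: recip_fps_def)

text \<open>\<open>recip_fps h\<close> has no constant term, so the coefficients of the composition
  up to order m only involve those of \<open>c h\<close> up to m, and the truncation may be shifted
  instead of the function.\<close>

lemma uexp_shift:
  assumes "uexp H g c" "H \<subseteq> {0..1}"
  shows "uexp H (\<lambda>h x. g h (x + of_real h)) (\<lambda>h. fps_compose (c h) (recip_fps h))"
proof (rule uexp_approx)
  fix m
  obtain K R where K: "K \<ge> 0" "R \<ge> 1" "\<And>h x. h \<in> H \<Longrightarrow> Re x \<ge> R \<Longrightarrow>
    norm (g h x - trunc m (c h) x) \<le> K / Re x ^ (m + 1)"
    by (rule uexpD [OF assms(1), of m]) blast
  obtain B where B: "B \<ge> 0" "\<And>h s. h \<in> H \<Longrightarrow> s \<le> m \<Longrightarrow> norm (fps_nth (c h) s) \<le> B"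
    by (rule uexp_coeff_bounded [OF assms(1), of m]) blast
  show "\<exists>g' c' K R. uexp H g' c' \<and>
      (\<forall>h\<in>H. \<forall>s\<le>m. fps_nth (c' h) s = fps_nth (fps_compose (c h) (recip_fps h)) s) \<and>
      (\<forall>h\<in>H. \<forall>x. Re x \<ge> R \<longrightarrow> norm (g h (x + of_real h) - g' h x) \<le> K / Re x ^ (m + 1))"
  proof (intro exI conjI)
    show "uexp H (\<lambda>h x. \<Sum>s\<le>m. fps_nth (c h) s * sc (1 / (x + of_real (of_nat 1 * h))) ^ s)
        (\<lambda>h. \<Sum>s\<le>m. fps_const (fps_nth (c h) s) * recip_fps (of_nat 1 * h) ^ s)"
      by (intro uexp_sum uexp_mult uexp_power uexp_recip assms(2) uexp_const [where B = B]) (use B in auto)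
    show "\<forall>h\<in>H. \<forall>s\<le>m. fps_nth (\<Sum>s\<le>m. fps_const (fps_nth (c h) s) * recip_fps (of_nat 1 * h) ^ s) s =
        fps_nth (fps_compose (c h) (recip_fps h)) s"
    proof (intro ballI allI impI)
      fix h s assume "s \<le> m"
      have "fps_nth (\<Sum>j\<le>m. fps_const (fps_nth (c h) j) * recip_fps (of_nat 1 * h) ^ j) s =
          (\<Sum>j\<le>m. fps_nth (c h) j * fps_nth (recip_fps h ^ j) s)" by (simp add: fps_sum_nth)
      also have "\<dots> = (\<Sum>j\<in>{0..s}. fps_nth (c h) j * fps_nth (recip_fps h ^ j) s)"
        using \<open>s \<le> m\<close>
        by (intro sum.mono_neutral_right) (auto simp: not_le fps_power_prefix)
      finally show "fps_nth (\<Sum>s\<le>m. fps_const (fps_nth (c h) s) * recip_fps (of_nat 1 * h) ^ s) s =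
          fps_nth (fps_compose (c h) (recip_fps h)) s" by (simp add: fps_compose_nth)
    qed
    show "\<forall>h\<in>H. \<forall>x. Re x \<ge> R \<longrightarrow> norm (g h (x + of_real h) -
        trunc m (c h) (x + of_real (of_nat 1 * h))) \<le> K / Re x ^ (m + 1)"
    proof (intro ballI allI impI)
      fix h x assume h: "h \<in> H" "Re x \<ge> R"
      then have "h \<ge> 0" using assms(2) by auto
      have "norm (g h (x + of_real h) - trunc m (c h) (x + of_real (of_nat 1 * h)))
          \<le> K / Re (x + of_real h) ^ (m + 1)"
        using K(3) [of h "x + of_real h"] h \<open>h \<ge> 0\<close> by simp
      also have "\<dots> \<le> K / Re x ^ (m + 1)"
        using K(1,2) h \<open>h \<ge> 0\<close> by (intro divide_left_mono power_mono mult_pos_pos) auto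
      finally show "norm (g h (x + of_real h) - trunc m (c h) (x + of_real (of_nat 1 * h)))
          \<le> K / Re x ^ (m + 1)" .
    qed
  qed
qed

text \<open>Along the positive reals the lowest nonzero coefficient of the difference would be
  O(1/t). Uniqueness is what turns functional equations into identities of formal series.\<close>

lemma uexp_unique:
  assumes "uexp H g c" "uexp H g d" "h \<in> H"
  shows "c h = d h"
proof (rule ccontr)
  define e where "e = c h - d h"
  assume "c h \<noteq> d h"
  then have "\<exists>n. fps_nth e n \<noteq> 0" by (auto simp: e_def fps_eq_iff)
  then obtain n where n: "fps_nth e n \<noteq> 0" "\<And>k. k < n \<Longrightarrow> fps_nth e k = 0"
    using exists_least_iff [of "\<lambda>n. fps_nth e n \<noteq> 0"] by blast
  obtain K R where K: "K \<ge> 0" "R \<ge> 1" "\<And>h x. h \<in> H \<Longrightarrow> Re x \<ge> R \<Longrightarrow>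
    norm (g h x - g h x - trunc n (c h - d h) x) \<le> K / Re x ^ (n + 1)"
    by (rule uexpD [OF uexp_diff [OF assms(1,2)], of n]) blast
  have "norm (fps_nth e n) \<le> K / t" if t: "t \<ge> R" for t
  proof -
    have t1: "t \<ge> 1" using K t by simp
    have "trunc n e (of_real t) = fps_nth e n * sc (1 / of_real t) ^ n"
      by (subst sum.mono_neutral_right [of _ "{n}"]) (use n(2) in \<open>auto simp: le_less\<close>)
    then have "norm (fps_nth e n * sc (1 / of_real t) ^ n) \<le> K / t ^ (n + 1)"
      using K(3) [OF assms(3), of "of_real t"] t by (simp add: e_def)
    moreover have "norm (fps_nth e n * sc (1 / of_real t) ^ n) = norm (fps_nth e n) / t ^ n"
      using t1 by (simp add: sc_power [symmetric] sc_commute norm_divide norm_power power_divide)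
    ultimately have "norm (fps_nth e n) / t ^ n \<le> K / t / t ^ n" by (simp add: field_simps)
    then have "0 < t ^ n \<longrightarrow> norm (fps_nth e n) \<le> K / t" unfolding divide_le_cancel by simp
    then show ?thesis using t1 by simp
  qed
  then have "eventually (\<lambda>t. norm (fps_nth e n) \<le> K / t) at_top"
    by (auto simp: eventually_at_top_linorder)
  moreover have "((\<lambda>t. K / t) \<longlongrightarrow> 0) at_top"
    by (intro tendsto_divide_0 [OF tendsto_const] filterlim_at_top_imp_at_infinity filterlim_ident)
  ultimately have "norm (fps_nth e n) \<le> 0" by (intro tendsto_lowerbound) auto
  then show False using n by simp
qed

subsection \<open>The recursion for the coefficients\<close>

text \<open>Meant for a = 1/(x + h), b = 1/x, c = h: then \<open>q j\<close> is the difference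
  quotient of the j-th powers, built by a recursion that never divides by c and so makes sense for c
  = 0. It is applied both to matrices and to formal series.\<close>

lemma power_eq_add_mult:
  fixes a b c :: "'a::ring_1"
  assumes "q 0 = 0" "\<And>j. q (Suc j) = a * q j - b ^ Suc j * a"
    and "a = b - c * (b * a)" "a * b = b * a" "c * a = a * c" "c * b = b * c"
  shows "a ^ j = b ^ j + c * q j"
proof (induction j)
  case (Suc j)
  have bc: "b ^ j * c = c * b ^ j" using assms(6) by (simp add: power_commuting_commutes)
  have "a * b ^ j = b ^ j * a" using assms(4) by (metis power_commuting_commutes)
  also have "\<dots> = b ^ j * (b - c * (b * a))" using assms(3) by simp
  also have "\<dots> = b ^ Suc j - c * (b ^ Suc j * a)"
    by (simp add: right_diff_distrib power_Suc2 mult.assoc [symmetric] bc del: power_Suc)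
  finally have "a * b ^ j = b ^ Suc j - c * (b ^ Suc j * a)" .
  moreover have "a * (c * q j) = c * (a * q j)" using assms(5) by (simp add: mult.assoc [symmetric])
  ultimately have "a ^ Suc j = b ^ Suc j - c * (b ^ Suc j * a) + c * (a * q j)"
    by (simp add: Suc distrib_left)
  also have "\<dots> = b ^ Suc j + c * q (Suc j)"
    by (simp add: assms(2) right_diff_distrib del: power_Suc)
  finally show ?case .
qed (simp add: assms(1))

text \<open>\<open>qf j h x\<close> is the difference quotient of \<open>x\<^sup>-\<^sup>j\<close>, and \<open>qc j h\<close> is its expansion in \<open>1/x\<close>.\<close>

primrec qf :: "nat \<Rightarrow> real \<Rightarrow> complex \<Rightarrow> ('n::finite) malg" where
  "qf 0 h x = 0"
| "qf (Suc j) h x = sc (1 / (x + of_real h)) * qf j h x - sc (1 / x) ^ Suc j * sc (1 / (x + of_real h))"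

primrec qc :: "nat \<Rightarrow> real \<Rightarrow> ('n::finite) malg fps" where
  "qc 0 h = 0"
| "qc (Suc j) h = recip_fps h * qc j h - fps_X ^ Suc j * recip_fps h"

lemma uexp_recip': "H \<subseteq> {0..1} \<Longrightarrow> uexp H (\<lambda>h x. sc (1 / (x + of_real h))) (\<lambda>h. recip_fps h)"
  using uexp_recip [of H 1] by simp

lemma uexp_qf: "H \<subseteq> {0..1} \<Longrightarrow> uexp H (\<lambda>h x. qf j h x) (\<lambda>h. qc j h)"
proof (induction j)
  case 0
  show ?case using uexp_const [of H "\<lambda>_. 0" 0] by simp
next
  case (Suc j)
  then show ?case
    unfolding qf.simps qc.simps
    by (intro uexp_diff uexp_mult uexp_recip' uexp_power uexp_inverse)
qed

lemma sc_commute_sc: "sc a * sc b = sc b * sc a"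
  by (simp add: sc_mult [symmetric] mult.commute)

lemma qf_eq:
  assumes "x \<noteq> 0" "x + of_real h \<noteq> 0"
  shows "sc (1 / (x + of_real h)) ^ j = sc (1 / x) ^ j + sc (of_real h) * qf j h x"
proof (rule power_eq_add_mult)
  have "1 / (x + of_real h) = 1 / x - of_real h * (1 / x * (1 / (x + of_real h)))"
    using assms by (simp add: divide_simps)
  then show "sc (1 / (x + of_real h)) = sc (1 / x) - sc (of_real h) * (sc (1 / x) * sc (1 / (x + of_real h)))"
    by (metis sc_diff sc_mult)
qed (auto simp: sc_commute_sc)

lemma fps_const_of_real_commute: "fps_const (of_real r :: 'a::real_algebra_1) * f = f * fps_const (of_real r)"
  by (simp add: fps_eq_iff of_real_def)

lemma recip_fps_eq: "recip_fps h = fps_X - fps_const (of_real h) * (fps_X * recip_fps h)"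
proof (rule fps_ext)
  fix n
  show "fps_nth (recip_fps h) n = fps_nth (fps_X - fps_const (of_real h) * (fps_X * recip_fps h)) n"
  proof (cases n)
    case (Suc k)
    show ?thesis
      by (cases k) (auto simp: Suc recip_fps_def)
  qed simp
qed

lemma qc_eq: "recip_fps h ^ j = fps_X ^ j + fps_const (of_real h) * qc j h"
proof (rule power_eq_add_mult [OF _ _ recip_fps_eq])
  show "recip_fps h * fps_X = fps_X * (recip_fps h :: 'a malg fps)"
    by (rule fps_mult_fps_X_commute [symmetric])
  show "fps_const (of_real h) * recip_fps h = recip_fps h * (fps_const (of_real h) :: 'a malg fps)"
    "fps_const (of_real h) * fps_X = fps_X * (fps_const (of_real h) :: 'a malg fps)"
    by (rule fps_const_of_real_commute)+
qed simp_all

text \<open>The difference quotient of x^-j begins with x^-(j+1). The recursion for the coefficients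
  is triangular for this reason.\<close>

lemma qc_nth_eq_0: "n \<le> j \<Longrightarrow> fps_nth (qc j h) n = 0"
proof (induction j arbitrary: n)
  case (Suc j)
  have "fps_nth (recip_fps h) i * fps_nth (qc j h :: 'a malg fps) (n - i) = 0" if "i \<le> n" for i
  proof (cases "i = 0")
    case False
    then have "n - i \<le> j" using Suc.prems by linarith
    then show ?thesis by (simp add: Suc.IH)
  qed simp
  then have "fps_nth (recip_fps h * qc j h :: 'a malg fps) n = 0" by (simp add: fps_mult_nth)
  moreover have "fps_nth (fps_X ^ Suc j * recip_fps h :: 'a malg fps) n = 0"
    using Suc.prems by (auto simp: fps_X_power_mult_nth simp del: power_Suc)
  ultimately show ?case by (simp del: power_Suc)
qed simp

text \<open>At h = 0 the difference quotient of x^-j is its derivative.\<close>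

lemma qc_0: "qc j 0 = - of_nat j * fps_X ^ Suc j"
proof (induction j)
  case (Suc j)
  have "fps_X * (- of_nat j * fps_X ^ Suc j) = - (of_nat j * (fps_X * fps_X ^ Suc j) :: 'a malg fps)"
    by (metis (no_types, lifting) mult.assoc mult_minus_left mult_minus_right mult_of_nat_commute)
  moreover have "fps_X ^ Suc j * fps_X = (fps_X * fps_X ^ Suc j :: 'a malg fps)"
    by (rule power_commutes)
  ultimately show ?case
    unfolding qc.simps Suc recip_fps_0 by (simp add: distrib_right left_diff_distrib power_Suc [of _ "Suc j"] del: power_Suc)
qed simp

text \<open>Convergence of each coefficient separately, without uniformity in the index: a given
  truncation involves only finitely many of them.\<close>

definition ctend :: "(real \<Rightarrow> ('n::finite) malg fps) \<Rightarrow> 'n malg fps \<Rightarrow> bool" where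
  "ctend c d \<longleftrightarrow> (\<forall>n. ((\<lambda>h. fps_nth (c h) n) \<longlongrightarrow> fps_nth d n) (at_right 0))"

lemma ctend_const: "ctend (\<lambda>h. c) c"
  by (simp add: ctend_def)

lemma ctend_diff: "ctend c d \<Longrightarrow> ctend c' d' \<Longrightarrow> ctend (\<lambda>h. c h - c' h) (d - d')"
  and ctend_mult: "ctend c d \<Longrightarrow> ctend c' d' \<Longrightarrow> ctend (\<lambda>h. c h * c' h) (d * d')"
  by (auto simp: ctend_def fps_mult_nth intro!: tendsto_intros)

lemma ctend_power: "ctend c d \<Longrightarrow> ctend (\<lambda>h. c h ^ j) (d ^ j)"
  by (induction j) (auto intro: ctend_mult ctend_const)

lemma ctend_compose: "ctend c d \<Longrightarrow> ctend c' d' \<Longrightarrow> ctend (\<lambda>h. fps_compose (c h) (c' h)) (fps_compose d d')"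
  using ctend_power [of c' d'] by (auto simp: ctend_def fps_compose_nth intro!: tendsto_intros)

lemma ctend_recip_fps: "ctend (\<lambda>h. recip_fps (of_nat k * h)) fps_X"
  unfolding ctend_def
proof
  fix n
  have "((\<lambda>h. fps_nth (recip_fps (of_nat k * h)) n) \<longlongrightarrow> fps_nth (recip_fps (of_nat k * 0)) n) (at_right 0)"
    unfolding recip_fps_def fps_nth_Abs_fps
    by (cases "n = 0", simp, simp only: if_False, intro tendsto_intros)
  then show "((\<lambda>h. fps_nth (recip_fps (of_nat k * h)) n) \<longlongrightarrow> fps_nth fps_X n) (at_right 0)"
    by (simp only: recip_fps_0 mult_zero_right)
qed

lemma ctend_recip_fps': "ctend (\<lambda>h. recip_fps h) (recip_fps 0)"
  using ctend_recip_fps [of 1] by (simp add: recip_fps_0)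

lemma ctend_qc: "ctend (\<lambda>h. qc j h) (qc j 0)"
proof (induction j)
  case (Suc j)
  then show ?case
    unfolding qc.simps by (intro ctend_diff ctend_mult ctend_recip_fps' ctend_const)
qed (simp add: ctend_const)

text \<open>The difference quotient of \<phi> under the shift of x by h, taken power by power. The
  sum stops at n because \<open>qc j h\<close> has no coefficients up to j; as there is no division
  by h, the value at h = 0 is the derivative.\<close>

definition Qdiff :: "('n::finite) malg fps \<Rightarrow> real \<Rightarrow> 'n malg fps" where
  "Qdiff \<phi> h = Abs_fps (\<lambda>n. \<Sum>j\<le>n. fps_nth \<phi> j * fps_nth (qc j h) n)"

lemma fps_compose_recip_fps:
  "fps_compose \<phi> (recip_fps h) = \<phi> + fps_const (of_real h) * Qdiff \<phi> h"
proof (rule fps_ext)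
  fix n
  have "fps_nth \<phi> j * fps_nth (recip_fps h ^ j) n =
      fps_nth \<phi> j * (if n = j then 1 else 0) + of_real h * (fps_nth \<phi> j * fps_nth (qc j h) n)" for j
    unfolding qc_eq by (simp add: algebra_simps fps_X_power_iff of_real_def)
  then have "fps_nth (fps_compose \<phi> (recip_fps h)) n =
      (\<Sum>j\<le>n. fps_nth \<phi> j * (if n = j then 1 else 0)) + of_real h * (\<Sum>j\<le>n. fps_nth \<phi> j * fps_nth (qc j h) n)"
    by (simp add: fps_compose_nth sum.distrib sum_distrib_left atLeast0AtMost)
  also have "(\<Sum>j\<le>n. fps_nth \<phi> j * (if n = j then 1 else 0)) = fps_nth \<phi> n"
    by (subst sum.mono_neutral_right [of _ "{n}"]) auto
  finally show "fps_nth (fps_compose \<phi> (recip_fps h)) n = fps_nth (\<phi> + fps_const (of_real h) * Qdiff \<phi> h) n"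
    by (simp add: Qdiff_def)
qed

text \<open>For \<open>h > 0\<close>, the equation \<open>(F (x + h) - F x) / h = (A (x + h) F (x + h) - F x A\<^sub>0) / x\<close> in terms of
  expansions in \<open>1/x\<close>; for \<open>h = 0\<close>, the equation \<open>F' = (A F - F A\<^sub>0) / x\<close>.\<close>

definition fps_rec :: "real \<Rightarrow> ('n::finite) malg fps \<Rightarrow> 'n malg fps \<Rightarrow> bool" where
  "fps_rec h \<alpha> \<phi> \<longleftrightarrow> Qdiff \<phi> h =
    fps_X * (fps_compose \<alpha> (recip_fps h) * fps_compose \<phi> (recip_fps h) - \<phi> * fps_const (fps_nth \<alpha> 0))"

text \<open>The coefficient of X^(s+1) in the recursion, with the terms containing the s-th
  coefficient of \<phi> moved to the left; the right-hand side only involves earlier ones. At h = 0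
  the left-hand side is the Sylvester operator shifted by s.\<close>

lemma fps_rec_nth:
  assumes "fps_rec h \<alpha> \<phi>"
  defines "u \<equiv> recip_fps h"
  shows "fps_nth \<phi> s * fps_nth (qc s h) (Suc s) - fps_nth \<alpha> 0 * fps_nth \<phi> s * fps_nth (u ^ s) s +
      fps_nth \<phi> s * fps_nth \<alpha> 0 =
    (\<Sum>i=1..s. fps_nth (fps_compose \<alpha> u) i * fps_nth (fps_compose \<phi> u) (s - i)) +
      fps_nth \<alpha> 0 * (\<Sum>j<s. fps_nth \<phi> j * fps_nth (u ^ j) s) - (\<Sum>j<s. fps_nth \<phi> j * fps_nth (qc j h) (Suc s))"
proof -
  have "fps_nth (Qdiff \<phi> h) (Suc s) = (\<Sum>j<s. fps_nth \<phi> j * fps_nth (qc j h) (Suc s)) + fps_nth \<phi> s * fps_nth (qc s h) (Suc s)"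
    by (simp add: Qdiff_def qc_nth_eq_0 lessThan_Suc_atMost [symmetric] del: qc.simps)
  moreover have "fps_nth (Qdiff \<phi> h) (Suc s) =
      fps_nth (fps_compose \<alpha> u * fps_compose \<phi> u) s - fps_nth \<phi> s * fps_nth \<alpha> 0"
    using assms(1) unfolding fps_rec_def u_def by simp
  moreover have "fps_nth (fps_compose \<alpha> u * fps_compose \<phi> u) s =
      fps_nth \<alpha> 0 * fps_nth (fps_compose \<phi> u) s +
      (\<Sum>i=1..s. fps_nth (fps_compose \<alpha> u) i * fps_nth (fps_compose \<phi> u) (s - i))"
    unfolding fps_mult_nth by (simp add: sum.atLeast_Suc_atMost [of 0 s])
  moreover have "fps_nth (fps_compose \<phi> u) s =
      (\<Sum>j<s. fps_nth \<phi> j * fps_nth (u ^ j) s) + fps_nth \<phi> s * fps_nth (u ^ s) s"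
    by (simp add: fps_compose_nth atLeast0AtMost lessThan_Suc_atMost [symmetric])
  ultimately show ?thesis by (simp add: algebra_simps)
qed

text \<open>\<open>Y\<close> is not known to be bounded in advance. Once \<delta> is below \<kappa>
  / 2, the part of the right-hand side that contains Y - Y0 is absorbed on the left.\<close>

lemma tendsto_of_linear_bound:
  fixes Y :: "'b \<Rightarrow> 'a::real_normed_vector"
  assumes "\<kappa> > 0" "\<And>h. \<kappa> * norm (Y h - Y0) \<le> \<delta> h * norm (Y h) + \<epsilon> h"
    and "(\<delta> \<longlongrightarrow> (0::real)) F" "(\<epsilon> \<longlongrightarrow> 0) F"
  shows "(Y \<longlongrightarrow> Y0) F"
proof -
  have "((\<lambda>h. \<bar>\<delta> h\<bar> * norm Y0 + \<bar>\<epsilon> h\<bar>) \<longlongrightarrow> \<bar>0\<bar> * norm Y0 + \<bar>0\<bar>) F"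
    by (intro tendsto_intros assms)
  then have "((\<lambda>h. \<bar>\<delta> h\<bar> * norm Y0 + \<bar>\<epsilon> h\<bar>) \<longlongrightarrow> 0) F" by simp
  then have "((\<lambda>h. (\<bar>\<delta> h\<bar> * norm Y0 + \<bar>\<epsilon> h\<bar>) * (2 / \<kappa>)) \<longlongrightarrow> 0) F"
    by (rule tendsto_mult_left_zero)
  moreover have "\<forall>\<^sub>F h in F. norm (Y h - Y0) \<le> (\<bar>\<delta> h\<bar> * norm Y0 + \<bar>\<epsilon> h\<bar>) * (2 / \<kappa>)"
  proof -
    have "\<forall>\<^sub>F h in F. \<bar>\<delta> h\<bar> < \<kappa> / 2"
      using tendstoD [OF assms(3), of "\<kappa> / 2"] assms(1) by simp
    then show ?thesis
    proof eventually_elim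
      case (elim h)
      have "\<kappa> * norm (Y h - Y0) \<le> \<bar>\<delta> h\<bar> * norm (Y h) + \<bar>\<epsilon> h\<bar>"
        using assms(2) [of h] by (smt (verit) mult_right_mono norm_ge_zero)
      also have "\<dots> \<le> \<bar>\<delta> h\<bar> * (norm (Y h - Y0) + norm Y0) + \<bar>\<epsilon> h\<bar>"
        using norm_triangle_sub [of "Y h" Y0] by (intro add_mono mult_left_mono) auto
      also have "\<dots> \<le> \<kappa> / 2 * norm (Y h - Y0) + (\<bar>\<delta> h\<bar> * norm Y0 + \<bar>\<epsilon> h\<bar>)"
        using mult_right_mono [OF less_imp_le [OF elim], of "norm (Y h - Y0)"] by (simp add: algebra_simps)
      finally have "\<kappa> / 2 * norm (Y h - Y0) \<le> \<bar>\<delta> h\<bar> * norm Y0 + \<bar>\<epsilon> h\<bar>" by simp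
      then show ?case using assms(1) by (simp add: field_simps)
    qed
  qed
  ultimately have "((\<lambda>h. Y h - Y0) \<longlongrightarrow> 0) F" by (rule Lim_null_comparison [rotated])
  then show ?thesis by (simp add: LIM_zero_iff)
qed

text \<open>Strong induction on the index. The operator acting on the s-th coefficient for h is a
  perturbation of the one for h = 0, which is bounded below by \<open>inj\<close>; the right-hand
  sides converge by induction.\<close>

lemma fps_rec_tendsto:
  fixes \<alpha>0 \<phi>0 :: "('n::finite) malg fps"
  assumes \<alpha>: "ctend \<alpha> \<alpha>0"
    and rec: "\<forall>\<^sub>F h in at_right 0. fps_rec h (\<alpha> h) (\<phi> h)" "fps_rec 0 \<alpha>0 \<phi>0"
    and init: "\<forall>\<^sub>F h in at_right 0. fps_nth (\<phi> h) 0 = fps_nth \<phi>0 0"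
    and inj: "\<And>s. s \<ge> 1 \<Longrightarrow> \<exists>\<kappa>>0. \<forall>Y. \<kappa> * norm Y \<le> norm (- (of_nat s * Y) - fps_nth \<alpha>0 0 * Y + Y * fps_nth \<alpha>0 0)"
  shows "ctend \<phi> \<phi>0"
  unfolding ctend_def
proof
  fix s
  show "((\<lambda>h. fps_nth (\<phi> h) s) \<longlongrightarrow> fps_nth \<phi>0 s) (at_right 0)"
  proof (induction s rule: less_induct)
    case (less s)
    show ?case
    proof (cases "s = 0")
      case True
      then show ?thesis using init by (auto intro: tendsto_eventually)
    next
      case False
      obtain \<kappa> where \<kappa>: "\<kappa> > 0" "\<And>Y. \<kappa> * norm Y \<le> norm (- (of_nat s * Y) - fps_nth \<alpha>0 0 * Y + Y * fps_nth \<alpha>0 0)"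
        using inj [of s] False by auto
      define a where "a h = (fps_nth (qc s h) (Suc s) :: 'n malg)" for h
      define b where "b h = fps_nth (\<alpha> h) 0" for h
      define d where "d h = (fps_nth (recip_fps h ^ s) s :: 'n malg)" for h
      define L where "L h Y = Y * a h - b h * Y * d h + Y * b h" for h and Y :: "'n malg"
      define b0 where "b0 = fps_nth \<alpha>0 0"
      define Gf where "Gf h \<alpha> \<phi> = (\<Sum>i=1..s. fps_nth (fps_compose \<alpha> (recip_fps h)) i * fps_nth (fps_compose \<phi> (recip_fps h)) (s - i)) +
        fps_nth \<alpha> 0 * (\<Sum>j<s. fps_nth \<phi> j * fps_nth (recip_fps h ^ j) s) - (\<Sum>j<s. fps_nth \<phi> j * fps_nth (qc j h) (Suc s))"
        for h and \<alpha> \<phi> :: "'n malg fps"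
      have lim: "(a \<longlongrightarrow> - of_nat s) (at_right 0)" "(b \<longlongrightarrow> b0) (at_right 0)" "(d \<longlongrightarrow> 1) (at_right 0)"
      proof -
        have "(a \<longlongrightarrow> fps_nth (qc s 0) (Suc s)) (at_right 0)"
          using ctend_qc [of s] unfolding ctend_def a_def by blast
        moreover have "fps_nth (qc s 0) (Suc s) = (- of_nat s :: 'n malg)"
          unfolding qc_0 by (simp add: fps_X_power_mult_right_nth del: power_Suc flip: fps_of_nat)
        ultimately show "(a \<longlongrightarrow> - of_nat s) (at_right 0)" by simp
        show "(b \<longlongrightarrow> b0) (at_right 0)" using \<alpha> unfolding ctend_def b_def b0_def by blast
        have "(d \<longlongrightarrow> fps_nth (recip_fps 0 ^ s) s) (at_right 0)"
          using ctend_power [OF ctend_recip_fps', of s] unfolding ctend_def d_def by blast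
        then show "(d \<longlongrightarrow> 1) (at_right 0)" by (simp add: recip_fps_0)
      qed
      have u: "((\<lambda>h. fps_nth (recip_fps h ^ j) n) \<longlongrightarrow> fps_nth (recip_fps 0 ^ j :: 'n malg fps) n) (at_right 0)" for j n
        using ctend_power [OF ctend_recip_fps', of j] unfolding ctend_def by blast
      have qc: "((\<lambda>h. fps_nth (qc j h) n) \<longlongrightarrow> fps_nth (qc j 0 :: 'n malg fps) n) (at_right 0)" for j n
        using ctend_qc [of j] unfolding ctend_def by blast
      have comp: "((\<lambda>h. fps_nth (fps_compose (\<phi> h) (recip_fps h)) k) \<longlongrightarrow> fps_nth (fps_compose \<phi>0 (recip_fps 0)) k) (at_right 0)" if "k < s" for k
        unfolding fps_compose_nth
        using that less u by (intro tendsto_sum tendsto_mult) auto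
      have compa: "((\<lambda>h. fps_nth (fps_compose (\<alpha> h) (recip_fps h)) k) \<longlongrightarrow> fps_nth (fps_compose \<alpha>0 (recip_fps 0)) k) (at_right 0)" for k
        using ctend_compose [OF \<alpha> ctend_recip_fps'] unfolding ctend_def by blast
      have G: "((\<lambda>h. Gf h (\<alpha> h) (\<phi> h)) \<longlongrightarrow> Gf 0 \<alpha>0 \<phi>0) (at_right 0)"
        unfolding Gf_def
        using comp compa less lim(2) qc u
        unfolding b_def b0_def
        by (intro tendsto_diff tendsto_add tendsto_sum tendsto_mult) auto
      have eq: "\<forall>\<^sub>F h in at_right 0. L h (fps_nth (\<phi> h) s) = Gf h (\<alpha> h) (\<phi> h)"
        using rec(1) by eventually_elim (drule fps_rec_nth [of _ _ _ s], simp add: L_def Gf_def a_def b_def d_def)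
      have eq0: "- (of_nat s * fps_nth \<phi>0 s) - b0 * fps_nth \<phi>0 s + fps_nth \<phi>0 s * b0 = Gf 0 \<alpha>0 \<phi>0"
      proof -
        have "fps_nth (qc s 0) (Suc s) = (- of_nat s :: 'n malg)"
          unfolding qc_0 by (simp add: fps_X_power_mult_right_nth del: power_Suc flip: fps_of_nat)
        then show ?thesis
          using fps_rec_nth [OF rec(2), of s]
          by (simp add: Gf_def b0_def recip_fps_0 mult_of_nat_commute)
      qed
      \<comment> \<open>\<delta> bounds the difference between \<open>L h\<close> and the limiting
        operator, and \<epsilon> is the defect between \<open>L h\<close> at the s-th coefficient
        and the limiting right-hand side.\<close>
      define \<delta> where "\<delta> h = norm (a h - - of_nat s) + norm (b h) * norm (d h - 1) + norm (b h - b0) + norm (b h - b0)" for h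
      define \<epsilon> where "\<epsilon> h = norm (L h (fps_nth (\<phi> h) s) - Gf 0 \<alpha>0 \<phi>0)" for h
      show ?thesis
      proof (rule tendsto_of_linear_bound [OF \<kappa>(1)])
        fix h
        define Y where "Y = fps_nth (\<phi> h) s"
        define Y0 where "Y0 = fps_nth \<phi>0 s"
        have "- (of_nat s * (Y - Y0)) - b0 * (Y - Y0) + (Y - Y0) * b0 =
            (L h Y - Gf 0 \<alpha>0 \<phi>0) - (Y * (a h - - of_nat s) - (b h * Y * (d h - 1) + (b h - b0) * Y) + Y * (b h - b0))"
          unfolding eq0 [symmetric] L_def Y0_def by (simp add: algebra_simps mult_of_nat_commute)
        then have "\<kappa> * norm (Y - Y0) \<le>
            norm ((L h Y - Gf 0 \<alpha>0 \<phi>0) - (Y * (a h - - of_nat s) - (b h * Y * (d h - 1) + (b h - b0) * Y) + Y * (b h - b0)))"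
          using \<kappa>(2) [of "Y - Y0"] by (simp add: b0_def)
        also have "\<dots> \<le> \<epsilon> h + (norm Y * norm (a h - - of_nat s) +
            (norm (b h) * norm Y * norm (d h - 1) + norm (b h - b0) * norm Y) + norm Y * norm (b h - b0))"
          unfolding \<epsilon>_def Y_def [symmetric]
          by (intro order.trans [OF norm_triangle_ineq4] order.trans [OF norm_triangle_ineq] add_mono
              order.trans [OF norm_mult_ineq] mult_right_mono order_refl norm_ge_zero norm_mult_ineq)
        also have "\<dots> = \<delta> h * norm Y + \<epsilon> h"
          by (simp add: \<delta>_def algebra_simps)
        finally show "\<kappa> * norm (fps_nth (\<phi> h) s - fps_nth \<phi>0 s) \<le> \<delta> h * norm (fps_nth (\<phi> h) s) + \<epsilon> h"
          by (simp add: Y_def Y0_def)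
      next
        have "(\<delta> \<longlongrightarrow> norm (- of_nat s - - of_nat s :: 'n malg) + norm b0 * norm (1 - 1 :: 'n malg) + norm (b0 - b0) + norm (b0 - b0)) (at_right 0)"
          unfolding \<delta>_def by (intro tendsto_intros lim)
        then show "(\<delta> \<longlongrightarrow> 0) (at_right 0)" by simp
        have "((\<lambda>h. norm (Gf h (\<alpha> h) (\<phi> h) - Gf 0 \<alpha>0 \<phi>0)) \<longlongrightarrow> norm (Gf 0 \<alpha>0 \<phi>0 - Gf 0 \<alpha>0 \<phi>0)) (at_right 0)"
          by (intro tendsto_intros G)
        then have lim0: "((\<lambda>h. norm (Gf h (\<alpha> h) (\<phi> h) - Gf 0 \<alpha>0 \<phi>0)) \<longlongrightarrow> 0) (at_right 0)" by simp
        show "(\<epsilon> \<longlongrightarrow> 0) (at_right 0)"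
        proof (rule Lim_transform_eventually [OF lim0])
          show "\<forall>\<^sub>F h in at_right 0. norm (Gf h (\<alpha> h) (\<phi> h) - Gf 0 \<alpha>0 \<phi>0) = \<epsilon> h"
            using eq by eventually_elim (simp add: \<epsilon>_def)
        qed
      qed
    qed
  qed
qed

subsection \<open>Non-resonance\<close>

text \<open>The basis vector of the first index of a block is an eigenvector of the Jordan matrix,
  and Q transports it to \<open>M\<close>.\<close>

lemma jordan_mat_eigenvalue:
  assumes "jordan_reduction M Q b c"
  shows "is_eigenvalue M (c (b i))"
proof -
  have M: "invertible Q" "M = Q ** jordan_mat b c ** matrix_inv Q"
    using assms by (auto simp: jordan_reduction_def)
  have inv: "matrix_inv Q ** Q = mat 1"
    using someI_ex [OF M(1)[unfolded invertible_def]] unfolding matrix_inv_def by simp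
  define k where "k = Min {k. b k = b i}"
  have k: "b k = b i" "\<And>l. b l = b i \<Longrightarrow> k \<le> l"
    using Min_in [of "{k. b k = b i}"] by (auto simp: k_def)
  have "jordan_mat b c *v axis k 1 = c (b i) *s axis k 1"
  proof -
    have "(jordan_mat b c *v axis k 1) $ l = jordan_mat b c $ l $ k" for l
      by (simp add: matrix_vector_mult_def axis_def if_distrib [of "\<lambda>x. _ * x"] cong: if_cong)
    moreover have "jordan_mat b c $ l $ k = (if l = k then c (b i) else 0)" for l
    proof -
      have "l = k" if "b l = b i" "l \<le> k" using k(2) [OF that(1)] that(2) by simp
      then show ?thesis using k(1) by (auto simp: jordan_mat_def block_toeplitz_def)
    qed
    ultimately show ?thesis by (simp add: vec_eq_iff axis_def)
  qed
  then have "M *v (Q *v axis k 1) = c (b i) *s (Q *v axis k 1)"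
    unfolding M(2) matrix_vector_mul_assoc [symmetric]
    by (simp add: matrix_vector_mul_assoc inv matrix_vector_mul_assoc [symmetric] vector_scalar_commute)
  moreover have "Q *v axis k 1 \<noteq> 0"
  proof
    assume "Q *v axis k (1::complex) = 0"
    then have "matrix_inv Q *v (Q *v axis k 1) = 0" by simp
    then show False by (simp add: matrix_vector_mul_assoc inv axis_eq_0_iff)
  qed
  ultimately show ?thesis unfolding is_eigenvalue_def by blast
qed

text \<open>In Jordan coordinates the Sylvester operator is triangular: look at the lowest nonzero entry of the
  first nonzero column.\<close>

lemma sylvester_injective:
  assumes "jordan_reduction M Q b c" "non_resonant M" "s \<ge> 1"
    and Y: "- (of_nat s * Y) - alg_of M * Y + Y * alg_of M = 0"
  shows "Y = 0"
proof (rule ccontr)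
  assume "Y \<noteq> 0"
  have M: "invertible Q" "M = Q ** jordan_mat b c ** matrix_inv Q"
    using assms by (auto simp: jordan_reduction_def)
  define q where "q = alg_of Q"
  define q' where "q' = alg_of (matrix_inv Q)"
  define J where "J = alg_of (jordan_mat b c)"
  have inv: "q' * q = 1" "q * q' = 1"
    using someI_ex [OF M(1)[unfolded invertible_def]] unfolding matrix_inv_def q_def q'_def
    by (simp_all add: alg_of_mult [symmetric])
  have AM: "alg_of M = q * J * q'" unfolding M(2) by (simp add: alg_of_mult q_def q'_def J_def)
  define Z where "Z = q' * Y * q"
  have "q * Z * q' = (q * q') * Y * (q * q')" by (simp add: Z_def mult.assoc)
  then have "Z \<noteq> 0" using \<open>Y \<noteq> 0\<close> inv by auto
  have "J * Z = q' * (alg_of M * Y) * q" "Z * J = q' * (Y * alg_of M) * q"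
  proof -
    have "q' * (alg_of M * Y) * q = (q' * q) * J * q' * Y * q" by (simp add: AM mult.assoc)
    then show "J * Z = q' * (alg_of M * Y) * q" by (simp add: inv Z_def mult.assoc)
    have "q' * (Y * alg_of M) * q = q' * Y * q * J * (q' * q)" by (simp add: AM mult.assoc)
    then show "Z * J = q' * (Y * alg_of M) * q" by (simp add: inv Z_def mult.assoc)
  qed
  moreover have "of_nat s * Z = q' * (of_nat s * Y) * q"
    by (simp add: Z_def mult.assoc) (metis mult.assoc mult_of_nat_commute)
  ultimately have "- (of_nat s * Z) - J * Z + Z * J =
      q' * (- (of_nat s * Y) - alg_of M * Y + Y * alg_of M) * q" by (simp add: algebra_simps)
  then have eq: "- (of_nat s * Z) - J * Z + Z * J = 0" using Y by simp
  define S where "S = {j. \<exists>i. ent Z i j \<noteq> 0}"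
  define j where "j = Min S"
  have "S \<noteq> {}" using \<open>Z \<noteq> 0\<close> malg_eqI [of Z 0] by (auto simp: S_def)
  then have "j \<in> S" unfolding j_def by (intro Min_in finite)
  define T where "T = {i. ent Z i j \<noteq> 0}"
  define i where "i = Max T"
  have "T \<noteq> {}" using \<open>j \<in> S\<close> by (auto simp: S_def T_def)
  then have "i \<in> T" unfolding i_def by (intro Max_in finite)
  then have i1: "ent Z i j \<noteq> 0" by (simp add: T_def)
  have j2: "ent Z i k = 0" if "k < j" for i k
  proof (rule ccontr)
    assume "ent Z i k \<noteq> 0"
    then have "k \<in> S" by (auto simp: S_def)
    then have "j \<le> k" unfolding j_def by (intro Min_le finite)
    then show False using that by simp
  qed
  have i2: "ent Z k j = 0" if "i < k" for k
  proof (rule ccontr)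
    assume "ent Z k j \<noteq> 0"
    then have "k \<in> T" by (auto simp: T_def)
    then have "k \<le> i" unfolding i_def by (intro Max_ge finite)
    then show False using that by simp
  qed
  have J: "ent J k l = 0" if "\<not> k \<le> l" for k l using that by (simp add: J_def jordan_mat_def block_toeplitz_def)
  have Jd: "ent J k k = c (b k)" for k by (simp add: J_def jordan_mat_def block_toeplitz_def)
  have "ent (J * Z) i j = (\<Sum>k\<in>{i}. ent J i k * ent Z k j)"
    unfolding ent_mult
  proof (rule sum.mono_neutral_right)
    show "\<forall>k\<in>UNIV - {i}. ent J i k * ent Z k j = 0"
    proof
      fix k assume "k \<in> UNIV - {i}"
      then consider "k < i" | "i < k" by fastforce
      then show "ent J i k * ent Z k j = 0" by cases (use J [of i k] i2 [of k] in auto)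
    qed
  qed auto
  moreover have "ent (Z * J) i j = (\<Sum>k\<in>{j}. ent Z i k * ent J k j)"
    unfolding ent_mult
  proof (rule sum.mono_neutral_right)
    show "\<forall>k\<in>UNIV - {j}. ent Z i k * ent J k j = 0"
    proof
      fix k assume "k \<in> UNIV - {j}"
      then consider "k < j" | "j < k" by fastforce
      then show "ent Z i k * ent J k j = 0" by cases (use J [of k j] j2 [of k] in auto)
    qed
  qed auto
  moreover have "ent (of_nat s * Z) i j = of_nat s * ent Z i j"
    by (metis ent_sc_mult of_real_of_nat_eq sc_of_real)
  moreover have "ent (- (of_nat s * Z) - J * Z + Z * J) i j = 0" by (simp add: eq)
  \<comment> \<open>At this entry only the diagonal of \<open>J\<close> contributes, so two
    eigenvalues would differ by s.\<close>
  ultimately have "(- of_nat s - c (b i) + c (b j)) * ent Z i j = 0" by (simp add: Jd algebra_simps)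
  then have "- of_nat s - c (b i) + c (b j) = 0" using i1 by simp
  then have "c (b j) - c (b i) = of_nat s" by (simp add: algebra_simps)
  moreover have "is_eigenvalue M (c (b j))" "is_eigenvalue M (c (b i))"
    using jordan_mat_eigenvalue assms(1) by blast+
  ultimately have "c (b j) = c (b i)" using assms(2) unfolding non_resonant_def by (metis Ints_of_nat)
  with \<open>c (b j) - c (b i) = of_nat s\<close> assms(3) show False by simp
qed

lemma norm_malg_le: "norm (m :: ('n::finite) malg) \<le> real (CARD('n))^2 * norm (mat_of m)"
proof -
  have "cmod (ent m i j) \<le> norm (mat_of m)" for i j
    unfolding ent_def by (meson Finite_Cartesian_Product.norm_nth_le order.trans)
  then have "norm m \<le> (\<Sum>i\<in>(UNIV::'n set). \<Sum>j\<in>(UNIV::'n set). norm (mat_of m))"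
    by (intro order.trans [OF norm_le_sum_ent] sum_mono)
  then show ?thesis by (simp add: power2_eq_square)
qed

text \<open>In finite dimension injectivity gives a lower bound. It is taken in the Euclidean norm
  of matrices and transferred by two comparisons of norms, each with the factor n^2.\<close>

lemma linear_malg_bounded_below:
  fixes L :: "('n::finite) malg \<Rightarrow> 'n malg"
  assumes "linear L" "\<And>Y. L Y = 0 \<Longrightarrow> Y = 0"
  shows "\<exists>\<kappa>>0. \<forall>Y. \<kappa> * norm Y \<le> norm (L Y)"
proof -
  define f where "f = (\<lambda>M. mat_of (L (alg_of M)))"
  have alg: "alg_of (M + M') = alg_of M + alg_of M'" "alg_of (r *\<^sub>R M) = r *\<^sub>R alg_of M" for r and M M' :: "'n cmat"
    by (simp_all add: plus_malg.abs_eq scaleR_malg.abs_eq)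
  have "linear f"
    by (rule linearI) (simp_all add: f_def alg linear_add [OF assms(1)] linear_scale [OF assms(1)]
        plus_malg.rep_eq scaleR_malg.rep_eq)
  moreover have "inj f"
  proof (subst linear_injective_0 [OF \<open>linear f\<close>], intro allI impI)
    fix M assume "f M = 0"
    then have "L (alg_of M) = 0" by (metis f_def mat_of_inverse alg_of_0)
    then have "alg_of M = 0" by (rule assms(2))
    then show "M = 0" by (metis alg_of_0 alg_of_inject UNIV_I)
  qed
  ultimately obtain B where B: "B > 0" "\<And>M. B * norm M \<le> norm (f M)"
    using linear_inj_bounded_below_pos by blast
  define c where "c = real (CARD('n))^2"
  have c: "c > 0" by (simp add: c_def)
  show ?thesis
  proof (intro exI conjI allI)
    show "B / (c * c) > 0" using B c by simp
    fix Y :: "'n malg"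
    have "B * norm Y \<le> B * (c * norm (mat_of Y))"
      using B norm_malg_le [of Y] by (intro mult_left_mono) (auto simp: c_def)
    also have "\<dots> \<le> c * norm (f (mat_of Y))" using B(2) [of "mat_of Y"] c by simp
    also have "\<dots> \<le> c * (c * norm (L Y))"
      using norm_mat_of_le [of "L Y"] c by (intro mult_left_mono) (auto simp: c_def f_def mat_of_inverse)
    finally show "B / (c * c) * norm Y \<le> norm (L Y)" using c by (simp add: field_simps)
  qed
qed

lemma sylvester_bounded_below:
  assumes "jordan_reduction M Q b c" "non_resonant M" "s \<ge> 1"
  shows "\<exists>\<kappa>>0. \<forall>Y. \<kappa> * norm Y \<le> norm (- (of_nat s * Y) - alg_of M * Y + Y * alg_of M)"
proof (rule linear_malg_bounded_below)
  show "linear (\<lambda>Y. - (of_nat s * Y) - alg_of M * Y + Y * alg_of M)"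
    by (rule linearI) (simp_all add: algebra_simps)
qed (rule sylvester_injective [OF assms])

subsection \<open>Expansions of factorial series and of power series\<close>

lemma rising_0 [simp]: "rising h 0 x = 1"
  by (simp add: rising_def)

lemma rising_Suc: "rising h (Suc s) x = rising h s x * (x + of_real (of_nat s * h))"
  by (simp add: rising_def)

lemma rising_Suc': "rising h (Suc s) x = x * rising h s (x + of_real h)"
  unfolding rising_def by (subst prod.lessThan_Suc_shift) (simp add: algebra_simps)

lemma rising_pos: "h > 0 \<Longrightarrow> (x::real) > 0 \<Longrightarrow> rising h s x > 0"
  and rising_nonneg: "h > 0 \<Longrightarrow> (x::real) \<ge> 0 \<Longrightarrow> rising h s x \<ge> 0"
  by (auto simp: rising_def intro!: prod_pos prod_nonneg add_pos_nonneg)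

lemma rising_ge_power: "h > 0 \<Longrightarrow> (x::real) \<ge> 0 \<Longrightarrow> x ^ s \<le> rising h s x"
  by (induction s) (auto simp: rising_Suc mult.commute [of x] intro!: mult_mono rising_nonneg)

lemma rising_le_power:
  assumes "0 < h" "h \<le> 1" "(x::real) \<ge> 0" "s \<le> m"
  shows "rising h s x \<le> (x + real m) ^ s"
proof -
  have "rising h s x \<le> (\<Prod>k<s. x + real m)"
    unfolding rising_def
  proof (rule prod_mono, intro conjI)
    fix k assume "k \<in> {..<s}"
    then have "real k * h \<le> real m * 1" using assms by (intro mult_mono) auto
    then show "x + of_real (real k * h) \<le> x + real m" by simp
  qed (use assms in auto)
  then show ?thesis by simp
qed

lemma norm_rising_ge:
  assumes "h > 0" "Re x \<ge> 0"
  shows "rising h s (Re x) \<le> cmod (rising h s x)"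
  unfolding rising_def prod_norm [symmetric]
proof (rule prod_mono, intro conjI)
  fix k
  show "Re x + of_real (real k * h) \<le> cmod (x + of_real (real k * h))"
    using complex_Re_le_cmod [of "x + of_real (real k * h)"] by simp
qed (use assms in auto)

text \<open>The majorant telescopes: \<open>(\<xi> - l) l\<^bsup>[s]\<^esup> / \<xi>\<^bsup>[s+1]\<^esup> = l\<^bsup>[s]\<^esup> / \<xi>\<^bsup>[s]\<^esup> - l\<^bsup>[s+1]\<^esup> / \<xi>\<^bsup>[s+1]\<^esup>\<close>.\<close>

lemma factorial_series_tail:
  fixes a :: "nat \<Rightarrow> ('n::finite) malg"
  assumes h: "h > 0" and l: "l \<ge> 0" and C: "C \<ge> 0"
    and a: "\<And>s. s \<ge> 1 \<Longrightarrow> norm (a s) \<le> C * rising h (s - 1) l"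
    and x: "Re x > l"
  shows "summable (\<lambda>s. norm (sc (1 / rising h s x) * a s))"
    and "norm ((\<Sum>s. sc (1 / rising h s x) * a s) - (\<Sum>s\<le>m. sc (1 / rising h s x) * a s))
      \<le> C * (rising h m l / rising h m (Re x)) / (Re x - l)"
proof -
  define \<xi> where "\<xi> = Re x"
  have \<xi>: "\<xi> > l" "\<xi> > 0" using x l by (auto simp: \<xi>_def)
  define t where "t s = rising h s l / rising h s \<xi>" for s
  have tpos: "t s \<ge> 0" for s
    unfolding t_def using h l \<xi> by (intro divide_nonneg_pos rising_nonneg rising_pos) auto
  define f where "f s = sc (1 / rising h s x) * a s" for s
  have f: "norm (f (Suc s)) \<le> C / (\<xi> - l) * (t s - t (Suc s))" for s
  proof -
    have r: "rising h s \<xi> > 0" "rising h (Suc s) \<xi> > 0" using h \<xi> by (auto intro: rising_pos)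
    have "norm (f (Suc s)) = norm (a (Suc s)) / cmod (rising h (Suc s) x)"
      by (simp add: f_def norm_divide)
    also have "\<dots> \<le> C * rising h s l / rising h (Suc s) \<xi>"
      using a [of "Suc s"] norm_rising_ge [OF h, of x "Suc s"] \<xi> r h l C
      by (intro frac_le) (auto simp: \<xi>_def intro!: mult_nonneg_nonneg rising_nonneg)
    also have "\<dots> = C / (\<xi> - l) * (t s - t (Suc s))"
    proof -
      have "\<xi> + real s * h \<noteq> 0" using \<xi> h by (smt (verit) mult_nonneg_nonneg of_nat_0_le_iff)
      then have "t s - t (Suc s) = rising h s l / rising h s \<xi> * ((\<xi> - l) / (\<xi> + real s * h))"
        using r(1) unfolding t_def rising_Suc by (simp add: divide_simps) (simp add: algebra_simps)
      then show ?thesis using \<xi> by (simp add: rising_Suc)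
    qed
    finally show ?thesis .
  qed
  have part: "(\<Sum>n<N. norm (f (n + Suc m))) \<le> C * t m / (\<xi> - l)" for N m
  proof -
    have "(\<Sum>n<N. norm (f (n + Suc m))) \<le> (\<Sum>n<N. C / (\<xi> - l) * (t (n + m) - t (Suc n + m)))"
      using f by (intro sum_mono) auto
    also have "\<dots> = C / (\<xi> - l) * (t m - t (N + m))"
    proof -
      have "(\<Sum>n<N. t (n + m) - t (Suc n + m)) = t m - t (N + m)" by (induction N) auto
      then show ?thesis by (simp only: sum_distrib_left [symmetric])
    qed
    also have "\<dots> \<le> C / (\<xi> - l) * t m"
      using tpos [of "N + m"] C \<xi> by (intro mult_left_mono) auto
    finally show ?thesis by simp
  qed
  have sn: "summable (\<lambda>n. norm (f (n + Suc m)))" for m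
    by (rule summableI_nonneg_bounded [OF _ part]) auto
  have "summable (\<lambda>n. norm (f n))"
    using sn [of 0] summable_iff_shift [of "\<lambda>n. norm (f n)" 1] by simp
  then have "summable f" by (rule summable_norm_cancel)
  from \<open>summable (\<lambda>n. norm (f n))\<close> show "summable (\<lambda>s. norm (sc (1 / rising h s x) * a s))"
    by (simp add: f_def [abs_def])
  from \<open>summable f\<close> have "suminf f - (\<Sum>s\<le>m. f s) = (\<Sum>n. f (n + Suc m))"
    using suminf_minus_initial_segment [OF \<open>summable f\<close>, of "Suc m"] by (simp add: lessThan_Suc_atMost)
  moreover have "norm (\<Sum>n. f (n + Suc m)) \<le> C * t m / (\<xi> - l)"
    using summable_norm [OF sn] suminf_le_const [OF sn part] by (rule order.trans)
  ultimately show "norm ((\<Sum>s. sc (1 / rising h s x) * a s) - (\<Sum>s\<le>m. sc (1 / rising h s x) * a s))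
      \<le> C * (rising h m l / rising h m (Re x)) / (Re x - l)"
    by (simp add: f_def [abs_def] t_def \<xi>_def)
qed

text \<open>The expansion of \<open>1 / rising h s x\<close> in 1/x. It has order s, so each power
  of 1/x receives contributions from finitely many terms of a factorial series;
  \<open>fact_fps\<close> collects them.\<close>

primrec rprod :: "real \<Rightarrow> nat \<Rightarrow> ('n::finite) malg fps" where
  "rprod h 0 = 1"
| "rprod h (Suc s) = rprod h s * recip_fps (of_nat s * h)"

lemma uexp_inverse_rising:
  "H \<subseteq> {0..1} \<Longrightarrow> uexp H (\<lambda>h x. sc (1 / rising h s x)) (\<lambda>h. rprod h s)"
proof (induction s)
  case 0
  show ?case using uexp_const [of H "\<lambda>_. 1" 1] by simp
next
  case (Suc s)
  have "sc (1 / rising h (Suc s) x) = (sc (1 / rising h s x) * sc (1 / (x + of_real (of_nat s * h))) :: 'a malg)" for h x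
    by (simp add: rising_Suc sc_mult [symmetric])
  then show ?case unfolding rprod.simps using Suc by (simp only: uexp_mult uexp_recip)
qed

lemma rprod_prefix: "n < s \<Longrightarrow> fps_nth (rprod h s) n = 0"
proof (induction s arbitrary: n)
  case (Suc s)
  have "fps_nth (rprod h s) i * fps_nth (recip_fps (of_nat s * h) :: 'a malg fps) (n - i) = 0" if "i \<le> n" for i
    using Suc.IH [of i] Suc.prems that by (cases "i = n") auto
  then show ?case by (simp add: fps_mult_nth)
qed simp

lemma ctend_rprod: "ctend (\<lambda>h. rprod h s) (fps_X ^ s)"
proof (induction s)
  case (Suc s)
  have "ctend (\<lambda>h. rprod h s * recip_fps (of_nat s * h)) (fps_X ^ s * fps_X :: 'a malg fps)"
    by (intro ctend_mult Suc ctend_recip_fps)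
  then show ?case by (simp add: power_commutes)
qed (simp add: ctend_const)

definition fact_fps :: "real \<Rightarrow> (nat \<Rightarrow> ('n::finite) malg) \<Rightarrow> 'n malg fps" where
  "fact_fps h a = Abs_fps (\<lambda>n. \<Sum>s\<le>n. a s * fps_nth (rprod h s) n)"

lemma fact_fps_nth_0: "fps_nth (fact_fps h a) 0 = a 0"
  by (simp add: fact_fps_def)

lemma ctend_fact_fps:
  assumes "\<And>s. ((\<lambda>h. a h s) \<longlongrightarrow> a' s) (at_right 0)"
  shows "ctend (\<lambda>h. fact_fps h (a h)) (Abs_fps a')"
  unfolding ctend_def
proof
  fix n
  have "((\<lambda>h. \<Sum>s\<le>n. a h s * fps_nth (rprod h s) n) \<longlongrightarrow> (\<Sum>s\<le>n. a' s * fps_nth (fps_X ^ s) n)) (at_right 0)"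
    using ctend_rprod unfolding ctend_def by (intro tendsto_sum tendsto_mult assms) blast
  moreover have "(\<Sum>s\<le>n. a' s * fps_nth (fps_X ^ s) n) = a' n"
    by (subst sum.mono_neutral_right [of _ "{n}"]) (auto simp: fps_X_power_iff)
  ultimately show "((\<lambda>h. fps_nth (fact_fps h (a h)) n) \<longlongrightarrow> fps_nth (Abs_fps a') n) (at_right 0)"
    by (simp add: fact_fps_def)
qed

text \<open>The type condition bounds the tail after m terms by a multiple of the quotient of the
  m-th rising factorials of \<open>l\<close> and Re x, divided by Re x - l. This is O(x^-(m+1))
  uniformly for h \<le> 1, and finitely many terms are expanded directly.\<close>

lemma uexp_factorial_series:
  fixes a :: "real \<Rightarrow> nat \<Rightarrow> ('n::finite) malg"
  assumes H: "H \<subseteq> {0<..1}" and l: "l \<ge> 0" and C: "C \<ge> 0"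
    and a: "\<And>h s. h \<in> H \<Longrightarrow> s \<ge> 1 \<Longrightarrow> norm (a h s) \<le> C * rising h (s - 1) l"
    and a0: "\<And>h. h \<in> H \<Longrightarrow> norm (a h 0) \<le> B"
    and f: "\<And>h x. h \<in> H \<Longrightarrow> Re x > R \<Longrightarrow> (\<lambda>s. sc (1 / rising h s x) * a h s) sums f h x"
  shows "uexp H f (\<lambda>h. fact_fps h (a h))"
proof (rule uexp_approx)
  fix m
  have H01: "H \<subseteq> {0..1}" using H by auto
  have ab: "\<exists>B. \<forall>h\<in>H. norm (a h s) \<le> B" for s
  proof (cases s)
    case 0
    then show ?thesis using a0 by auto
  next
    case (Suc k)
    have "norm (a h s) \<le> C * (l + real k) ^ k" if "h \<in> H" for h
    proof -
      have "norm (a h s) \<le> C * rising h k l" using a [OF that, of s] Suc by simp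
      also have "\<dots> \<le> C * (l + real k) ^ k"
        using H that l C by (intro mult_left_mono rising_le_power) auto
      finally show ?thesis .
    qed
    then show ?thesis by blast
  qed
  show "\<exists>g' c' K R. uexp H g' c' \<and>
      (\<forall>h\<in>H. \<forall>s\<le>m. fps_nth (c' h) s = fps_nth (fact_fps h (a h)) s) \<and>
      (\<forall>h\<in>H. \<forall>x. Re x \<ge> R \<longrightarrow> norm (f h x - g' h x) \<le> K / Re x ^ (m + 1))"
  proof (intro exI conjI)
    show "uexp H (\<lambda>h x. \<Sum>s\<le>m. a h s * sc (1 / rising h s x)) (\<lambda>h. \<Sum>s\<le>m. fps_const (a h s) * rprod h s)"
    proof (intro uexp_sum uexp_mult uexp_inverse_rising H01)
      fix s
      obtain B where "\<forall>h\<in>H. norm (a h s) \<le> B" using ab by blast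
      then show "uexp H (\<lambda>h x. a h s) (\<lambda>h. fps_const (a h s))" by (intro uexp_const) blast
    qed
    show "\<forall>h\<in>H. \<forall>s\<le>m. fps_nth (\<Sum>s\<le>m. fps_const (a h s) * rprod h s) s = fps_nth (fact_fps h (a h)) s"
    proof (intro ballI allI impI)
      fix h n assume "n \<le> m"
      have "fps_nth (\<Sum>s\<le>m. fps_const (a h s) * rprod h s) n = (\<Sum>s\<le>m. a h s * fps_nth (rprod h s) n)"
        by (simp add: fps_sum_nth)
      also have "\<dots> = (\<Sum>s\<le>n. a h s * fps_nth (rprod h s) n)"
        using \<open>n \<le> m\<close> by (intro sum.mono_neutral_right) (auto simp: rprod_prefix not_le)
      finally show "fps_nth (\<Sum>s\<le>m. fps_const (a h s) * rprod h s) n = fps_nth (fact_fps h (a h)) n"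
        by (simp add: fact_fps_def)
    qed
    \<comment> \<open>From 2 l + 1 on, Re x - l is at least half of Re x; this accounts for the
      factor 2.\<close>
    show "\<forall>h\<in>H. \<forall>x. Re x \<ge> max (2 * l + 1) (R + 1) \<longrightarrow>
        norm (f h x - (\<Sum>s\<le>m. a h s * sc (1 / rising h s x))) \<le> (2 * C * (l + real m) ^ m) / Re x ^ (m + 1)"
    proof (intro ballI allI impI)
      fix h x assume h: "h \<in> H" and x: "Re x \<ge> max (2 * l + 1) (R + 1)"
      have h0: "0 < h" "h \<le> 1" using h H by auto
      have \<xi>: "Re x > l" "Re x > 0" "Re x - l \<ge> Re x / 2" "Re x > R" using x l by auto
      have "f h x = (\<Sum>s. sc (1 / rising h s x) * a h s)"
        using f [OF h \<xi>(4)] by (simp add: sums_iff)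
      moreover have "(\<Sum>s\<le>m. a h s * sc (1 / rising h s x)) = (\<Sum>s\<le>m. sc (1 / rising h s x) * a h s)"
        by (simp add: sc_commute)
      ultimately have "norm (f h x - (\<Sum>s\<le>m. a h s * sc (1 / rising h s x))) \<le>
          C * (rising h m l / rising h m (Re x)) / (Re x - l)"
        using factorial_series_tail(2) [OF h0(1) l C a [OF h] \<xi>(1), of m] by simp
      also have "\<dots> \<le> C * ((l + real m) ^ m / Re x ^ m) / (Re x / 2)"
        using h0 l \<xi> C rising_ge_power [of h "Re x" m] rising_nonneg [of h l m]
        by (intro frac_le mult_left_mono rising_le_power mult_nonneg_nonneg) auto
      also have "\<dots> = (2 * C * (l + real m) ^ m) / Re x ^ (m + 1)"
        by (simp add: mult_ac)
      finally show "norm (f h x - (\<Sum>s\<le>m. a h s * sc (1 / rising h s x))) \<le> (2 * C * (l + real m) ^ m) / Re x ^ (m + 1)" .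
    qed
  qed
qed

text \<open>Convergence at one point x1 bounds the terms there, so any convergent factorial series
  satisfies the growth condition with M x1 and x1 + h in place of \<open>C\<close> and
  \<open>l\<close>. These constants depend on h, hence the singleton.\<close>

lemma uexp_factorial_series_single:
  fixes a :: "nat \<Rightarrow> ('n::finite) malg"
  assumes h: "0 < h" "h \<le> 1"
    and f: "\<And>x. Re x > R \<Longrightarrow> (\<lambda>s. sc (1 / rising h s x) * a s) sums f x"
  shows "uexp {h} (\<lambda>_. f) (\<lambda>h. fact_fps h a)"
proof -
  define x1 where "x1 = \<bar>R\<bar> + 1"
  have x1: "x1 > 0" "x1 > R" by (auto simp: x1_def)
  have "summable (\<lambda>s. sc (1 / rising h s (of_real x1)) * a s)"
    using f [of "of_real x1"] x1 by (auto simp: sums_iff)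
  then have "Bseq (\<lambda>s. sc (1 / rising h s (of_real x1)) * a s)"
    by (intro convergent_imp_Bseq) (auto dest: summable_LIMSEQ_zero simp: convergent_def)
  then obtain M where M: "M > 0" "\<And>s. norm (sc (1 / rising h s (of_real x1)) * a s) \<le> M"
    by (auto simp: Bseq_def)
  have r: "cmod (rising h s (of_real x1)) = rising h s x1" for s
  proof -
    have "rising h s (of_real x1 :: complex) = of_real (rising h s x1)" by (simp add: rising_def)
    then show ?thesis using rising_pos [OF h(1) x1(1), of s] by simp
  qed
  have bound: "norm (a s) \<le> M * x1 * rising h (s - 1) (x1 + h)" if "s \<ge> 1" for s
  proof -
    obtain k where k: "s = Suc k" using \<open>s \<ge> 1\<close> by (cases s) auto
    have "norm (a s) / rising h s x1 \<le> M" using M(2) [of s] r [of s] by (simp add: norm_divide)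
    then have "norm (a s) \<le> M * rising h s x1"
      using rising_pos [OF h(1) x1(1), of s] by (simp add: pos_divide_le_eq)
    then show ?thesis by (simp add: k rising_Suc' mult.assoc)
  qed
  show ?thesis
    by (rule uexp_factorial_series [where C = "M * x1" and l = "x1 + h" and B = "norm (a 0)" and R = R])
      (use h x1 M bound f in auto)
qed

lemma uexp_power_series:
  fixes a :: "nat \<Rightarrow> ('n::finite) malg"
  assumes f: "\<And>x. cmod x > R \<Longrightarrow> (\<lambda>s. sc (1 / x ^ s) * a s) sums f x"
  shows "uexp H (\<lambda>_. f) (\<lambda>_. Abs_fps a)"
proof (rule uexp_h_indep [of 0])
  define r where "r = \<bar>R\<bar> + 1"
  have r: "r > 0" "r > R" "r \<ge> 1" by (auto simp: r_def)
  have "summable (\<lambda>s. sc (1 / of_real r ^ s) * a s)"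
    using f [of "of_real r"] r by (auto simp: sums_iff)
  then have "Bseq (\<lambda>s. sc (1 / of_real r ^ s) * a s)"
    by (intro convergent_imp_Bseq) (auto dest: summable_LIMSEQ_zero simp: convergent_def)
  then obtain M where M: "M > 0" "\<And>s. norm (sc (1 / of_real r ^ s) * a s) \<le> M"
    by (auto simp: Bseq_def)
  have a: "norm (a s) \<le> M * r ^ s" for s
    using M(2) [of s] r by (simp add: norm_divide norm_power pos_divide_le_eq)
  show "uexp {0} (\<lambda>_. f) (\<lambda>_. Abs_fps a)"
    unfolding uexp_def
  proof (intro conjI allI)
    fix m
    show "\<exists>K R. \<forall>h\<in>{0::real}. \<forall>x. Re x \<ge> R \<longrightarrow>
        norm (f x - trunc m (Abs_fps a) x) \<le> K / Re x ^ (m + 1)"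
    proof (rule exI [of _ "2 * M * r ^ (m + 1)"], rule exI [of _ "2 * r"], intro ballI allI impI)
      fix x assume x: "Re x \<ge> 2 * r"
      then have cx: "cmod x \<ge> 2 * r" "cmod x \<ge> Re x" "Re x > 0" using complex_Re_le_cmod [of x] r by auto
      define g where "g s = sc (1 / x ^ s) * a s" for s
      have "g sums f x" unfolding g_def using f [of x] cx r by simp
      moreover have "trunc m (Abs_fps a) x = (\<Sum>s<Suc m. g s)"
        by (auto simp: g_def lessThan_Suc_atMost sc_power [symmetric] sc_commute power_divide intro!: sum.cong)
      ultimately have e: "f x - trunc m (Abs_fps a) x = (\<Sum>n. g (n + Suc m))"
        using suminf_minus_initial_segment [of g "Suc m"] by (simp add: sums_iff)
      have "norm (g (n + Suc m)) \<le> M * (r / Re x) ^ Suc m * (1/2) ^ n" for n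
      proof -
        have "norm (g (n + Suc m)) = norm (a (n + Suc m)) / cmod x ^ (n + Suc m)"
          by (simp add: g_def norm_divide norm_power norm_mult)
        also have "\<dots> \<le> M * r ^ (n + Suc m) / cmod x ^ (n + Suc m)"
          by (intro divide_right_mono a) auto
        also have "\<dots> = M * ((r / cmod x) ^ n * (r / cmod x) ^ Suc m)"
          unfolding power_add power_divide by simp
        also have "\<dots> \<le> M * ((1/2) ^ n * (r / Re x) ^ Suc m)"
        proof -
          have "cmod x > 0" using cx r by linarith
          then have "r / cmod x \<le> 1 / 2" using cx r by (simp add: pos_divide_le_eq)
          moreover have "r / cmod x \<le> r / Re x" using cx r by (intro frac_le) auto
          ultimately show ?thesis
            using cx r M by (intro mult_left_mono mult_mono power_mono) auto
        qed
        finally show ?thesis by (simp only: mult.commute mult.left_commute)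
      qed
      moreover have "(\<lambda>n. M * (r / Re x) ^ Suc m * (1/2) ^ n) sums (M * (r / Re x) ^ Suc m * 2)"
        using geometric_sums [of "1/2 :: real"] by (intro sums_mult) simp
      ultimately have "norm (\<Sum>n. g (n + Suc m)) \<le> M * (r / Re x) ^ Suc m * 2"
        using norm_suminf_le [of "\<lambda>n. g (n + Suc m)" "\<lambda>n. M * (r / Re x) ^ Suc m * (1/2) ^ n"]
        by (simp add: sums_iff)
      then show "norm (f x - trunc m (Abs_fps a) x) \<le> 2 * M * r ^ (m + 1) / Re x ^ (m + 1)"
        unfolding e by (simp add: power_divide mult.commute mult.left_commute)
    qed
  qed auto
qed

lemma uexp_limit:
  assumes "uexp {h} (\<lambda>_. f) c" "((\<lambda>t. f (of_real t)) \<longlongrightarrow> l) at_top"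
  shows "fps_nth (c h) 0 = l"
proof -
  obtain K R where KR: "K \<ge> 0" "R \<ge> 1" "\<And>h' x. h' \<in> {h} \<Longrightarrow> Re x \<ge> R \<Longrightarrow>
    norm (f x - trunc 0 (c h') x) \<le> K / Re x ^ (0 + 1)"
    by (rule uexpD [OF assms(1), of 0]) blast
  have "((\<lambda>t. K / t) \<longlongrightarrow> 0) at_top"
    by (intro tendsto_divide_0 [OF tendsto_const] filterlim_at_top_imp_at_infinity filterlim_ident)
  moreover have "\<forall>\<^sub>F t in at_top. norm (f (of_real t) - fps_nth (c h) 0) \<le> K / t"
    using eventually_ge_at_top [of R] by eventually_elim (use KR(3) [of h "of_real t" for t] in auto)
  ultimately have "((\<lambda>t. f (of_real t) - fps_nth (c h) 0) \<longlongrightarrow> 0) at_top"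
    by (rule Lim_null_comparison [rotated])
  then have "((\<lambda>t. f (of_real t)) \<longlongrightarrow> fps_nth (c h) 0) at_top" by (simp add: LIM_zero_iff)
  then show ?thesis using assms(2) by (intro tendsto_unique [of at_top]) auto
qed

subsection \<open>Discrete Gronwall estimates\<close>

text \<open>Indices increase to the right while errors travel to the left: u n is the initial error,
  u 0 the final one. As all factors are at least 1, each residual is amplified by at most the full
  product.\<close>

lemma discrete_gronwall:
  fixes u \<rho> \<beta> :: "nat \<Rightarrow> real"
  assumes "\<And>k. k < n \<Longrightarrow> u k \<le> (1 + \<beta> k) * u (Suc k) + \<rho> k"
    and "\<And>k. \<beta> k \<ge> 0" "\<And>k. \<rho> k \<ge> 0"
  shows "u 0 \<le> (\<Prod>k<n. 1 + \<beta> k) * (u n + (\<Sum>k<n. \<rho> k))"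
  using assms(1)
proof (induction n)
  case (Suc n)
  have P: "(\<Prod>k<n. 1 + \<beta> k) \<ge> 0" using assms(2) by (intro prod_nonneg) (auto intro: add_nonneg_nonneg)
  have S: "\<rho> n + (\<Sum>k<n. \<rho> k) \<ge> 0" using assms(3) by (intro add_nonneg_nonneg sum_nonneg)
  have "u 0 \<le> (\<Prod>k<n. 1 + \<beta> k) * (u n + (\<Sum>k<n. \<rho> k))" using Suc by simp
  also have "\<dots> \<le> (\<Prod>k<n. 1 + \<beta> k) * ((1 + \<beta> n) * u (Suc n) + \<rho> n + (\<Sum>k<n. \<rho> k))"
    using Suc.prems [of n] P by (intro mult_left_mono) auto
  also have "\<dots> \<le> (\<Prod>k<n. 1 + \<beta> k) * ((1 + \<beta> n) * (u (Suc n) + (\<rho> n + (\<Sum>k<n. \<rho> k))))"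
    using mult_right_mono [of 1 "1 + \<beta> n", OF _ S] assms(2) [of n] P
    by (intro mult_left_mono) (auto simp: distrib_left)
  finally show ?case by (simp add: mult.assoc add.commute add.left_commute)
qed simp

text \<open>Bernoulli's inequality replaces each factor by a b-th power of the ratio of consecutive
  points, and these ratios telescope. The growth is polynomial with exponent b, independently of
  h.\<close>

lemma prod_step_ratio_le:
  fixes h \<xi> :: real
  assumes "h > 0" "\<xi> > 0"
  shows "(\<Prod>k<n. 1 + real b * (h / (\<xi> + real k * h))) \<le> ((\<xi> + real n * h) / \<xi>) ^ b"
proof (induction n)
  case (Suc n)
  have pos: "\<xi> + real k * h > 0" for k using assms by (intro add_pos_nonneg) auto
  define t where "t = h / (\<xi> + real n * h)"
  have t: "t \<ge> 0" using assms pos [of n] by (simp add: t_def)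
  have "(\<Prod>k<Suc n. 1 + real b * (h / (\<xi> + real k * h))) \<le> ((\<xi> + real n * h) / \<xi>) ^ b * (1 + t) ^ b"
    using Suc Bernoulli_inequality [of t b] t pos assms
    by (simp only: prod.lessThan_Suc t_def [symmetric])
      (intro mult_mono prod_nonneg, auto intro!: add_nonneg_nonneg mult_nonneg_nonneg divide_nonneg_nonneg simp: less_imp_le)
  also have "\<dots> = (((\<xi> + real n * h) / \<xi>) * (1 + t)) ^ b" by (simp only: power_mult_distrib)
  also have "((\<xi> + real n * h) / \<xi>) * (1 + t) = (\<xi> + real (Suc n) * h) / \<xi>"
    using pos [of n] assms(2) by (simp add: t_def divide_simps) (simp add: algebra_simps)
  finally show ?case .
qed (use assms in simp)

text \<open>For p > b the function \<xi>^-p decreases fast enough to dominate one step of the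
  recursion, even with the margin h / (2 \<xi>^(p+1)), which is to absorb the residual. Put t =
  h/\<xi>: the estimate reduces to 1/(1 + t) \<le> 1 - t/2 for t \<le> 1.\<close>

lemma supersolution_step:
  fixes h \<xi> :: real
  assumes "h > 0" "\<xi> \<ge> h" "p \<ge> b + 1"
  shows "(1 + real b * (h / \<xi>)) * (1 / (\<xi> + h) ^ p) \<le> 1 / \<xi> ^ p - h / (2 * \<xi> ^ (p + 1))"
proof -
  define t where "t = h / \<xi>"
  have \<xi>: "\<xi> > 0" using assms by simp
  have t: "0 \<le> t" "t \<le> 1" using assms \<xi> by (auto simp: t_def)
  have "(1 + t) ^ (b + 1) \<le> (1 + t) ^ p" using t assms(3) by (intro power_increasing) auto
  moreover have "1 + real b * t \<le> (1 + t) ^ b" using Bernoulli_inequality [of t b] t by simp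
  then have "(1 + real b * t) * (1 + t) \<le> (1 + t) ^ (b + 1)" using t by (simp add: mult_right_mono mult.commute)
  ultimately have "(1 + real b * t) * (1 + t) \<le> (1 + t) ^ p" by simp
  then have "(1 + real b * t) / (1 + t) ^ p \<le> 1 / (1 + t)"
    using t by (simp add: divide_simps)
  also have "\<dots> \<le> 1 - t / 2"
  proof -
    have "1 \<le> (1 - t / 2) * (1 + t)" using t mult_left_mono [of t 1 t] by (simp add: algebra_simps)
    then show ?thesis using t by (simp add: pos_divide_le_eq)
  qed
  finally have "(1 + real b * t) / (1 + t) ^ p \<le> 1 - t / 2" .
  then have "(1 + real b * t) / (1 + t) ^ p / \<xi> ^ p \<le> (1 - t / 2) / \<xi> ^ p"
    using \<xi> by (intro divide_right_mono) auto
  moreover have "(\<xi> + h) ^ p = (1 + t) ^ p * \<xi> ^ p"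
    using \<xi> by (simp add: t_def power_mult_distrib [symmetric] distrib_right)
  moreover have "(1 - t / 2) / \<xi> ^ p = 1 / \<xi> ^ p - h / (2 * \<xi> ^ (p + 1))"
    by (simp add: t_def diff_divide_distrib)
  ultimately show ?thesis by (simp add: t_def)
qed

text \<open>Subtracting the supersolution 2 K / \<xi>^p removes the residual. The homogeneous
  recursion amplifies the value at the n-th point by at most its b-th power, up to a constant,
  whereas that value decays with exponent p \<ge> b + 1. So the contribution of infinity tends to 0,
  whatever \<open>C\<close> and \<open>k0\<close> are, and a bound in terms of \<open>K\<close>
  remains.\<close>

lemma discrete_gronwall_at_infinity:
  fixes u :: "nat \<Rightarrow> real"
  assumes h: "h > 0" "\<xi> \<ge> h" and p: "p \<ge> b + 1" and K: "K \<ge> 0"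
    and step: "\<And>k. u k \<le> (1 + real b * (h / (\<xi> + real k * h))) * u (Suc k) + h * K / (\<xi> + real k * h) ^ (p + 1)"
    and C: "\<And>k. k \<ge> k0 \<Longrightarrow> u k \<le> C / (\<xi> + real k * h) ^ p"
  shows "u 0 \<le> 2 * K / \<xi> ^ p"
proof -
  have \<xi>: "\<xi> > 0" using h by simp
  define \<xi>k where "\<xi>k k = \<xi> + real k * h" for k
  have pos: "\<xi>k k > 0" "\<xi>k k \<ge> h" "\<xi>k (Suc k) = \<xi>k k + h" for k
    using \<xi> h by (auto simp: \<xi>k_def algebra_simps intro: add_pos_nonneg add_increasing2)
  define v where "v k = u k - 2 * K / \<xi>k k ^ p" for k
  have v: "v k \<le> (1 + real b * (h / \<xi>k k)) * v (Suc k) + 0" for k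
  proof -
    have "2 * K * ((1 + real b * (h / \<xi>k k)) * (1 / (\<xi>k k + h) ^ p)) \<le>
        2 * K * (1 / \<xi>k k ^ p - h / (2 * \<xi>k k ^ (p + 1)))"
      using K supersolution_step [OF h(1) pos(2) p] by (intro mult_left_mono) auto
    then have "(1 + real b * (h / \<xi>k k)) * (2 * K / \<xi>k (Suc k) ^ p) + h * K / \<xi>k k ^ (p + 1) \<le> 2 * K / \<xi>k k ^ p"
      by (simp add: pos(3) right_diff_distrib mult_ac)
    then show ?thesis using step [of k] by (simp add: v_def \<xi>k_def [symmetric] right_diff_distrib)
  qed
  define C' where "C' = \<bar>C\<bar>"
  have "v 0 \<le> C' / \<xi> ^ b * (1 / \<xi>k n)" if n: "n \<ge> k0" "\<xi>k n \<ge> 1" for n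
  proof -
    have P0: "(\<Prod>k<n. 1 + real b * (h / \<xi>k k)) \<ge> 0"
      using pos h by (intro prod_nonneg) (auto intro!: add_nonneg_nonneg mult_nonneg_nonneg divide_nonneg_nonneg simp: less_imp_le)
    have "v 0 \<le> (\<Prod>k<n. 1 + real b * (h / \<xi>k k)) * (v n + (\<Sum>k<n. 0))"
      using v pos h by (intro discrete_gronwall) (auto intro!: mult_nonneg_nonneg divide_nonneg_nonneg simp: less_imp_le)
    also have "\<dots> \<le> (\<Prod>k<n. 1 + real b * (h / \<xi>k k)) * (C' / \<xi>k n ^ p)"
    proof (intro mult_left_mono P0)
      have "v n \<le> u n" using K pos(1) [of n] by (simp add: v_def)
      also have "\<dots> \<le> C / \<xi>k n ^ p" using C [OF n(1)] by (simp add: \<xi>k_def)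
      also have "\<dots> \<le> C' / \<xi>k n ^ p" using pos(1) [of n] by (intro divide_right_mono) (auto simp: C'_def)
      finally show "v n + (\<Sum>k<n. 0) \<le> C' / \<xi>k n ^ p" by simp
    qed
    also have "\<dots> \<le> (\<xi>k n / \<xi>) ^ b * (C' / \<xi>k n ^ p)"
      using prod_step_ratio_le [OF h(1) \<xi>, of b n] pos(1) [of n]
      by (intro mult_right_mono) (auto simp: \<xi>k_def [symmetric] C'_def intro!: divide_nonneg_nonneg)
    also have "\<dots> = C' / \<xi> ^ b * (\<xi>k n ^ b / \<xi>k n ^ p)" by (simp add: power_divide)
    also have "\<dots> \<le> C' / \<xi> ^ b * (1 / \<xi>k n)"
    proof (intro mult_left_mono)
      have "\<xi>k n ^ b * \<xi>k n \<le> \<xi>k n ^ p"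
        using power_increasing [OF p n(2)] by (simp add: mult.commute)
      then show "\<xi>k n ^ b / \<xi>k n ^ p \<le> 1 / \<xi>k n" using pos(1) [of n] by (simp add: divide_simps)
    qed (use \<xi> in \<open>auto simp: C'_def\<close>)
    finally show ?thesis .
  qed
  moreover have fl: "filterlim \<xi>k at_top sequentially"
    unfolding \<xi>k_def using h
    by (intro filterlim_tendsto_add_at_top [OF tendsto_const] filterlim_at_top_mult_tendsto_pos [OF tendsto_const] filterlim_real_sequentially) auto
  then have "\<forall>\<^sub>F n in sequentially. \<xi>k n \<ge> 1" by (auto simp: filterlim_at_top)
  moreover have "(\<lambda>n. C' / \<xi> ^ b * (1 / \<xi>k n)) \<longlonglongrightarrow> C' / \<xi> ^ b * 0"
    by (intro tendsto_mult_left tendsto_divide_0 [OF tendsto_const] filterlim_at_top_imp_at_infinity fl)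
  ultimately have "v 0 \<le> C' / \<xi> ^ b * 0"
    by (intro tendsto_lowerbound [of _ "C' / \<xi> ^ b * 0" sequentially])
      (auto elim: eventually_mono [OF eventually_conj [OF eventually_ge_at_top [of k0]]])
  then show ?thesis by (simp add: v_def \<xi>k_def)
qed

subsection \<open>Uniform asymptotics of the solutions\<close>

text \<open>Both sides are expanded for the fixed h; uniqueness gives an identity of series, from
  which the common factor h is cancelled.\<close>

lemma fps_rec_of_equation:
  fixes F A :: "complex \<Rightarrow> ('n::finite) malg"
  assumes h: "0 < h" "h \<le> 1"
    and F: "uexp {h} (\<lambda>_. F) (\<lambda>_. \<phi>)" and A: "uexp {h} (\<lambda>_. A) (\<lambda>_. \<alpha>)"
    and eq: "\<And>x. Re x \<ge> R \<Longrightarrow> F (x + of_real h) - F x =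
      sc (of_real h) * (sc (1 / x) * (A (x + of_real h) * F (x + of_real h) - F x * fps_nth \<alpha> 0))"
  shows "fps_rec h \<alpha> \<phi>"
proof -
  have H: "{h} \<subseteq> {0..1}" using h by simp
  have shift: "uexp {h} (\<lambda>_ x. f (x + of_real h)) (\<lambda>_. fps_compose c (recip_fps h))"
    if "uexp {h} (\<lambda>_. f) (\<lambda>_. c)" for f :: "complex \<Rightarrow> 'n malg" and c
    using uexp_shift [OF that H] by (rule uexp_cong) auto
  have "uexp {h} (\<lambda>_ x. F (x + of_real h) - F x) (\<lambda>_. fps_compose \<phi> (recip_fps h) - \<phi>)"
    by (intro uexp_diff shift F)
  then have 1: "uexp {h} (\<lambda>_ x. sc (of_real h) * (sc (1 / x) * (A (x + of_real h) * F (x + of_real h) - F x * fps_nth \<alpha> 0)))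
      (\<lambda>_. fps_compose \<phi> (recip_fps h) - \<phi>)"
    by (rule uexp_cong) (use eq in auto)
  have 2: "uexp {h} (\<lambda>_ x. sc (of_real h) * (sc (1 / x) * (A (x + of_real h) * F (x + of_real h) - F x * fps_nth \<alpha> 0)))
      (\<lambda>_. fps_const (of_real h) * (fps_X * (fps_compose \<alpha> (recip_fps h) * fps_compose \<phi> (recip_fps h) - \<phi> * fps_const (fps_nth \<alpha> 0))))"
    unfolding sc_of_real
    by (intro uexp_mult uexp_diff shift F A uexp_inverse uexp_const [OF order_refl])
  have "fps_compose \<phi> (recip_fps h) - \<phi> =
      fps_const (of_real h) * (fps_X * (fps_compose \<alpha> (recip_fps h) * fps_compose \<phi> (recip_fps h) - \<phi> * fps_const (fps_nth \<alpha> 0)))"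
    using uexp_unique [OF 1 2, of h] by simp
  moreover have "fps_compose \<phi> (recip_fps h) - \<phi> = fps_const (of_real h) * Qdiff \<phi> h"
    by (subst fps_compose_recip_fps) simp
  ultimately have *: "fps_const (of_real h) * Qdiff \<phi> h =
      fps_const (of_real h) * (fps_X * (fps_compose \<alpha> (recip_fps h) * fps_compose \<phi> (recip_fps h) - \<phi> * fps_const (fps_nth \<alpha> 0)))"
    by simp
  have cancel: "f = g" if "fps_const (of_real h) * f = fps_const (of_real h) * g" for f g :: "'n malg fps"
  proof (rule fps_ext)
    fix n
    have "fps_nth (fps_const (of_real h) * f) n = fps_nth (fps_const (of_real h) * g) n" by (simp only: that)
    then show "fps_nth f n = fps_nth g n" using h by (simp add: of_real_def)
  qed
  show ?thesis unfolding fps_rec_def by (rule cancel [OF *])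
qed

text \<open>The residual \<open>r\<close>, already divided by h through \<open>qf\<close>, has a
  uniform expansion. Its coefficients up to order m + 1 vanish because they agree with those of the
  exact recursion, so it is O(x^-(m+2)).\<close>

lemma truncation_residual:
  fixes A :: "real \<Rightarrow> complex \<Rightarrow> ('n::finite) malg"
  assumes H: "H \<subseteq> {0<..1}" and A: "uexp H A \<alpha>"
    and bdd: "\<And>s. s \<le> m \<Longrightarrow> \<exists>B. \<forall>h\<in>H. norm (fps_nth (\<phi> h) s) \<le> B"
    and rec: "\<And>h. h \<in> H \<Longrightarrow> fps_rec h (\<alpha> h) (\<phi> h)"
  defines "P \<equiv> \<lambda>h x. \<Sum>s\<le>m. fps_nth (\<phi> h) s * sc (1 / x) ^ s"
  obtains K R where "K \<ge> 0" "R \<ge> 1" "\<And>h x. h \<in> H \<Longrightarrow> Re x \<ge> R \<Longrightarrow>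
    \<exists>r. norm r \<le> K / Re x ^ (m + 2) \<and> P h (x + of_real h) - P h x =
      sc (of_real h) * (sc (1 / x) * (A h (x + of_real h) * P h (x + of_real h) - P h x * fps_nth (\<alpha> h) 0)) + sc (of_real h) * r"
proof -
  have H01: "H \<subseteq> {0..1}" using H by auto
  have const: "uexp H (\<lambda>h x. fps_nth (\<phi> h) s) (\<lambda>h. fps_const (fps_nth (\<phi> h) s))" if "s \<le> m" for s
    using bdd [OF that] by (auto intro: uexp_const)
  define Pc where "Pc h = (\<Sum>s\<le>m. fps_const (fps_nth (\<phi> h) s) * fps_X ^ s)" for h
  define Qc where "Qc h = (\<Sum>s\<le>m. fps_const (fps_nth (\<phi> h) s) * qc s h)" for h
  define r where "r h x = (\<Sum>s\<le>m. fps_nth (\<phi> h) s * qf s h x) -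
    sc (1 / x) * (A h (x + of_real h) * P h (x + of_real h) - P h x * fps_nth (\<alpha> h) 0)" for h x
  have uP: "uexp H P Pc"
    unfolding P_def Pc_def by (intro uexp_sum uexp_mult const uexp_power uexp_inverse) auto
  obtain B where B: "\<And>h. h \<in> H \<Longrightarrow> norm (fps_nth (\<alpha> h) 0) \<le> B"
    using uexp_coeff_bounded [OF A, of 0] by (metis order_refl)
  have ur: "uexp H r (\<lambda>h. Qc h - fps_X * (fps_compose (\<alpha> h) (recip_fps h) * fps_compose (Pc h) (recip_fps h) - Pc h * fps_const (fps_nth (\<alpha> h) 0)))"
    unfolding r_def Qc_def
    by (intro uexp_diff uexp_sum uexp_mult const uexp_qf uexp_inverse uexp_shift A uP H01 uexp_const [OF B]) auto
  have Pc: "fps_nth (Pc h) s = fps_nth (\<phi> h) s" if "s \<le> m" for h s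
  proof -
    have "fps_nth (Pc h) s = (\<Sum>j\<le>m. fps_nth (\<phi> h) j * (if s = j then 1 else 0))"
      by (simp add: Pc_def fps_sum_nth fps_X_power_iff)
    also have "\<dots> = fps_nth (\<phi> h) s"
      using that by (subst sum.mono_neutral_right [of _ "{s}"]) auto
    finally show ?thesis .
  qed
  have Qc: "fps_nth (Qc h) n = fps_nth (Qdiff (\<phi> h) h) n" if "n \<le> m + 1" for h n
  proof -
    have "fps_nth (Qc h) n = (\<Sum>j\<le>m. fps_nth (\<phi> h) j * fps_nth (qc j h) n)"
      by (simp add: Qc_def fps_sum_nth)
    also have "\<dots> = (\<Sum>j\<in>{..m}\<union>{..n}. fps_nth (\<phi> h) j * fps_nth (qc j h) n)"
      using that by (intro sum.mono_neutral_left) (auto simp: qc_nth_eq_0)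
    also have "\<dots> = (\<Sum>j\<le>n. fps_nth (\<phi> h) j * fps_nth (qc j h) n)"
      by (intro sum.mono_neutral_right) (auto simp: qc_nth_eq_0)
    finally show ?thesis by (simp add: Qdiff_def)
  qed
  \<comment> \<open>The order m + 1 is reached, one more than the truncation: the factor X shifts
    the right-hand side, and \<open>qc j h\<close> starts after degree j.\<close>
  have zero: "fps_nth (Qc h - fps_X * (fps_compose (\<alpha> h) (recip_fps h) * fps_compose (Pc h) (recip_fps h) - Pc h * fps_const (fps_nth (\<alpha> h) 0))) n = 0"
    if "h \<in> H" "n \<le> m + 1" for h n
  proof -
    have c: "fps_nth (fps_compose (Pc h) (recip_fps h)) k = fps_nth (fps_compose (\<phi> h) (recip_fps h)) k" if "k \<le> m" for k
      unfolding fps_compose_nth using that Pc by (intro sum.cong) auto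
    have "fps_nth (fps_X * (fps_compose (\<alpha> h) (recip_fps h) * fps_compose (Pc h) (recip_fps h) - Pc h * fps_const (fps_nth (\<alpha> h) 0))) n =
        fps_nth (fps_X * (fps_compose (\<alpha> h) (recip_fps h) * fps_compose (\<phi> h) (recip_fps h) - \<phi> h * fps_const (fps_nth (\<alpha> h) 0))) n"
    proof (cases n)
      case (Suc k)
      then have "k \<le> m" using that by simp
      then have "fps_nth (fps_compose (\<alpha> h) (recip_fps h) * fps_compose (Pc h) (recip_fps h)) k =
          fps_nth (fps_compose (\<alpha> h) (recip_fps h) * fps_compose (\<phi> h) (recip_fps h)) k"
        unfolding fps_mult_nth by (intro sum.cong refl arg_cong2 [of _ _ _ _ "(*)"] c) auto
      then show ?thesis using Suc Pc [OF \<open>k \<le> m\<close>] by simp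
    qed simp
    also have "\<dots> = fps_nth (Qdiff (\<phi> h) h) n" using rec [OF that(1)] unfolding fps_rec_def by simp
    finally show ?thesis using Qc [OF that(2)] by simp
  qed
  obtain K R where KR: "K \<ge> 0" "R \<ge> 1" "\<And>h x. h \<in> H \<Longrightarrow> Re x \<ge> R \<Longrightarrow>
    norm (r h x - (\<Sum>s\<le>m+1. fps_nth (Qc h - fps_X * (fps_compose (\<alpha> h) (recip_fps h) * fps_compose (Pc h) (recip_fps h) - Pc h * fps_const (fps_nth (\<alpha> h) 0))) s * sc (1 / x) ^ s)) \<le> K / Re x ^ (m + 1 + 1)"
    by (rule uexpD [OF ur, of "m + 1"]) blast
  show ?thesis
  proof (rule that [OF KR(1,2)])
    fix h x assume hx: "h \<in> H" "Re x \<ge> R"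
    have nz: "x \<noteq> 0" "x + of_real h \<noteq> 0"
      using hx KR(2) H by (auto simp: complex_eq_iff)
    have "norm (r h x) \<le> K / Re x ^ (m + 2)"
    proof -
      have "(\<Sum>s\<le>m+1. fps_nth (Qc h - fps_X * (fps_compose (\<alpha> h) (recip_fps h) * fps_compose (Pc h) (recip_fps h) - Pc h * fps_const (fps_nth (\<alpha> h) 0))) s * sc (1 / x) ^ s) = 0"
        by (rule sum.neutral) (use zero [OF hx(1)] in auto)
      then show ?thesis using KR(3) [OF hx] by (simp only:) (simp add: numeral_2_eq_2)
    qed
    moreover have "P h (x + of_real h) - P h x = sc (of_real h) * (\<Sum>s\<le>m. fps_nth (\<phi> h) s * qf s h x)"
    proof -
      have "fps_nth (\<phi> h) s * (sc (of_real h) * qf s h x) = sc (of_real h) * (fps_nth (\<phi> h) s * qf s h x)" for s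
        by (metis mult.assoc sc_commute)
      then show ?thesis
        unfolding P_def qf_eq [OF nz] by (simp add: distrib_left sum.distrib sum_distrib_left)
    qed
    ultimately show "\<exists>r. norm r \<le> K / Re x ^ (m + 2) \<and> P h (x + of_real h) - P h x =
      sc (of_real h) * (sc (1 / x) * (A h (x + of_real h) * P h (x + of_real h) - P h x * fps_nth (\<alpha> h) 0)) + sc (of_real h) * r"
      by (intro exI [of _ "r h x"]) (simp add: r_def distrib_left [symmetric])
  qed
qed

text \<open>The step is implicit, since D also occurs in the product with \<open>B\<close>. For t =
  h a / \<xi> at most 1/2 it can be solved at the cost of (1 + t) / (1 - t) \<le> 1 + 4 t; this is
  the origin of the constant 4 a and of the 2 in front of the residual.\<close>

lemma difference_step_bound:
  fixes D D' A B r :: "('n::finite) malg"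
  assumes eq: "D' - D = sc (of_real h) * (z * (A * D' - D * B)) - sc (of_real h) * r"
    and h: "h > 0" and z: "norm z \<le> 1 / \<xi>" "\<xi> > 0" and a: "norm A \<le> a" "norm B \<le> a" "2 * h * a \<le> \<xi>"
  shows "norm D \<le> (1 + 4 * a * (h / \<xi>)) * norm D' + 2 * h * norm r"
proof -
  define t where "t = h * a / \<xi>"
  have a0: "a \<ge> 0" using a(1) norm_ge_zero order.trans by blast
  have t: "0 \<le> t" "t \<le> 1 / 2" using a z h a0 by (auto simp: t_def divide_simps)
  have hz: "norm (sc (of_real h) * (z * X)) \<le> h / \<xi> * norm X" for X :: "'n malg"
  proof -
    have "norm (sc (of_real h) * (z * X)) \<le> h * (1 / \<xi> * norm X)"
    proof -
      have "norm (z * X) \<le> 1 / \<xi> * norm X"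
        using z(1) by (intro order.trans [OF norm_mult_ineq] mult_right_mono) auto
      then have "h * norm (z * X) \<le> h * (1 / \<xi> * norm X)" using h by (intro mult_left_mono) auto
      then show ?thesis using h by simp
    qed
    then show ?thesis by simp
  qed
  have AD: "norm (sc (of_real h) * (z * (A * D'))) \<le> t * norm D'"
  proof -
    have "h / \<xi> * norm (A * D') \<le> h / \<xi> * (a * norm D')"
      using h z a by (intro mult_left_mono order.trans [OF norm_mult_ineq] mult_right_mono) auto
    then show ?thesis using hz [of "A * D'"] by (simp add: t_def)
  qed
  have DB: "norm (sc (of_real h) * (z * (D * B))) \<le> t * norm D"
  proof -
    have "h / \<xi> * norm (D * B) \<le> h / \<xi> * (norm D * a)"
      using h z a by (intro mult_left_mono order.trans [OF norm_mult_ineq] mult_left_mono) auto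
    then show ?thesis using hz [of "D * B"] by (simp add: t_def mult_ac)
  qed
  have "D = D' - sc (of_real h) * (z * (A * D')) + sc (of_real h) * (z * (D * B)) + sc (of_real h) * r"
    using eq by (simp add: algebra_simps)
  then have "norm D \<le> norm D' + t * norm D' + t * norm D + h * norm r"
    using h by (metis (no_types, lifting) AD DB add_mono norm_sc_mult norm_of_real abs_of_pos norm_triangle_le norm_triangle_le_diff order_refl)
  then have "(1 - t) * norm D \<le> (1 + t) * norm D' + h * norm r" by (simp add: algebra_simps)
  also have "\<dots> \<le> (1 - t) * ((1 + 4 * t) * norm D' + 2 * h * norm r)"
  proof -
    have "1 + t \<le> (1 - t) * (1 + 4 * t)" using t mult_left_mono [of t "1/2" t] by (simp add: algebra_simps)
    then have "(1 + t) * norm D' \<le> (1 - t) * (1 + 4 * t) * norm D'" by (intro mult_right_mono) auto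
    moreover have "1 * (h * norm r) \<le> ((1 - t) * 2) * (h * norm r)" using t h by (intro mult_right_mono) auto
    ultimately show ?thesis by (simp add: distrib_left mult_ac)
  qed
  finally have "norm D \<le> (1 + 4 * t) * norm D' + 2 * h * norm r" using t by (simp add: mult_le_cancel_left)
  then show ?thesis by (simp add: t_def mult_ac)
qed

text \<open>The exponent \<open>b\<close> comes from 4 a, with a bounding the coefficients of the
  equation, and is chosen before m and before the subfamily \<open>H'\<close>. This order matters:
  bounds on the coefficients of F up to m will be available only for h below a threshold that
  depends on m.\<close>

lemma truncation_error:
  fixes A F :: "real \<Rightarrow> complex \<Rightarrow> ('n::finite) malg"
  assumes H: "H \<subseteq> {0<..1}" and A: "uexp H A \<alpha>"
    and F: "\<And>h. h \<in> H \<Longrightarrow> uexp {h} (\<lambda>_. F h) (\<lambda>_. \<phi> h)"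
    and rec: "\<And>h. h \<in> H \<Longrightarrow> fps_rec h (\<alpha> h) (\<phi> h)"
    and eq: "\<And>h x. h \<in> H \<Longrightarrow> Re x \<ge> R0 \<Longrightarrow> F h (x + of_real h) - F h x =
      sc (of_real h) * (sc (1 / x) * (A h (x + of_real h) * F h (x + of_real h) - F h x * fps_nth (\<alpha> h) 0))"
  shows "\<exists>b. \<forall>m\<ge>b. \<forall>H'\<subseteq>H. (\<forall>s\<le>m. \<exists>B. \<forall>h\<in>H'. norm (fps_nth (\<phi> h) s) \<le> B) \<longrightarrow>
    (\<exists>K R. \<forall>h\<in>H'. \<forall>x. Re x \<ge> R \<longrightarrow>
    norm (F h x - trunc m (\<phi> h) x) \<le> K / Re x ^ (m + 1))"
proof -
  obtain B where B: "\<And>h. h \<in> H \<Longrightarrow> norm (fps_nth (\<alpha> h) 0) \<le> B"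
    using uexp_coeff_bounded [OF A, of 0] by (metis order_refl)
  obtain G RA where G: "G \<ge> 0" "RA \<ge> 1" "\<And>h x. h \<in> H \<Longrightarrow> Re x \<ge> RA \<Longrightarrow> norm (A h x) \<le> G"
    by (rule uexp_bounded [OF A]) blast
  define a where "a = max G \<bar>B\<bar>"
  have a: "a \<ge> 0" "a \<ge> G" "a \<ge> B" by (auto simp: a_def)
  define b where "b = nat \<lceil>4 * a\<rceil>"
  have b: "4 * a \<le> real b" by (simp add: b_def real_nat_ceiling_ge)
  have "\<exists>K R. \<forall>h\<in>H'. \<forall>x. Re x \<ge> R \<longrightarrow>
    norm (F h x - trunc m (\<phi> h) x) \<le> K / Re x ^ (m + 1)"
    if m: "m \<ge> b" and H': "H' \<subseteq> H" and bdd: "\<forall>s\<le>m. \<exists>B. \<forall>h\<in>H'. norm (fps_nth (\<phi> h) s) \<le> B" for m H'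
  proof -
    define P where "P = (\<lambda>h x. \<Sum>s\<le>m. fps_nth (\<phi> h) s * sc (1 / x) ^ s)"
    obtain K R where K: "K \<ge> 0" "R \<ge> 1" "\<And>h x. h \<in> H' \<Longrightarrow> Re x \<ge> R \<Longrightarrow>
      \<exists>r. norm r \<le> K / Re x ^ (m + 2) \<and> P h (x + of_real h) - P h x =
        sc (of_real h) * (sc (1 / x) * (A h (x + of_real h) * P h (x + of_real h) - P h x * fps_nth (\<alpha> h) 0)) + sc (of_real h) * r"
      unfolding P_def
      by (rule truncation_residual [of H' A \<alpha> m \<phi>]) (use H H' bdd rec uexp_subset [OF A H'] in blast)+
    \<comment> \<open>One factor 2 stems from solving the implicit step, the other from the
      supersolution. The entry 2 a of the maximum makes h a / Re x at most 1/2.\<close>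
    show ?thesis
    proof (rule exI [of _ "2 * (2 * K)"], rule exI [of _ "Max {R, RA, R0, 2 * a, 1}"], intro ballI allI impI)
      fix h x assume h': "h \<in> H'" and x: "Max {R, RA, R0, 2 * a, 1} \<le> Re x"
      have h: "h \<in> H" using h' H' by blast
      have h0: "0 < h" "h \<le> 1" using h H by auto
      have x': "Re x \<ge> R" "Re x \<ge> RA" "Re x \<ge> R0" "Re x \<ge> 2 * a" "Re x \<ge> 1" using x by auto
      define D where "D y = F h y - P h y" for y
      define y where "y k = x + of_real (real k * h)" for k
      have y: "Re (y k) = Re x + real k * h" "y (Suc k) = y k + of_real h" for k
        by (simp_all add: y_def algebra_simps)
      have step: "norm (D (y k)) \<le> (1 + real b * (h / (Re x + real k * h))) * norm (D (y (Suc k))) +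
          h * (2 * K) / (Re x + real k * h) ^ (m + 1 + 1)" for k
      proof -
        define \<xi> where "\<xi> = Re x + real k * h"
        have \<xi>: "\<xi> \<ge> Re x" using h0 by (simp add: \<xi>_def)
        have R: "Re (y k) = \<xi>" by (simp add: y \<xi>_def)
        obtain r where r: "norm r \<le> K / \<xi> ^ (m + 2)" "P h (y k + of_real h) - P h (y k) =
            sc (of_real h) * (sc (1 / y k) * (A h (y k + of_real h) * P h (y k + of_real h) - P h (y k) * fps_nth (\<alpha> h) 0)) + sc (of_real h) * r"
          using K(3) [OF h', of "y k"] \<xi> x' unfolding R by auto
        have F': "F h (y k + of_real h) - F h (y k) =
            sc (of_real h) * (sc (1 / y k) * (A h (y k + of_real h) * F h (y k + of_real h) - F h (y k) * fps_nth (\<alpha> h) 0))"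
          using eq [OF h, of "y k"] \<xi> x' R by simp
        have "D (y (Suc k)) - D (y k) =
            sc (of_real h) * (sc (1 / y k) * (A h (y k + of_real h) * D (y (Suc k)) - D (y k) * fps_nth (\<alpha> h) 0)) - sc (of_real h) * r"
        proof -
          have "D (y (Suc k)) - D (y k) = (F h (y k + of_real h) - F h (y k)) - (P h (y k + of_real h) - P h (y k))"
            by (simp add: D_def y(2))
          then show ?thesis unfolding F' r(2) by (simp add: D_def y(2) algebra_simps)
        qed
        then have "norm (D (y k)) \<le> (1 + 4 * a * (h / \<xi>)) * norm (D (y (Suc k))) + 2 * h * norm r"
        proof (rule difference_step_bound)
          show "norm (sc (1 / y k) :: 'n malg) \<le> 1 / \<xi>" using R \<xi> x' by (intro norm_sc_inverse_le) auto
          show "norm (A h (y k + of_real h)) \<le> a" using G(3) [OF h, of "y k + of_real h"] R \<xi> x' h0 a by simp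
          show "norm (fps_nth (\<alpha> h) 0) \<le> a" using B [OF h] a by simp
          have "h * a \<le> 1 * a" using h0 a by (intro mult_right_mono) auto
          then show "2 * h * a \<le> \<xi>" using x' \<xi> by simp
        qed (use h0 \<xi> x' in auto)
        also have "\<dots> \<le> (1 + real b * (h / \<xi>)) * norm (D (y (Suc k))) + 2 * h * (K / \<xi> ^ (m + 2))"
          using b r h0 \<xi> x' by (intro add_mono mult_right_mono mult_left_mono) auto
        finally show ?thesis by (simp add: \<xi>_def mult_ac)
      qed
      \<comment> \<open>Constants for this h alone. They are admissible here because only the decay
        at infinity is required, and they do not reach the final bound.\<close>
      obtain K1 R1 where K1: "K1 \<ge> 0" "R1 \<ge> 1" "\<And>h' z. h' \<in> {h} \<Longrightarrow> Re z \<ge> R1 \<Longrightarrow>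
        norm (F h z - trunc m (\<phi> h) z) \<le> K1 / Re z ^ (m + 1)"
        by (rule uexpD [OF F [OF h], of m]) blast
      obtain k0 where k0: "real k0 * h \<ge> R1" using ex_less_of_nat_mult [OF h0(1), of R1] by (metis less_imp_le)
      have "norm (D (y 0)) \<le> 2 * (2 * K) / Re x ^ (m + 1)"
      proof (rule discrete_gronwall_at_infinity [where u = "\<lambda>k. norm (D (y k))", OF h0(1) _ _ _ step])
        fix k assume "k \<ge> k0"
        then have "real k0 * h \<le> real k * h" using h0 by (intro mult_right_mono) auto
        then have "Re (y k) \<ge> R1" using k0 x' by (simp add: y)
        from K1(3) [OF _ this] show "norm (D (y k)) \<le> K1 / (Re x + real k * h) ^ (m + 1)"
          by (simp add: D_def P_def y(1))
      qed (use h0 x' m K in auto)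
      then show "norm (F h x - trunc m (\<phi> h) x) \<le> 2 * (2 * K) / Re x ^ (m + 1)"
        by (simp add: D_def P_def y_def)
    qed
  qed
  then show ?thesis by blast
qed

subsection \<open>Consistency of the difference scheme\<close>

text \<open>The scheme evaluates the coefficient at x + h. Convergence on a neighbourhood
  \<open>L\<close> and uniform continuity of the limit absorb the displacement.\<close>

lemma uniform_limit_shift:
  fixes Z :: "real \<Rightarrow> complex \<Rightarrow> 'a::real_normed_vector"
  assumes lim: "uniform_limit L Z Z0 (at_right 0)" and uc: "uniformly_continuous_on L Z0"
    and KL: "K \<subseteq> L" and \<delta>: "\<delta> > 0" "\<And>x h. x \<in> K \<Longrightarrow> 0 < h \<Longrightarrow> h < \<delta> \<Longrightarrow> x + of_real h \<in> L"
  shows "uniform_limit K (\<lambda>h x. Z h (x + of_real h)) Z0 (at_right 0)"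
proof (rule uniform_limitI)
  fix e :: real assume e: "e > 0"
  obtain d where d: "d > 0" "\<And>x y. x \<in> L \<Longrightarrow> y \<in> L \<Longrightarrow> dist y x < d \<Longrightarrow> dist (Z0 y) (Z0 x) < e / 2"
    using uc e unfolding uniformly_continuous_on_def by (meson half_gt_zero)
  have "\<forall>\<^sub>F h in at_right (0::real). h < min d \<delta> \<and> 0 < h"
    using d(1) \<delta>(1) by (intro eventually_conj) (auto simp: eventually_at_right_less intro!: eventually_at_rightI [of 0 "min d \<delta>"])
  moreover have "\<forall>\<^sub>F h in at_right 0. \<forall>x\<in>L. dist (Z h x) (Z0 x) < e / 2"
    using uniform_limitD [OF lim, of "e / 2"] e by simp
  ultimately show "\<forall>\<^sub>F h in at_right 0. \<forall>x\<in>K. dist (Z h (x + of_real h)) (Z0 x) < e"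
  proof eventually_elim
    case (elim h)
    show ?case
    proof
      fix x assume x: "x \<in> K"
      have xh: "x + of_real h \<in> L" "x \<in> L" using x elim \<delta>(2) KL by auto
      have "dist (Z h (x + of_real h)) (Z0 (x + of_real h)) < e / 2" using elim xh by blast
      moreover have "dist (Z0 (x + of_real h)) (Z0 x) < e / 2"
        using elim by (intro d(2) xh) (auto simp: dist_norm)
      ultimately show "dist (Z h (x + of_real h)) (Z0 x) < e"
        using dist_triangle [of "Z h (x + of_real h)" "Z0 x" "Z0 (x + of_real h)"] by linarith
    qed
  qed
qed

lemma compact_neighbourhood:
  fixes K :: "complex set"
  assumes "compact K" "open U" "K \<subseteq> U"
  obtains L d where "d > 0" "compact L" "K \<subseteq> L" "L \<subseteq> U" "\<And>x y. x \<in> K \<Longrightarrow> cmod y \<le> d \<Longrightarrow> x + y \<in> L"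
proof -
  obtain e where e: "e > 0" "(\<Union>x\<in>K. ball x e) \<subseteq> U"
    using compact_subset_open_imp_ball_epsilon_subset [OF assms] by auto
  define L where "L = (\<lambda>(x, y). x + y) ` (K \<times> cball 0 (e / 2))"
  have "compact L"
    unfolding L_def by (intro compact_continuous_image compact_Times assms compact_cball)
      (auto simp: case_prod_unfold intro!: continuous_intros)
  moreover have in_L: "x + y \<in> L" if "x \<in> K" "cmod y \<le> e / 2" for x y
    unfolding L_def using that by (intro image_eqI [of _ _ "(x, y)"]) auto
  moreover have "K \<subseteq> L" using in_L [of _ 0] e by auto
  moreover have "L \<subseteq> U"
  proof
    fix z assume "z \<in> L"
    then obtain x y where "z = x + y" "x \<in> K" "cmod y \<le> e / 2" by (auto simp: L_def)
    then have "z \<in> ball x e" using e by (auto simp: dist_norm)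
    then show "z \<in> U" using e \<open>x \<in> K\<close> by blast
  qed
  ultimately show ?thesis using e by (intro that [of "e / 2" L]) auto
qed

text \<open>The mean value inequality for f minus its linear part at x: on the disc of radius h the
  derivative varies by less than \<epsilon>, uniformly for x in K.\<close>

lemma euler_scalar:
  assumes f: "f holomorphic_on U" and U: "open U" and K: "compact K" "K \<subseteq> U" and \<epsilon>: "\<epsilon> > 0"
  shows "\<forall>\<^sub>F h in at_right 0. \<forall>x\<in>K. cmod (f (x + of_real h) - f x - of_real h * deriv f x) \<le> \<epsilon> * h"
proof -
  obtain L d where L: "d > 0" "compact L" "K \<subseteq> L" "L \<subseteq> U" "\<And>x y. x \<in> K \<Longrightarrow> cmod y \<le> d \<Longrightarrow> x + y \<in> L"
    using compact_neighbourhood [OF K(1) U K(2)] by metis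
  have "continuous_on L (deriv f)"
    using holomorphic_deriv [OF f U] L(4) by (meson holomorphic_on_imp_continuous_on continuous_on_subset)
  then have "uniformly_continuous_on L (deriv f)" using L(2) by (rule compact_uniformly_continuous)
  then obtain d' where d': "d' > 0" "\<And>x y. x \<in> L \<Longrightarrow> y \<in> L \<Longrightarrow> dist y x < d' \<Longrightarrow> dist (deriv f y) (deriv f x) < \<epsilon>"
    using \<epsilon> unfolding uniformly_continuous_on_def by meson
  have "\<forall>\<^sub>F h in at_right (0::real). h < min d d' \<and> 0 < h"
    using d'(1) L(1) by (intro eventually_conj) (auto simp: eventually_at_right_less intro!: eventually_at_rightI [of 0 "min d d'"])
  then show ?thesis
  proof eventually_elim
    case (elim h)
    show ?case
    proof
      fix x assume x: "x \<in> K"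
      define g where "g z = f z - z * deriv f x" for z
      have "cmod (g (x + of_real h) - g x) \<le> \<epsilon> * cmod (x + of_real h - x)"
      proof (rule field_differentiable_bound [of "cball x h"])
        fix z assume z: "z \<in> cball x h"
        have zL: "z \<in> L" using L(5) [OF x, of "z - x"] z elim by (auto simp: dist_norm norm_minus_commute)
        have "(f has_field_derivative deriv f z) (at z)"
          by (rule holomorphic_derivI [OF f U]) (use L(4) zL in blast)
        then have "(g has_field_derivative deriv f z - 1 * deriv f x) (at z)"
          unfolding g_def by (intro DERIV_diff DERIV_cmult_right DERIV_ident)
        then show "(g has_field_derivative deriv f z - deriv f x) (at z within cball x h)"
          by (simp add: has_field_derivative_at_within)
        have "dist (deriv f z) (deriv f x) < \<epsilon>"
          using z elim x L(3) by (intro d'(2) zL) (auto simp: dist_commute)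
        then show "cmod (deriv f z - deriv f x) \<le> \<epsilon>" by (simp add: dist_norm)
      qed (use elim in \<open>auto simp: dist_norm\<close>)
      then show "cmod (f (x + of_real h) - f x - of_real h * deriv f x) \<le> \<epsilon> * h"
        using elim by (simp add: g_def algebra_simps)
    qed
  qed
qed

lemma continuous_on_malg_iff: "continuous_on S f \<longleftrightarrow> (\<forall>i j. continuous_on S (\<lambda>x. ent (f x) i j))"
  unfolding continuous_on_def tendsto_malg_iff by blast

lemma euler_malg:
  fixes Y :: "complex \<Rightarrow> ('n::finite) malg"
  assumes Y: "\<And>i j. (\<lambda>z. ent (Y z) i j) holomorphic_on U" and U: "open U" and K: "compact K" "K \<subseteq> U"
    and Y': "\<And>i j x. x \<in> K \<Longrightarrow> deriv (\<lambda>z. ent (Y z) i j) x = ent (Y' x) i j" and \<epsilon>: "\<epsilon> > 0"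
  shows "\<forall>\<^sub>F h in at_right 0. \<forall>x\<in>K. norm (Y (x + of_real h) - Y x - sc (of_real h) * Y' x) \<le> \<epsilon> * h"
proof -
  define N where "N = real CARD('n) * real CARD('n)"
  have N: "N > 0" by (simp add: N_def)
  have "\<forall>\<^sub>F h in at_right 0. \<forall>i j. \<forall>x\<in>K. cmod (ent (Y (x + of_real h)) i j - ent (Y x) i j - of_real h * deriv (\<lambda>z. ent (Y z) i j) x) \<le> \<epsilon> / N * h"
    using \<epsilon> N by (intro eventually_all_finite euler_scalar [OF Y U K]) auto
  then show ?thesis
  proof eventually_elim
    case (elim h)
    show ?case
    proof
      fix x assume x: "x \<in> K"
      have "norm (Y (x + of_real h) - Y x - sc (of_real h) * Y' x) \<le>
          (\<Sum>i\<in>(UNIV::'n set). \<Sum>j\<in>(UNIV::'n set). \<epsilon> / N * h)"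
      proof (intro order.trans [OF norm_le_sum_ent] sum_mono)
        fix i j
        show "cmod (ent (Y (x + of_real h) - Y x - sc (of_real h) * Y' x) i j) \<le> \<epsilon> / N * h"
          using elim [rule_format, OF x, of i j] Y' [OF x, of i j] by simp
      qed
      also have "\<dots> = \<epsilon> * h" using N by (simp add: N_def)
      finally show "norm (Y (x + of_real h) - Y x - sc (of_real h) * Y' x) \<le> \<epsilon> * h" .
    qed
  qed
qed

text \<open>Serves both equations: that of F, where \<open>B h\<close> tends to the leading
  coefficient, and that of E, where it is 0. The three thirds of \<epsilon> stand for the Euler
  error, the convergence of the shifted coefficient, and that of \<open>B\<close>.\<close>

lemma scheme_consistent:
  fixes A :: "real \<Rightarrow> complex \<Rightarrow> ('n::finite) malg"
  assumes U: "open U" "0 \<notin> U" and K: "compact K" "K \<subseteq> U"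
    and Y: "\<And>i j. (\<lambda>z. ent (Y z) i j) holomorphic_on U"
    and ode: "\<And>i j x. x \<in> U \<Longrightarrow> deriv (\<lambda>z. ent (Y z) i j) x = ent (sc (1 / x) * (A0 x * Y x - Y x * B0)) i j"
    and A0: "continuous_on U A0" and A: "\<And>L. compact L \<Longrightarrow> L \<subseteq> U \<Longrightarrow> uniform_limit L A A0 (at_right 0)"
    and B: "(B \<longlongrightarrow> B0) (at_right 0)" and \<epsilon>: "\<epsilon> > 0"
  shows "\<forall>\<^sub>F h in at_right 0. \<forall>x\<in>K. norm (Y (x + of_real h) - Y x -
    sc (of_real h) * (sc (1 / x) * (A h (x + of_real h) * Y (x + of_real h) - Y x * B h))) \<le> \<epsilon> * h"
proof (cases "K = {}")
  case False
  obtain L d where L: "d > 0" "compact L" "K \<subseteq> L" "L \<subseteq> U" "\<And>x y. x \<in> K \<Longrightarrow> cmod y \<le> d \<Longrightarrow> x + y \<in> L"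
    using compact_neighbourhood [OF K(1) U(1) K(2)] by metis
  have Yc: "continuous_on U Y"
    unfolding continuous_on_malg_iff using Y holomorphic_on_imp_continuous_on by blast
  have YL: "continuous_on L Y" "continuous_on L A0" using Yc A0 L(4) continuous_on_subset by blast+
  have bY: "bounded (Y ` L)" "bounded (A0 ` L)"
    using YL L(2) by (auto intro!: compact_imp_bounded compact_continuous_image)
  have "uniform_limit L (\<lambda>h x. A h x * Y x) (\<lambda>x. A0 x * Y x) (at_right 0)"
    by (rule bounded_bilinear.bounded_uniform_limit [OF bounded_bilinear_mult])
      (use A [OF L(2,4)] bY in \<open>auto intro: uniform_limit_const\<close>)
  then have lim: "uniform_limit K (\<lambda>h x. A h (x + of_real h) * Y (x + of_real h)) (\<lambda>x. A0 x * Y x) (at_right 0)"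
    by (rule uniform_limit_shift [where \<delta> = d])
      (use L YL in \<open>auto intro!: compact_uniformly_continuous continuous_intros\<close>)
  obtain y where y: "y > 0" "\<And>x. x \<in> L \<Longrightarrow> norm (Y x) \<le> y"
    using bY(1) unfolding bounded_pos by auto
  have "continuous_on K (\<lambda>x. 1 / x)" using K U by (auto intro!: continuous_intros)
  then have "bounded ((\<lambda>x. 1 / x) ` K)" using K by (auto intro!: compact_imp_bounded compact_continuous_image)
  then obtain z where z: "z > 0" "\<And>x. x \<in> K \<Longrightarrow> cmod (1 / x) \<le> z" unfolding bounded_pos by auto
  have "\<forall>\<^sub>F h in at_right 0. \<forall>x\<in>K. dist (A h (x + of_real h) * Y (x + of_real h)) (A0 x * Y x) < \<epsilon> / (3 * z)"
    using lim \<epsilon> z by (auto simp: uniform_limit_iff)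
  moreover have "\<forall>\<^sub>F h in at_right 0. dist (B h) B0 < \<epsilon> / (3 * z * y)"
    using B \<epsilon> z y by (intro tendstoD) auto
  moreover have "\<forall>\<^sub>F h in at_right 0. \<forall>x\<in>K. norm (Y (x + of_real h) - Y x - sc (of_real h) * (sc (1 / x) * (A0 x * Y x - Y x * B0))) \<le> \<epsilon> / 3 * h"
    using \<epsilon> K ode by (intro euler_malg [OF Y U(1) K]) auto
  moreover have "\<forall>\<^sub>F h in at_right (0::real). h > 0" by (simp add: eventually_at_right_less)
  ultimately show ?thesis
  proof eventually_elim
    case (elim h)
    show ?case
    proof
      fix x assume x: "x \<in> K"
      define W where "W = A h (x + of_real h) * Y (x + of_real h)"
      have "norm (W - A0 x * Y x) \<le> \<epsilon> / (3 * z)" using elim x by (auto simp: W_def dist_norm less_imp_le)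
      moreover have "norm (Y x * (B h - B0)) \<le> \<epsilon> / (3 * z)"
      proof -
        have "norm (Y x * (B h - B0)) \<le> y * (\<epsilon> / (3 * z * y))"
          using elim x L(3) y by (intro order.trans [OF norm_mult_ineq] mult_mono) (auto simp: dist_norm less_imp_le)
        then show ?thesis using y by simp
      qed
      ultimately have "norm ((W - A0 x * Y x) - Y x * (B h - B0)) \<le> \<epsilon> / (3 * z) + \<epsilon> / (3 * z)"
        by (rule order.trans [OF norm_triangle_ineq4 add_mono])
      then have "norm (sc (of_real h) * (sc (1 / x) * ((W - A0 x * Y x) - Y x * (B h - B0)))) \<le> h * (z * (\<epsilon> / (3 * z) + \<epsilon> / (3 * z)))"
        unfolding norm_sc_mult using elim z(2) [OF x] z(1) \<epsilon> by (intro mult_mono) auto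
      also have "\<dots> = 2 * \<epsilon> / 3 * h" using z by (simp add: field_simps)
      finally have 1: "norm (sc (of_real h) * (sc (1 / x) * ((W - A0 x * Y x) - Y x * (B h - B0)))) \<le> 2 * \<epsilon> / 3 * h" .
      have "Y (x + of_real h) - Y x - sc (of_real h) * (sc (1 / x) * (W - Y x * B h)) =
          (Y (x + of_real h) - Y x - sc (of_real h) * (sc (1 / x) * (A0 x * Y x - Y x * B0))) -
          sc (of_real h) * (sc (1 / x) * ((W - A0 x * Y x) - Y x * (B h - B0)))"
        by (simp add: algebra_simps)
      also have "norm \<dots> \<le> \<epsilon> / 3 * h + 2 * \<epsilon> / 3 * h"
        using elim(3) x by (intro order.trans [OF norm_triangle_ineq4 add_mono [OF _ 1]]) blast
      also have "\<dots> = \<epsilon> * h" by (simp add: field_simps)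
      finally show "norm (Y (x + of_real h) - Y x - sc (of_real h) * (sc (1 / x) * (A h (x + of_real h) * Y (x + of_real h) - Y x * B h))) \<le> \<epsilon> * h"
        by (simp add: W_def)
    qed
  qed
qed simp

subsection \<open>Convergence on a right half-plane\<close>

text \<open>With h \<le> 1 the steps overshoot X by at most 1, so they end in a vertical strip of
  fixed width.\<close>

lemma steps_to:
  fixes \<xi> X h :: real
  assumes "h > 0" "h \<le> 1" "\<xi> \<le> X"
  obtains n where "X \<le> \<xi> + real n * h" "\<xi> + real n * h \<le> X + 1" "\<And>k. k < n \<Longrightarrow> \<xi> + real k * h \<le> X"
proof -
  define n where "n = nat \<lceil>(X - \<xi>) / h\<rceil>"
  have "(X - \<xi>) / h \<ge> 0" using assms by simp
  then have n: "(X - \<xi>) / h \<le> real n" "real n < (X - \<xi>) / h + 1"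
    by (auto simp: n_def real_nat_ceiling_ge) linarith
  have 1: "X - \<xi> \<le> real n * h" using n(1) assms by (simp add: pos_divide_le_eq)
  have "real n * h < ((X - \<xi>) / h + 1) * h" using n(2) assms by (intro mult_strict_right_mono) auto
  also have "\<dots> = X - \<xi> + h" using assms by (simp add: distrib_right)
  finally have 2: "real n * h < X - \<xi> + h" .
  show ?thesis
  proof (rule that [of n])
    fix k assume "k < n"
    then have "real (Suc k) * h \<le> real n * h" using assms by (intro mult_right_mono) auto
    then show "\<xi> + real k * h \<le> X" using 2 by (simp add: distrib_right)
  qed (use 1 2 assms in auto)
qed

text \<open>The order of the choices matters: m \<ge> b, then X, then h. The truncation error at X,
  amplified by G = (X + 1)^b, is O(1/X). With X fixed, the distance \<sigma> of the truncations and
  the consistency error \<eta> become small with h, so their amplification is harmless.\<close>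

lemma half_plane_convergence:
  fixes A F :: "real \<Rightarrow> complex \<Rightarrow> ('n::finite) malg"
  assumes R: "R \<ge> 1" and a: "a \<ge> 0"
    and Abd: "\<forall>\<^sub>F h in at_right 0. (\<forall>x. Re x \<ge> R \<longrightarrow> norm (A h x) \<le> a) \<and> norm (B h) \<le> a"
    and eq: "\<forall>\<^sub>F h in at_right 0. \<forall>x. Re x \<ge> R \<longrightarrow> F h (x + of_real h) - F h x =
      sc (of_real h) * (sc (1 / x) * (A h (x + of_real h) * F h (x + of_real h) - F h x * B h))"
    and trunc: "\<exists>b. \<forall>m\<ge>b. \<exists>K R. \<forall>\<^sub>F h in at_right 0. \<forall>x. Re x \<ge> R \<longrightarrow>
      norm (F h x - trunc m (\<phi> h) x) \<le> K / Re x ^ (m + 1)"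
    and \<phi>: "ctend \<phi> \<phi>0" and F0: "uexp {0} (\<lambda>_. F0) (\<lambda>_. \<phi>0)"
    and cons: "\<And>K \<epsilon>. compact K \<Longrightarrow> K \<subseteq> {x. Re x \<ge> R} \<Longrightarrow> \<epsilon> > 0 \<Longrightarrow>
      \<forall>\<^sub>F h in at_right 0. \<forall>x\<in>K. norm (F0 (x + of_real h) - F0 x -
        sc (of_real h) * (sc (1 / x) * (A h (x + of_real h) * F0 (x + of_real h) - F0 x * B h))) \<le> \<epsilon> * h"
    and K: "compact K" "K \<subseteq> {x. Re x \<ge> max R (2 * a)}"
  shows "uniform_limit K F F0 (at_right 0)"
proof (rule uniform_limitI)
  fix e :: real assume e: "e > 0"
  obtain b0 where b0: "\<And>m. m \<ge> b0 \<Longrightarrow> \<exists>K R. \<forall>\<^sub>F h in at_right 0. \<forall>x. Re x \<ge> R \<longrightarrow>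
      norm (F h x - trunc m (\<phi> h) x) \<le> K / Re x ^ (m + 1)"
    using trunc by blast
  define b where "b = nat \<lceil>4 * a\<rceil>"
  have b: "4 * a \<le> real b" by (simp add: b_def real_nat_ceiling_ge)
  define m where "m = max b b0"
  obtain K1 R1 where K1: "\<forall>\<^sub>F h in at_right 0. \<forall>x. Re x \<ge> R1 \<longrightarrow>
      norm (F h x - trunc m (\<phi> h) x) \<le> K1 / Re x ^ (m + 1)"
    using b0 [of m] by (auto simp: m_def)
  obtain K2 R2 where K2: "K2 \<ge> 0" "R2 \<ge> 1" "\<And>h x. h \<in> {0::real} \<Longrightarrow> Re x \<ge> R2 \<Longrightarrow>
      norm (F0 x - trunc m \<phi>0 x) \<le> K2 / Re x ^ (m + 1)"
    by (rule uexpD [OF F0, of m]) blast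
  define C where "C = \<bar>K1\<bar> + K2"
  have C: "C \<ge> 0" using K2 by (simp add: C_def)
  obtain Bd where Bd: "\<And>x. x \<in> K \<Longrightarrow> cmod x \<le> Bd"
    using K(1) compact_imp_bounded bounded_iff by metis
  \<comment> \<open>\<open>R1\<close> and \<open>R2\<close> are where the two truncation estimates
    begin, \<open>Bd\<close> lies to the right of K, and the last entry makes the amplified
    truncation error 2^b C / X at most e/4.\<close>
  define X where "X = Max {1, R, R1, R2, Bd, 2 ^ b * C * 4 / e}"
  have X: "X \<ge> 1" "X \<ge> R" "X \<ge> R1" "X \<ge> R2" "X \<ge> Bd" "X \<ge> 2 ^ b * C * 4 / e"
    by (auto simp: X_def)
  define G where "G = (X + 1) ^ b"
  have G: "G > 0" using X by (simp add: G_def)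
  \<comment> \<open>A compact rectangle that contains all points from which a step is made;
    consistency is invoked only there.\<close>
  define Z where "Z = cbox (Complex R (- Bd)) (Complex X Bd)"
  have Z: "compact Z" "\<And>x. x \<in> Z \<longleftrightarrow> R \<le> Re x \<and> Re x \<le> X \<and> - Bd \<le> Im x \<and> Im x \<le> Bd"
    unfolding Z_def by (auto simp: in_cbox_complex_iff)
  define \<eta> where "\<eta> = e / (8 * G * (X + 1))"
  have \<eta>: "\<eta> > 0" using e G X by (simp add: \<eta>_def)
  define \<sigma> where "\<sigma> h = (\<Sum>s\<le>m. norm (fps_nth (\<phi> h) s - fps_nth \<phi>0 s))" for h
  have "((\<lambda>h. \<sigma> h) \<longlongrightarrow> (\<Sum>s\<le>m. norm (fps_nth \<phi>0 s - fps_nth \<phi>0 s))) (at_right 0)"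
    unfolding \<sigma>_def using \<phi> unfolding ctend_def by (intro tendsto_intros) blast
  then have "\<forall>\<^sub>F h in at_right 0. \<sigma> h < e / (4 * G)"
    using e G by (intro order_tendstoD) auto
  moreover have "\<forall>\<^sub>F h in at_right (0::real). h \<le> 1 \<and> 0 < h"
    by (intro eventually_conj) (auto simp: eventually_at_right_less intro!: eventually_at_rightI [of 0 1])
  moreover have "\<forall>\<^sub>F h in at_right 0. \<forall>x\<in>Z. norm (F0 (x + of_real h) - F0 x -
        sc (of_real h) * (sc (1 / x) * (A h (x + of_real h) * F0 (x + of_real h) - F0 x * B h))) \<le> \<eta> * h"
    by (rule cons) (use Z \<eta> in auto)
  ultimately show "\<forall>\<^sub>F h in at_right 0. \<forall>x\<in>K. dist (F h x) (F0 x) < e"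
    using K1 Abd eq
  proof eventually_elim
    case (elim h)
    then have \<sigma>: "\<sigma> h < e / (4 * G)" and h: "h \<le> 1" "0 < h" by auto
    note cons' = elim(3)[rule_format] and K1 = elim(4)[rule_format] and Abd = elim(5) and eq = elim(6)[rule_format]
    show ?case
    proof
      fix x assume x: "x \<in> K"
      have Rx: "Re x \<ge> R" "Re x \<ge> 2 * a" "Re x \<ge> 1" using x K R by auto
      have "Re x \<le> X" using Bd [OF x] X(5) complex_Re_le_cmod [of x] by linarith
      then obtain n where n: "X \<le> Re x + real n * h" "Re x + real n * h \<le> X + 1" "\<And>k. k < n \<Longrightarrow> Re x + real k * h \<le> X"
        using steps_to [OF h(2,1)] by metis
      define y where "y k = x + of_real (real k * h)" for k
      have y: "Re (y k) = Re x + real k * h" "Im (y k) = Im x" "y (Suc k) = y k + of_real h" for k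
        by (simp_all add: y_def algebra_simps)
      define D where "D z = F h z - F0 z" for z
      have step: "norm (D (y k)) \<le> (1 + real b * (h / (Re x + real k * h))) * norm (D (y (Suc k))) + 2 * h * \<eta>" if "k < n" for k
      proof -
        define \<xi> where "\<xi> = Re x + real k * h"
        have \<xi>: "\<xi> \<ge> Re x" "\<xi> \<le> X" using h n(3) [OF that] by (auto simp: \<xi>_def)
        have Ry: "Re (y k) = \<xi>" by (simp add: y \<xi>_def)
        have "\<bar>Im x\<bar> \<le> Bd" using Bd [OF x] abs_Im_le_cmod order.trans by blast
        then have "y k \<in> Z" unfolding Z(2) using Ry \<xi> Rx by (auto simp: y)
        define r0 where "r0 = F0 (y k + of_real h) - F0 (y k) -
          sc (of_real h) * (sc (1 / y k) * (A h (y k + of_real h) * F0 (y k + of_real h) - F0 (y k) * B h))"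
        have r0: "norm r0 \<le> \<eta> * h" unfolding r0_def by (rule cons' [OF \<open>y k \<in> Z\<close>])
        define r where "r = sc (of_real (1 / h)) * r0"
        have hr: "sc (of_real h) * r = r0" using h by (simp add: r_def mult.assoc [symmetric] sc_mult [symmetric])
        have r: "norm r \<le> \<eta>" using r0 h by (simp add: r_def norm_divide pos_divide_le_eq)
        have "D (y (Suc k)) - D (y k) = (F h (y k + of_real h) - F h (y k)) - (F0 (y k + of_real h) - F0 (y k))"
          by (simp add: D_def y(3))
        also have "F0 (y k + of_real h) - F0 (y k) = r0 +
          sc (of_real h) * (sc (1 / y k) * (A h (y k + of_real h) * F0 (y k + of_real h) - F0 (y k) * B h))"
          by (simp add: r0_def)
        also have "F h (y k + of_real h) - F h (y k) = sc (of_real h) * (sc (1 / y k) * (A h (y k + of_real h) * F h (y k + of_real h) - F h (y k) * B h))"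
          using Ry \<xi> Rx by (intro eq) auto
        finally have "D (y (Suc k)) - D (y k) =
            sc (of_real h) * (sc (1 / y k) * (A h (y k + of_real h) * D (y (Suc k)) - D (y k) * B h)) - sc (of_real h) * r"
          by (simp add: hr D_def y(3) algebra_simps)
        then have "norm (D (y k)) \<le> (1 + 4 * a * (h / \<xi>)) * norm (D (y (Suc k))) + 2 * h * norm r"
        proof (rule difference_step_bound)
          show "norm (sc (1 / y k) :: 'n malg) \<le> 1 / \<xi>" using Ry \<xi> Rx by (intro norm_sc_inverse_le) auto
          show "norm (A h (y k + of_real h)) \<le> a" using Abd Ry \<xi> Rx h by auto
          have "h * a \<le> 1 * a" using h a by (intro mult_right_mono) auto
          then show "2 * h * a \<le> \<xi>" using Rx \<xi> by simp
        qed (use Abd h \<xi> Rx in auto)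
        also have "\<dots> \<le> (1 + real b * (h / \<xi>)) * norm (D (y (Suc k))) + 2 * h * \<eta>"
          using b r h \<xi> Rx by (intro add_mono mult_right_mono mult_left_mono) auto
        finally show ?thesis by (simp add: \<xi>_def)
      qed
      \<comment> \<open>At the end point, beyond X, both functions are compared with their
        truncations of order m, and the truncations with each other.\<close>
      have far: "norm (D (y n)) \<le> C / X ^ (m + 1) + \<sigma> h"
      proof -
        have Re: "Re (y n) \<ge> X" "Re (y n) \<ge> R1" "Re (y n) \<ge> R2" "Re (y n) \<ge> 1" using n X by (auto simp: y)
        define P where "P c = trunc m c (y n)" for c :: "'n malg fps"
        have le: "c / Re (y n) ^ (m + 1) \<le> c / X ^ (m + 1)" if "c \<ge> 0" for c
          using that Re X by (intro divide_left_mono power_mono) auto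
        have "norm (F h (y n) - P (\<phi> h)) \<le> \<bar>K1\<bar> / X ^ (m + 1)"
          using K1 [OF Re(2)] le [of "\<bar>K1\<bar>"] Re unfolding P_def
          by (smt (verit) divide_right_mono zero_le_power)
        moreover have "norm (F0 (y n) - P \<phi>0) \<le> K2 / X ^ (m + 1)"
          using K2(3) [OF _ Re(3)] le [OF K2(1)] unfolding P_def by fastforce
        moreover have "norm (P (\<phi> h) - P \<phi>0) \<le> \<sigma> h"
        proof -
          have "P (\<phi> h) - P \<phi>0 = (\<Sum>s\<le>m. (fps_nth (\<phi> h) s - fps_nth \<phi>0 s) * sc (1 / y n) ^ s)"
            by (simp add: P_def sum_subtractf left_diff_distrib)
          moreover have "norm ((fps_nth (\<phi> h) s - fps_nth \<phi>0 s) * sc (1 / y n) ^ s) \<le> norm (fps_nth (\<phi> h) s - fps_nth \<phi>0 s)" for s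
          proof -
            have "norm (sc (1 / y n) ^ s :: 'n malg) \<le> 1 / Re (y n) ^ s"
              using Re by (intro norm_sc_inverse_power_le) auto
            also have "\<dots> \<le> 1" using Re by (simp add: divide_simps one_le_power)
            finally show ?thesis
              by (intro order.trans [OF norm_mult_ineq]) (simp add: mult_left_le)
          qed
          ultimately show ?thesis unfolding \<sigma>_def by (auto intro: order.trans [OF norm_sum sum_mono])
        qed
        moreover have "D (y n) = (F h (y n) - P (\<phi> h)) - (F0 (y n) - P \<phi>0) + (P (\<phi> h) - P \<phi>0)"
          by (simp add: D_def)
        ultimately have "norm (D (y n)) \<le> \<bar>K1\<bar> / X ^ (m + 1) + K2 / X ^ (m + 1) + \<sigma> h"
          by (smt (verit) norm_triangle_ineq norm_triangle_ineq4)
        then show ?thesis by (simp add: C_def add_divide_distrib)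
      qed
      have "norm (D (y 0)) \<le> (\<Prod>k<n. 1 + real b * (h / (Re x + real k * h))) * (norm (D (y n)) + (\<Sum>k<n. 2 * h * \<eta>))"
        using step h \<eta> Rx
        by (intro discrete_gronwall [where u = "\<lambda>k. norm (D (y k))"])
          (auto intro!: mult_nonneg_nonneg divide_nonneg_nonneg add_nonneg_nonneg)
      also have "\<dots> \<le> G * ((C / X ^ (m + 1) + \<sigma> h) + 2 * (X + 1) * \<eta>)"
      proof (intro mult_mono add_mono far)
        have "(\<Prod>k<n. 1 + real b * (h / (Re x + real k * h))) \<le> ((Re x + real n * h) / Re x) ^ b"
          by (rule prod_step_ratio_le) (use h Rx in auto)
        also have "\<dots> \<le> G"
          unfolding G_def
        proof (rule power_mono)
          have "(Re x + real n * h) / Re x \<le> (Re x + real n * h) / 1"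
            using Rx h by (intro divide_left_mono add_nonneg_nonneg) auto
          then show "(Re x + real n * h) / Re x \<le> X + 1" using n by simp
        qed (use Rx h in \<open>auto intro!: divide_nonneg_nonneg add_nonneg_nonneg\<close>)
        finally show "(\<Prod>k<n. 1 + real b * (h / (Re x + real k * h))) \<le> G" .
        have "real n * h \<le> X + 1" using n Rx by linarith
        then have "2 * (real n * h) * \<eta> \<le> 2 * (X + 1) * \<eta>" using \<eta> by (intro mult_right_mono) auto
        then show "(\<Sum>k<n. 2 * h * \<eta>) \<le> 2 * (X + 1) * \<eta>" by (simp add: mult_ac)
      qed (use G h \<eta> in \<open>auto intro!: add_nonneg_nonneg mult_nonneg_nonneg\<close>)
      also have "\<dots> = G * (C / X ^ (m + 1)) + G * \<sigma> h + G * (2 * (X + 1) * \<eta>)" by (simp add: algebra_simps)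
      also have "\<dots> < e"
      proof -
        have "G * (C / X ^ (m + 1)) \<le> e / 4"
        proof -
          have "G \<le> (2 * X) ^ b" unfolding G_def using X by (intro power_mono) auto
          moreover have "X ^ b * X \<le> X ^ (m + 1)"
          proof -
            have "X ^ (b + 1) \<le> X ^ (m + 1)" using X by (intro power_increasing) (auto simp: m_def)
            then show ?thesis by (simp add: mult.commute)
          qed
          ultimately have "G * (C / X ^ (m + 1)) \<le> (2 * X) ^ b * (C / (X ^ b * X))"
            using C X G by (intro mult_mono divide_left_mono) auto
          also have "\<dots> = 2 ^ b * C / X" using X by (simp add: power_mult_distrib)
          also have "\<dots> \<le> e / 4"
          proof -
            have "2 ^ b * C * 4 \<le> X * e" using X(6) e by (simp add: pos_divide_le_eq)
            then show ?thesis using X by (simp add: divide_simps mult_ac)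
          qed
          finally show ?thesis .
        qed
        moreover have "G * \<sigma> h < e / 4"
          using \<sigma> G by (simp add: pos_less_divide_eq mult_ac)
        moreover have "G * (2 * (X + 1) * \<eta>) = e / 4"
        proof -
          have gen: "G * (2 * u * (e / (8 * G * u))) = e / 4" if "u > 0" for u using that G by simp
          have "X + 1 > 0" using X(1) by simp
          then show ?thesis unfolding \<eta>_def by (rule gen)
        qed
        ultimately show ?thesis using e by linarith
      qed
      finally show "dist (F h x) (F0 x) < e" by (simp add: D_def y_def dist_norm)
    qed
  qed
qed

subsection \<open>Propagation to the left\<close>

text \<open>With B = 0 the step is explicit, and the coefficient is bounded on the compact set
  \<open>T\<close>, so n steps amplify errors by at most exp(M n h). As n h is bounded by the length
  of the segments, consistency alone gives convergence.\<close>

lemma propagation: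
  fixes A E :: "real \<Rightarrow> complex \<Rightarrow> ('n::finite) malg"
  assumes K: "compact K" "\<And>x. x \<in> K \<Longrightarrow> Re x \<le> X"
    and T: "compact T" "\<And>x t. x \<in> K \<Longrightarrow> 0 \<le> t \<Longrightarrow> Re x + t \<le> X + 1 \<Longrightarrow> x + of_real t \<in> T" "0 \<notin> T"
    and far: "uniform_limit (T \<inter> {x. Re x \<ge> X}) E E0 (at_right 0)"
    and Abd: "\<forall>\<^sub>F h in at_right 0. \<forall>x\<in>T. norm (A h (x + of_real h)) \<le> a"
    and eq: "\<forall>\<^sub>F h in at_right 0. \<forall>x\<in>T. E h (x + of_real h) - E h x =
      sc (of_real h) * (sc (1 / x) * (A h (x + of_real h) * E h (x + of_real h)))"
    and cons: "\<And>\<epsilon>. \<epsilon> > 0 \<Longrightarrow> \<forall>\<^sub>F h in at_right 0. \<forall>x\<in>T. norm (E0 (x + of_real h) - E0 x -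
      sc (of_real h) * (sc (1 / x) * (A h (x + of_real h) * E0 (x + of_real h)))) \<le> \<epsilon> * h"
  shows "uniform_limit K E E0 (at_right 0)"
proof (rule uniform_limitI)
  fix e :: real assume e: "e > 0"
  obtain Bd where Bd: "Bd > 0" "\<And>x. x \<in> K \<Longrightarrow> cmod x \<le> Bd"
    using K(1) compact_imp_bounded bounded_pos by metis
  \<comment> \<open>Bounds the length of the segment from a point of K to the line Re x = X +
    1.\<close>
  define L where "L = \<bar>X\<bar> + 1 + Bd"
  have L: "L > 0" using Bd by (simp add: L_def)
  have "continuous_on T (\<lambda>x. 1 / x)" using T by (auto intro!: continuous_intros)
  then have "bounded ((\<lambda>x. 1 / x) ` T)" using T by (auto intro!: compact_imp_bounded compact_continuous_image)
  then obtain z where z: "z > 0" "\<And>x. x \<in> T \<Longrightarrow> cmod (1 / x) \<le> z" unfolding bounded_pos by auto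
  define M where "M = z * \<bar>a\<bar>"
  have M: "M \<ge> 0" using z by (simp add: M_def)
  define G where "G = exp (M * L)"
  have G: "G > 0" by (simp add: G_def)
  define \<eta> where "\<eta> = e / (4 * G * L)"
  have \<eta>: "\<eta> > 0" using e G L by (simp add: \<eta>_def)
  have "\<forall>\<^sub>F h in at_right 0. \<forall>x\<in>T \<inter> {x. Re x \<ge> X}. dist (E h x) (E0 x) < e / (4 * G)"
    using far e G by (auto simp: uniform_limit_iff)
  moreover have "\<forall>\<^sub>F h in at_right (0::real). h \<le> 1 \<and> 0 < h"
    by (intro eventually_conj) (auto simp: eventually_at_right_less intro!: eventually_at_rightI [of 0 1])
  ultimately show "\<forall>\<^sub>F h in at_right 0. \<forall>x\<in>K. dist (E h x) (E0 x) < e"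
    using cons [OF \<eta>] Abd eq
  proof eventually_elim
    case (elim h)
    then have h: "h \<le> 1" "0 < h" by auto
    show ?case
    proof
      fix x assume x: "x \<in> K"
      obtain n where n: "X \<le> Re x + real n * h" "Re x + real n * h \<le> X + 1" "\<And>k. k < n \<Longrightarrow> Re x + real k * h \<le> X"
        using steps_to [OF h(2,1) K(2) [OF x]] by metis
      define y where "y k = x + of_real (real k * h)" for k
      have y: "Re (y k) = Re x + real k * h" "y (Suc k) = y k + of_real h" for k
        by (simp_all add: y_def algebra_simps)
      define D where "D z = E h z - E0 z" for z
      have yT: "y k \<in> T" if "k \<le> n" for k
      proof -
        have "real k * h \<le> real n * h" using that h by (intro mult_right_mono) auto
        then have "Re x + real k * h \<le> X + 1" using n(2) by linarith
        then show ?thesis unfolding y_def using h by (intro T(2) x) auto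
      qed
      have step: "norm (D (y k)) \<le> (1 + h * M) * norm (D (y (Suc k))) + h * \<eta>" if "k < n" for k
      proof -
        define W where "W = A h (y k + of_real h)"
        have W: "norm W \<le> \<bar>a\<bar>" using elim(4) yT [of k] that by (auto simp: W_def intro: order.trans)
        define r where "r = E0 (y k + of_real h) - E0 (y k) - sc (of_real h) * (sc (1 / y k) * (W * E0 (y k + of_real h)))"
        have r: "norm r \<le> \<eta> * h" using elim(3) yT [of k] that by (auto simp: r_def W_def)
        have "E h (y k + of_real h) - E h (y k) = sc (of_real h) * (sc (1 / y k) * (W * E h (y k + of_real h)))"
          using elim(5) yT [of k] that by (auto simp: W_def)
        then have "D (y k) = D (y (Suc k)) - sc (of_real h) * (sc (1 / y k) * (W * D (y (Suc k)))) + r"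
          by (simp add: D_def r_def y(2) algebra_simps)
        also have "norm \<dots> \<le> norm (D (y (Suc k))) + h * (z * (\<bar>a\<bar> * norm (D (y (Suc k))))) + \<eta> * h"
        proof -
          have "norm (W * D (y (Suc k))) \<le> \<bar>a\<bar> * norm (D (y (Suc k)))"
            using W by (intro order.trans [OF norm_mult_ineq] mult_right_mono) auto
          then have "cmod (1 / y k) * norm (W * D (y (Suc k))) \<le> z * (\<bar>a\<bar> * norm (D (y (Suc k))))"
            using z yT [of k] that by (intro mult_mono) auto
          then have "norm (sc (of_real h) * (sc (1 / y k) * (W * D (y (Suc k))))) \<le> h * (z * (\<bar>a\<bar> * norm (D (y (Suc k)))))"
            unfolding norm_sc_mult using h by (auto intro: mult_left_mono)
          then show ?thesis using r by (smt (verit) norm_triangle_ineq norm_triangle_ineq4)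
        qed
        finally show ?thesis by (simp add: M_def algebra_simps)
      qed
      have nh: "real n * h \<le> L"
        using n Bd(2) [OF x] complex_Re_le_cmod [of "- x"] by (simp add: L_def)
      have "norm (D (y 0)) \<le> (\<Prod>k<n. 1 + h * M) * (norm (D (y n)) + (\<Sum>k<n. h * \<eta>))"
        using step h \<eta> M by (intro discrete_gronwall [where u = "\<lambda>k. norm (D (y k))"]) auto
      also have "\<dots> \<le> G * (e / (4 * G) + L * \<eta>)"
      proof (intro mult_mono add_mono)
        have "(\<Prod>k<n. 1 + h * M) \<le> exp (h * M) ^ n"
          using h M exp_ge_add_one_self [of "h * M"] by (simp add: power_mono)
        also have "\<dots> = exp (M * (real n * h))" by (simp add: exp_of_nat_mult [symmetric] mult_ac)
        also have "\<dots> \<le> G" unfolding G_def using nh M by (auto intro: mult_left_mono)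
        finally show "(\<Prod>k<n. 1 + h * M) \<le> G" .
        have "y n \<in> T \<inter> {x. Re x \<ge> X}" using yT [of n] n by (simp add: y)
        then show "norm (D (y n)) \<le> e / (4 * G)" using elim(1) by (auto simp: D_def dist_norm less_imp_le)
        show "(\<Sum>k<n. h * \<eta>) \<le> L * \<eta>" using nh \<eta> by (simp add: mult.assoc [symmetric])
      qed (use G h \<eta> L e in auto)
      also have "\<dots> = e / 2" using G L by (simp add: \<eta>_def distrib_left)
      also have "\<dots> < e" using e by simp
      finally show "dist (E h x) (E0 x) < e" by (simp add: D_def y_def dist_norm)
    qed
  qed
qed

subsection \<open>Rational matrices\<close>

lemma ent_of_nat_mult [simp]: "ent (of_nat s * X) i j = of_nat s * ent X i j"
  by (metis ent_sc_mult of_real_of_nat_eq sc_of_real)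

lemma rat_denominator_nonzero: "snd (quot_of_fract (r :: complex poly fract)) \<noteq> 0"
  by (rule snd_quot_of_fract_nonzero)

lemma finite_ratm_poles: "finite (ratm_poles (A :: ('n::finite) ratmat))"
  unfolding ratm_poles_def rat_poles_def
  by (intro finite_UN_I finite) (auto intro: poly_roots_finite rat_denominator_nonzero)

lemma rat_eval_holomorphic: "S \<inter> rat_poles r = {} \<Longrightarrow> rat_eval r holomorphic_on S"
  unfolding rat_eval_def rat_poles_def by (intro holomorphic_intros) auto

lemma ratm_eval_entry_holomorphic:
  assumes "S \<inter> ratm_poles A = {}"
  shows "(\<lambda>x. ent (alg_of (ratm_eval A x)) i j) holomorphic_on S"
proof -
  have "S \<inter> rat_poles (A $ i $ j) = {}" using assms by (auto simp: ratm_poles_def)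
  then show ?thesis using rat_eval_holomorphic by (simp add: ratm_eval_def)
qed

text \<open>Multiplied by the denominator q, the identity with the fraction p/q continues to the
  whole half-plane. A pole there would be a common zero of p and q, against coprimality.\<close>

lemma rat_continuation:
  assumes f: "f holomorphic_on {x. Re x > l}"
    and eq: "\<And>x. Re x > R \<Longrightarrow> f x = rat_eval r x" and x: "Re x > l"
  shows "x \<notin> rat_poles r \<and> f x = rat_eval r x"
proof -
  define p where "p = fst (quot_of_fract r)"
  define q where "q = snd (quot_of_fract r)"
  have q: "q \<noteq> 0" unfolding q_def by (rule rat_denominator_nonzero)
  have fin: "finite {x. poly q x = 0}" using q by (rule poly_roots_finite)
  then obtain B where B: "\<And>x. poly q x = 0 \<Longrightarrow> cmod x \<le> B"
    using finite_imp_bounded [OF fin] unfolding bounded_iff by blast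
  define U where "U = {x. Re x > max l R} \<inter> - {x. poly q x = 0}"
  have "open U"
    unfolding U_def using fin by (intro open_Int open_halfspace_Re_gt open_Compl finite_imp_closed)
  define \<xi> where "\<xi> = complex_of_real (\<bar>l\<bar> + \<bar>R\<bar> + \<bar>B\<bar> + 1)"
  have "cmod \<xi> > B" unfolding \<xi>_def norm_of_real by simp
  then have "\<xi> \<in> U" using B [of \<xi>] by (auto simp: U_def \<xi>_def)
  have zero: "poly q x * f x - poly p x = 0" if "Re x > l" for x
  proof (rule analytic_continuation [where S = "{x. Re x > l}" and U = U and \<xi> = \<xi> and f = "\<lambda>x. poly q x * f x - poly p x"])
    show "(\<lambda>x. poly q x * f x - poly p x) holomorphic_on {x. l < Re x}"
      by (intro holomorphic_intros f)
    show "connected {x. l < Re x}" by (intro convex_connected convex_halfspace_Re_gt)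
    show "\<xi> islimpt U" using \<open>\<xi> \<in> U\<close> \<open>open U\<close> by (simp add: interior_limit_point interior_open)
    show "poly q z * f z - poly p z = 0" if "z \<in> U" for z
      using that eq [of z] by (simp add: U_def rat_eval_def p_def q_def)
  qed (use that \<open>\<xi> \<in> U\<close> in \<open>auto simp: U_def open_halfspace_Re_gt\<close>)
  have "poly q x \<noteq> 0"
  proof
    assume qx: "poly q x = 0"
    with zero [OF x] have "poly p x = 0" by simp
    with qx have "[:-x, 1:] dvd p" "[:-x, 1:] dvd q" by (simp_all add: poly_eq_0_iff_dvd)
    moreover have "coprime p q" unfolding p_def q_def by (rule coprime_quot_of_fract)
    ultimately have "is_unit [:-x, 1:]" by (rule coprime_common_divisor [rotated])
    then show False by (simp add: is_unit_pCons_iff)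
  qed
  then show ?thesis using zero [OF x] by (simp add: rat_poles_def rat_eval_def p_def q_def field_simps)
qed

text \<open>The expansion is given on a half-plane that may vary with h. The growth condition makes
  the series converge locally uniformly for Re x > \<open>l\<close>, and by continuation its sum is
  the rational matrix, which therefore has no poles there. Thus all h share one half-plane.\<close>

lemma fact_expansion_half_plane:
  fixes A :: "('n::finite) ratmat"
  assumes exp: "fact_expansion h A a" and h: "h > 0" and l: "l \<ge> 0" and C: "C \<ge> 0"
    and a: "\<And>s. s \<ge> 1 \<Longrightarrow> norm (alg_of (a s)) \<le> C * rising h (s - 1) l"
    and x: "Re x > l"
  shows "x \<notin> ratm_poles A" "(\<lambda>s. sc (1 / rising h s x) * alg_of (a s)) sums alg_of (ratm_eval A x)"
proof -
  define S where "S x = (\<Sum>s. sc (1 / rising h s x) * alg_of (a s))" for x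
  have sS: "(\<lambda>s. sc (1 / rising h s x) * alg_of (a s)) sums S x" if "Re x > l" for x
    unfolding S_def
    by (rule summable_sums [OF summable_norm_cancel [OF factorial_series_tail(1) [OF h l C a that]]])
  obtain R where R: "\<And>x. Re x > R \<Longrightarrow> (\<lambda>s. (1 / rising h s x) *\<^sub>C a s) sums ratm_eval A x"
    using exp unfolding fact_expansion_def by blast
  have SR: "S x = alg_of (ratm_eval A x)" if "Re x > max l R" for x
  proof -
    have "(\<lambda>s. alg_of ((1 / rising h s x) *\<^sub>C a s)) sums alg_of (ratm_eval A x)"
      using R [of x] that by (simp add: sums_alg_of_iff)
    then have "(\<lambda>s. sc (1 / rising h s x) * alg_of (a s)) sums alg_of (ratm_eval A x)"
      by (simp only: alg_of_csmult)
    moreover have "Re x > l" using that by simp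
    ultimately show ?thesis using sums_unique2 [OF sS] by blast
  qed
  have hol: "(\<lambda>x. ent (S x) i j) holomorphic_on {x. Re x > l}" for i j
  proof (rule holomorphic_uniform_sequence [where f = "\<lambda>n x. \<Sum>s<n. ent (sc (1 / rising h s x) * alg_of (a s)) i j"])
    show "open {x. Re x > l}" by (rule open_halfspace_Re_gt)
    have nz: "rising h s x \<noteq> 0" if "Re x > l" for s x
      using norm_rising_ge [OF h, of x s] rising_pos [OF h, of "Re x" s] that l by force
    have rh: "(\<lambda>x. rising h s x) holomorphic_on T" for s T
      unfolding rising_def by (intro holomorphic_intros)
    show "(\<lambda>x. \<Sum>s<n. ent (sc (1 / rising h s x) * alg_of (a s)) i j) holomorphic_on {x. Re x > l}" for n
      unfolding ent_sc_mult by (intro holomorphic_intros rh) (use nz in auto)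
    fix x assume "x \<in> {x. Re x > l}"
    then have x: "Re x > l" by simp
    define d where "d = (Re x - l) / 2"
    have d: "d > 0" using x by (simp add: d_def)
    \<comment> \<open>A real point to the left of the disc: the series of norms at this point is the
      Weierstrass majorant.\<close>
    define \<xi>0 where "\<xi>0 = l + d"
    have Re: "Re y \<ge> \<xi>0" if "y \<in> cball x d" for y
      using that abs_Re_le_cmod [of "x - y"] by (auto simp: dist_norm \<xi>0_def d_def field_simps)
    have "uniform_limit (cball x d) (\<lambda>n x. \<Sum>s<n. ent (sc (1 / rising h s x) * alg_of (a s)) i j)
        (\<lambda>x. \<Sum>s. ent (sc (1 / rising h s x) * alg_of (a s)) i j) sequentially"
    proof (rule Weierstrass_m_test)
      have r0: "cmod (rising h s (of_real \<xi>0)) = rising h s \<xi>0" for s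
      proof -
        have "rising h s (of_real \<xi>0 :: complex) = of_real (rising h s \<xi>0)" by (simp add: rising_def)
        then show ?thesis using rising_pos [OF h, of \<xi>0 s] d l by (simp add: \<xi>0_def)
      qed
      show "summable (\<lambda>s. norm (sc (1 / rising h s (of_real \<xi>0)) * alg_of (a s)))"
        by (rule factorial_series_tail(1) [OF h l C a]) (use d in \<open>simp_all add: \<xi>0_def\<close>)
      fix s y assume y: "y \<in> cball x d"
      have "rising h s \<xi>0 \<le> cmod (rising h s y)"
      proof -
        have "rising h s \<xi>0 \<le> rising h s (Re y)"
          unfolding rising_def using Re [OF y] d l h by (intro prod_mono) (auto simp: \<xi>0_def)
        also have "\<dots> \<le> cmod (rising h s y)"
          using Re [OF y] d l by (intro norm_rising_ge [OF h]) (auto simp: \<xi>0_def)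
        finally show ?thesis .
      qed
      moreover have "rising h s \<xi>0 > 0" using d l by (intro rising_pos h) (auto simp: \<xi>0_def)
      ultimately have "norm (alg_of (a s)) / cmod (rising h s y) \<le> norm (alg_of (a s)) / rising h s \<xi>0"
        by (intro divide_left_mono mult_pos_pos) auto
      then show "cmod (ent (sc (1 / rising h s y) * alg_of (a s)) i j) \<le> norm (sc (1 / rising h s (of_real \<xi>0)) * alg_of (a s))"
        using norm_ent_le [of "sc (1 / rising h s y) * alg_of (a s)" i j] by (simp add: norm_divide r0)
    qed
    moreover have "(\<Sum>s. ent (sc (1 / rising h s y) * alg_of (a s)) i j) = ent (S y) i j" if "y \<in> cball x d" for y
    proof -
      have "Re y > l" using Re [OF that] d by (simp add: \<xi>0_def)
      from sS [OF this] show ?thesis unfolding sums_malg_iff sums_iff by blast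
    qed
    then have "uniform_limit (cball x d) (\<lambda>n x. \<Sum>s<n. ent (sc (1 / rising h s x) * alg_of (a s)) i j)
        (\<lambda>x. \<Sum>s. ent (sc (1 / rising h s x) * alg_of (a s)) i j) sequentially \<longleftrightarrow>
      uniform_limit (cball x d) (\<lambda>n x. \<Sum>s<n. ent (sc (1 / rising h s x) * alg_of (a s)) i j)
        (\<lambda>x. ent (S x) i j) sequentially"
      by (intro uniform_limit_cong') auto
    ultimately have "uniform_limit (cball x d) (\<lambda>n x. \<Sum>s<n. ent (sc (1 / rising h s x) * alg_of (a s)) i j)
        (\<lambda>x. ent (S x) i j) sequentially"
      by blast
    moreover have "cball x d \<subseteq> {x. Re x > l}" using Re d by (auto simp: \<xi>0_def) (smt (verit))
    ultimately show "\<exists>d>0. cball x d \<subseteq> {x. Re x > l} \<and>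
        uniform_limit (cball x d) (\<lambda>n x. \<Sum>s<n. ent (sc (1 / rising h s x) * alg_of (a s)) i j) (\<lambda>x. ent (S x) i j) sequentially"
      using d by blast
  qed
  have *: "x \<notin> rat_poles (A $ i $ j) \<and> ent (S x) i j = rat_eval (A $ i $ j) x" for i j
    by (rule rat_continuation [OF hol _ x, of "max l R"]) (use SR in \<open>simp add: ratm_eval_def\<close>)
  then show "x \<notin> ratm_poles A" by (simp add: ratm_poles_def)
  have "S x = alg_of (ratm_eval A x)" by (rule malg_eqI) (simp add: * ratm_eval_def)
  then show "(\<lambda>s. sc (1 / rising h s x) * alg_of (a s)) sums alg_of (ratm_eval A x)"
    using sS [OF x] by simp
qed

subsection \<open>The region \<open>\<Omega>\<^sup>+\<close>\<close>

lemma Omega_plus_iff: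
  "x \<in> Omega_plus A \<longleftrightarrow> (\<forall>p\<in>insert 0 (ratm_poles A). Im x = Im p \<longrightarrow> Re x > Re p)"
proof -
  have *: "x \<in> {p - of_real t |t. t \<ge> 0} \<longleftrightarrow> Im x = Im p \<and> Re x \<le> Re p" for p
  proof
    assume "Im x = Im p \<and> Re x \<le> Re p"
    then have "x = p - of_real (Re p - Re x)" "Re p - Re x \<ge> 0" by (auto simp: complex_eq_iff)
    then show "x \<in> {p - of_real t |t. t \<ge> 0}" by blast
  qed auto
  show ?thesis unfolding Omega_plus_def by (simp only: Diff_iff UN_iff * not_le [symmetric]) blast
qed

lemma Omega_plus_not_pole: "x \<in> Omega_plus A \<Longrightarrow> x \<noteq> 0 \<and> x \<notin> ratm_poles A"
  unfolding Omega_plus_iff by auto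

lemma Omega_plus_add: "x \<in> Omega_plus A \<Longrightarrow> t \<ge> 0 \<Longrightarrow> x + of_real t \<in> Omega_plus A"
  unfolding Omega_plus_iff by force

lemma open_Omega_plus: "open (Omega_plus (A :: ('n::finite) ratmat))"
proof -
  have "Omega_plus A = - (\<Union>p\<in>insert 0 (ratm_poles A). {x. Im x = Im p} \<inter> {x. Re x \<le> Re p})"
    by (rule set_eqI) (simp only: Omega_plus_iff Compl_iff UN_iff Int_iff mem_Collect_eq not_le [symmetric], blast)
  moreover have "closed (\<Union>p\<in>insert 0 (ratm_poles A). {x. Im x = Im p} \<inter> {x. Re x \<le> Re p})"
  proof (rule closed_UN)
    have "closed {x. Im x = c}" for c by (intro closed_Collect_eq continuous_intros)
    then show "\<forall>p\<in>insert 0 (ratm_poles A). closed ({x. Im x = Im p} \<inter> {x. Re x \<le> Re p})"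
      by (auto intro!: closed_Int closed_halfspace_Re_le)
  qed (use finite_ratm_poles [of A] in simp)
  ultimately show ?thesis by (simp only: open_Compl)
qed

lemma right_half_plane_Omega_plus:
  fixes A :: "('n::finite) ratmat"
  obtains X where "\<And>x. Re x > X \<Longrightarrow> x \<in> Omega_plus A"
proof -
  obtain B where B: "\<And>p. p \<in> insert 0 (ratm_poles A) \<Longrightarrow> cmod p \<le> B"
  proof -
    have "bounded (insert 0 (ratm_poles A))" using finite_ratm_poles [of A] by (intro finite_imp_bounded) simp
    then show ?thesis using that unfolding bounded_iff by blast
  qed
  show ?thesis
  proof (rule that [of B])
    fix x assume "Re x > B"
    then show "x \<in> Omega_plus A"
      unfolding Omega_plus_iff using B complex_Re_le_cmod by (smt (verit))
  qed
qed

text \<open>Every point is joined by its horizontal ray to one common right half-plane.\<close>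

lemma connected_Omega_plus: "connected (Omega_plus (A :: ('n::finite) ratmat))"
proof -
  obtain X where X: "\<And>x. Re x > X \<Longrightarrow> x \<in> Omega_plus A" by (rule right_half_plane_Omega_plus [where A = A]) blast
  define H where "H = {x. Re x > X}"
  define S where "S x = (\<lambda>t. x + complex_of_real t) ` {0..} \<union> H" for x
  have conn: "connected (S x)" for x
    unfolding S_def
  proof (rule connected_Un)
    show "connected ((\<lambda>t. x + complex_of_real t) ` {0..})"
      by (intro connected_continuous_image continuous_intros) auto
    show "connected H" unfolding H_def by (intro convex_connected convex_halfspace_Re_gt)
    have "x + complex_of_real (\<bar>X - Re x\<bar> + 1) \<in> (\<lambda>t. x + complex_of_real t) ` {0..} \<inter> H"
      by (intro IntI imageI) (auto simp: H_def)
    then show "(\<lambda>t. x + complex_of_real t) ` {0..} \<inter> H \<noteq> {}" by blast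
  qed
  have "Omega_plus A = (\<Union>x\<in>Omega_plus A. S x)"
  proof
    show "Omega_plus A \<subseteq> (\<Union>x\<in>Omega_plus A. S x)"
    proof
      fix x assume x: "x \<in> Omega_plus A"
      then show "x \<in> (\<Union>x\<in>Omega_plus A. S x)"
        by (intro UN_I [OF x]) (auto simp: S_def intro!: image_eqI [of _ _ 0])
    qed
    show "(\<Union>x\<in>Omega_plus A. S x) \<subseteq> Omega_plus A"
      using X by (auto simp: S_def H_def Omega_plus_add)
  qed
  moreover have "connected (\<Union>x\<in>Omega_plus A. S x)"
  proof (rule connected_Union)
    have "complex_of_real (X + 1) \<in> \<Inter> (S ` Omega_plus A)" by (auto simp: S_def H_def)
    then show "\<Inter> (S ` Omega_plus A) \<noteq> {}" by blast
  qed (use conn in auto)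
  ultimately show ?thesis by simp
qed

subsection \<open>The differential system\<close>

lemma alg_of_mat_exp: "alg_of (mat_exp M) = exp (alg_of M)"
proof -
  have p: "alg_of (((**) M ^^ k) (mat 1)) = alg_of M ^ k" for k
    by (induction k) (simp_all add: alg_of_mult)
  have tm: "alg_of ((1 / fact k) *\<^sub>C ((**) M ^^ k) (mat 1)) = alg_of M ^ k /\<^sub>R fact k" for k
  proof -
    have "sc (1 / fact k) * X = X /\<^sub>R fact k" for X :: "'a malg"
      by (rule malg_eqI) (simp only: ent_sc_mult ent_scaleR, simp add: scaleR_conv_of_real field_simps)
    then show ?thesis by (simp add: alg_of_csmult p)
  qed
  have "(\<lambda>k. alg_of M ^ k /\<^sub>R fact k) sums alg_of (mat_of (exp (alg_of M)))"
    using exp_converges [of "alg_of M"] by (simp add: mat_of_inverse)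
  then have "(\<lambda>k. (1 / fact k) *\<^sub>C ((**) M ^^ k) (mat 1)) sums mat_of (exp (alg_of M))"
    unfolding tm [symmetric] sums_alg_of_iff .
  then show ?thesis unfolding mat_exp_def by (simp add: sums_iff mat_of_inverse)
qed

lemma alg_of_cpow_mat: "alg_of (cpow_mat x M) = exp (sc (Ln x) * alg_of M)"
  by (simp add: cpow_mat_def alg_of_mat_exp alg_of_csmult)

text \<open>Each entry of exp(w M) is an everywhere convergent power series in w and is
  differentiated term by term.\<close>

lemma ent_exp_has_derivative:
  "((\<lambda>w. ent (exp (sc w * M)) i j) has_field_derivative ent (M * exp (sc w * M)) i j) (at w)"
proof -
  define c where "c m = ent (M ^ m) i j / fact m" for m
  have sums: "(\<lambda>m. sc (w ^ m / fact m) * M ^ m) sums exp (sc w * M)" for w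
    using fcalc_sums [OF powser_exp, of w M] by (simp add: fcalc_exp)
  have c: "powser c (\<lambda>w. ent (exp (sc w * M)) i j)"
    unfolding powser_def
  proof
    fix w
    have "(\<lambda>m. ent (sc (w ^ m / fact m) * M ^ m) i j) sums ent (exp (sc w * M)) i j"
      using sums [of w] unfolding sums_malg_iff by blast
    then show "(\<lambda>m. c m * w ^ m) sums ent (exp (sc w * M)) i j"
      by (simp add: c_def mult.commute)
  qed
  have d: "powser (diffs c) (\<lambda>w. ent (M * exp (sc w * M)) i j)"
    unfolding powser_def
  proof
    fix w
    have "(\<lambda>m. M * (sc (w ^ m / fact m) * M ^ m)) sums (M * exp (sc w * M))"
      by (intro sums_mult sums)
    then have "(\<lambda>m. sc (w ^ m / fact m) * M ^ Suc m) sums (M * exp (sc w * M))"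
      by (simp add: mult.assoc [symmetric] sc_commute [of M])
    then have "(\<lambda>m. ent (sc (w ^ m / fact m) * M ^ Suc m) i j) sums ent (M * exp (sc w * M)) i j"
      unfolding sums_malg_iff by blast
    moreover have "ent (sc (w ^ m / fact m) * M ^ Suc m) i j = diffs c m * w ^ m" for m
      unfolding ent_sc_mult by (simp add: c_def diffs_def fact_Suc del: of_nat_Suc power_Suc)
    ultimately show "(\<lambda>m. diffs c m * w ^ m) sums ent (M * exp (sc w * M)) i j" by simp
  qed
  have "ent (M * exp (sc w * M)) i j = deriv (\<lambda>w. ent (exp (sc w * M)) i j) w"
    by (rule sums_unique2 [OF d [unfolded powser_def, rule_format] powser_deriv [OF c, unfolded powser_def, rule_format]])
  moreover have "(\<lambda>w. ent (exp (sc w * M)) i j) field_differentiable at w"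
  proof -
    have g: "(\<lambda>w. ent (exp (sc w * M)) i j) = (\<lambda>w. \<Sum>m. c m * w ^ m)"
      using c unfolding powser_def by (auto simp: sums_iff)
    have "summable (\<lambda>m. c m * w ^ m)" for w using c unfolding powser_def by (meson sums_summable)
    then show ?thesis
      unfolding g field_differentiable_def using termdiffs_strong_converges_everywhere by blast
  qed
  ultimately show ?thesis by (simp add: field_differentiable_derivI)
qed

lemma ent_exp_Ln_has_derivative:
  assumes "x \<notin> \<real>\<^sub>\<le>\<^sub>0"
  shows "((\<lambda>x. ent (exp (sc (Ln x) * M)) i j) has_field_derivative
    ent (sc (1 / x) * (M * exp (sc (Ln x) * M))) i j) (at x)"
proof -
  have "((\<lambda>x. ent (exp (sc (Ln x) * M)) i j) has_field_derivative
      ent (M * exp (sc (Ln x) * M)) i j * inverse x) (at x)"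
    by (rule DERIV_chain2 [OF ent_exp_has_derivative has_field_derivative_Ln [OF assms]])
  then show ?thesis by (simp add: field_simps)
qed

text \<open>The derivative is recorded as g / x, because g = x f' is again a series in the same
  powers of 1/x, with coefficients - s a_s.\<close>

lemma inverse_power_series_has_derivative:
  fixes a :: "nat \<Rightarrow> complex"
  assumes R: "R > 0" and f: "\<And>x. cmod x > R \<Longrightarrow> (\<lambda>s. a s / x ^ s) sums f x" and x: "cmod x > R"
  shows "\<exists>g. (\<lambda>s. - of_nat s * a s / x ^ s) sums g \<and> (f has_field_derivative g / x) (at x)"
proof -
  define y where "y = (cmod x + R) / 2"
  have y: "y > R" "y < cmod x" "y > 0" using x R by (auto simp: y_def)
  have xnz: "x \<noteq> 0" using x R by auto
  have sK: "summable (\<lambda>n. a n * (of_real (1 / y)) ^ n)"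
    using f [of "of_real y"] y by (simp add: sums_iff power_divide divide_inverse power_inverse)
  have lt: "norm (1 / x) < norm (complex_of_real (1 / y))"
    using y xnz by (simp add: norm_divide frac_less2)
  have D: "((\<lambda>z. \<Sum>n. a n * z ^ n) has_field_derivative (\<Sum>n. diffs a n * (1 / x) ^ n)) (at (1 / x))"
    by (rule termdiffs_strong [OF sK lt])
  have sD: "summable (\<lambda>n. diffs a n * (1 / x) ^ n)"
    by (rule termdiff_converges [OF lt]) (rule powser_inside [OF sK])
  define S where "S = (\<Sum>n. diffs a n * (1 / x) ^ n)"
  have "((\<lambda>w. 1 / w) has_field_derivative - (1 / x ^ 2)) (at x)"
    using xnz by (auto intro!: derivative_eq_intros simp: power2_eq_square)
  from DERIV_chain2 [OF D this]
  have "((\<lambda>w. \<Sum>n. a n * (1 / w) ^ n) has_field_derivative S * - (1 / x ^ 2)) (at x)"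
    by (simp add: S_def)
  then have "(f has_field_derivative S * - (1 / x ^ 2)) (at x)"
  proof (rule has_field_derivative_transform_within_open [of _ _ _ "{w. cmod w > R}"])
    show "open {w. cmod w > R}" by (intro open_Collect_less continuous_intros)
    show "(\<Sum>n. a n * (1 / w) ^ n) = f w" if "w \<in> {w. cmod w > R}" for w
      using f [of w] that by (simp add: sums_iff power_divide divide_inverse power_inverse)
  qed (use x in simp)
  moreover have "S * - (1 / x ^ 2) = (- S / x) / x" by (simp add: power2_eq_square)
  moreover have "(\<lambda>s. - of_nat s * a s / x ^ s) sums (- S / x)"
  proof -
    have "(\<lambda>n. - (1 / x) * (diffs a n * (1 / x) ^ n)) sums (- (1 / x) * S)"
      unfolding S_def by (intro sums_mult summable_sums sD)
    also have "(\<lambda>n. - (1 / x) * (diffs a n * (1 / x) ^ n)) = (\<lambda>n. - of_nat (Suc n) * a (Suc n) / x ^ Suc n)"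
      by (simp add: fun_eq_iff diffs_def power_divide del: of_nat_Suc)
    finally have "(\<lambda>n. - of_nat (Suc n) * a (Suc n) / x ^ Suc n) sums (- (1 / x) * S)" .
    then show ?thesis by (subst (asm) sums_Suc_iff) simp
  qed
  ultimately show ?thesis by auto
qed

text \<open>\<open>G\<close> is x F'. The product rule and cancellation of the invertible factor,
  the power of x with exponent \<open>M\<close>, turn the equation of the solution into one for F
  alone. For Re x > R > 0 the cut of the logarithm is avoided.\<close>

lemma frobenius_series_ode:
  fixes A :: "('n::finite) ratmat"
  assumes "frobenius_series A M R F"
  obtains a G where "a 0 = mat 1" "\<And>x. cmod x > R \<Longrightarrow> (\<lambda>s. sc (1 / x ^ s) * alg_of (a s)) sums alg_of (F x)"
    "\<And>x. cmod x > R \<Longrightarrow> (\<lambda>s. sc (1 / x ^ s) * (- of_nat s * alg_of (a s))) sums G x"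
    "\<And>x i j. cmod x > R \<Longrightarrow> ((\<lambda>x. ent (alg_of (F x)) i j) has_field_derivative ent (sc (1 / x) * G x) i j) (at x)"
    "\<And>x. Re x > R \<Longrightarrow> G x = alg_of (ratm_eval A x) * alg_of (F x) - alg_of (F x) * alg_of M"
    "\<And>x i j. Re x > R \<Longrightarrow> ((\<lambda>z. ent (alg_of (F z ** cpow_mat z M)) i j) has_field_derivative
      ent (sc (1 / x) * (alg_of (ratm_eval A x) * alg_of (F x ** cpow_mat x M))) i j) (at x)"
proof -
  have R: "R > 0" using assms by (simp add: frobenius_series_def)
  obtain a where a: "a 0 = mat 1" "\<And>x. cmod x > R \<Longrightarrow> (\<lambda>s. (1 / x ^ s) *\<^sub>C a s) sums F x"
    using assms unfolding frobenius_series_def by blast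
  have aF: "(\<lambda>s. sc (1 / x ^ s) * alg_of (a s)) sums alg_of (F x)" if "cmod x > R" for x
    using a(2) [OF that] by (simp add: sums_alg_of_iff [symmetric] alg_of_csmult)
  have ex: "\<exists>g. (\<lambda>s. - of_nat s * (a s $ i $ j) / x ^ s) sums g \<and>
      ((\<lambda>x. ent (alg_of (F x)) i j) has_field_derivative g / x) (at x)" if "cmod x > R" for x i j
  proof (rule inverse_power_series_has_derivative [OF R _ that])
    fix x assume "cmod x > R"
    then have "(\<lambda>s. ent (sc (1 / x ^ s) * alg_of (a s)) i j) sums ent (alg_of (F x)) i j"
      using aF unfolding sums_malg_iff by blast
    then show "(\<lambda>s. a s $ i $ j / x ^ s) sums ent (alg_of (F x)) i j" by simp
  qed
  define g where "g x i j = (SOME g. (\<lambda>s. - of_nat s * (a s $ i $ j) / x ^ s) sums g \<and>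
      ((\<lambda>x. ent (alg_of (F x)) i j) has_field_derivative g / x) (at x))" for x i j
  have g: "(\<lambda>s. - of_nat s * (a s $ i $ j) / x ^ s) sums g x i j"
    "((\<lambda>x. ent (alg_of (F x)) i j) has_field_derivative g x i j / x) (at x)" if "cmod x > R" for x i j
    using someI_ex [OF ex [OF that, of i j]] by (simp_all only: g_def)
  define G where "G x = alg_of (\<chi> i j. g x i j)" for x
  have G1: "(\<lambda>s. sc (1 / x ^ s) * (- of_nat s * alg_of (a s))) sums G x" if "cmod x > R" for x
  proof -
    show ?thesis using g(1) [OF that] unfolding sums_malg_iff by (simp add: G_def)
  qed
  have G2: "((\<lambda>x. ent (alg_of (F x)) i j) has_field_derivative ent (sc (1 / x) * G x) i j) (at x)" if "cmod x > R" for x i j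
    using g(2) [OF that] by (simp add: G_def)
  define e where "e x = exp (sc (Ln x) * alg_of M)" for x
  have prod: "((\<lambda>z. ent (alg_of (F z ** cpow_mat z M)) i j) has_field_derivative
      ent (sc (1 / x) * ((G x + alg_of (F x) * alg_of M) * e x)) i j) (at x)" if "Re x > R" for x i j
  proof -
    have x: "cmod x > R" "x \<notin> \<real>\<^sub>\<le>\<^sub>0"
      using that complex_Re_le_cmod [of x] R by (auto simp: complex_nonpos_Reals_iff)
    have "((\<lambda>z. \<Sum>k\<in>UNIV. ent (alg_of (F z)) i k * ent (e z) k j) has_field_derivative
        (\<Sum>k\<in>UNIV. ent (alg_of (F x)) i k * ent (sc (1 / x) * (alg_of M * e x)) k j + ent (sc (1 / x) * G x) i k * ent (e x) k j)) (at x)"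
      unfolding e_def by (intro DERIV_sum DERIV_mult' G2 x ent_exp_Ln_has_derivative)
    moreover have "(\<Sum>k\<in>UNIV. ent (alg_of (F x)) i k * ent (sc (1 / x) * (alg_of M * e x)) k j + ent (sc (1 / x) * G x) i k * ent (e x) k j) =
        ent (sc (1 / x) * ((G x + alg_of (F x) * alg_of M) * e x)) i j"
    proof -
      have "alg_of (F x) * (sc (1 / x) * (alg_of M * e x)) + (sc (1 / x) * G x) * e x =
          sc (1 / x) * ((G x + alg_of (F x) * alg_of M) * e x)"
        by (simp add: mult.assoc [symmetric] sc_commute [of "alg_of (F x)"] distrib_left distrib_right)
      then have "ent (alg_of (F x) * (sc (1 / x) * (alg_of M * e x)) + (sc (1 / x) * G x) * e x) i j =
          ent (sc (1 / x) * ((G x + alg_of (F x) * alg_of M) * e x)) i j" by simp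
      then show ?thesis by (simp only: ent_add ent_mult [of "alg_of (F x)"] ent_mult [of "sc (1 / x) * G x"] sum.distrib)
    qed
    moreover have "ent (alg_of (F z ** cpow_mat z M)) i j = (\<Sum>k\<in>UNIV. ent (alg_of (F z)) i k * ent (e z) k j)" for z
      unfolding alg_of_mult alg_of_cpow_mat ent_mult e_def ..
    ultimately show ?thesis by simp
  qed
  have ode: "(G x + alg_of (F x) * alg_of M) * e x = alg_of (ratm_eval A x) * (alg_of (F x) * e x)" if "Re x > R" for x
  proof -
    have x: "cmod x > R" "x \<notin> \<real>\<^sub>\<le>\<^sub>0" "x \<noteq> 0"
      using that complex_Re_le_cmod [of x] R by (auto simp: complex_nonpos_Reals_iff)
    obtain D where D: "\<And>i j. ((\<lambda>z. (F z ** cpow_mat z M) $ i $ j) has_field_derivative D $ i $ j) (at x)"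
      "x *\<^sub>C D = ratm_eval A x ** (F x ** cpow_mat x M)"
      using assms x unfolding frobenius_series_def by blast
    have "D $ i $ j = ent (sc (1 / x) * ((G x + alg_of (F x) * alg_of M) * e x)) i j" for i j
      using DERIV_unique [OF D(1) [of i j]] prod [OF that, of i j] by simp
    then have "alg_of D = sc (1 / x) * ((G x + alg_of (F x) * alg_of M) * e x)"
      by (intro malg_eqI) simp
    then have "sc x * alg_of D = (G x + alg_of (F x) * alg_of M) * e x"
      using x(3) by (simp add: mult.assoc [symmetric] sc_mult [symmetric])
    moreover have "sc x * alg_of D = alg_of (ratm_eval A x) * (alg_of (F x) * e x)"
      using arg_cong [OF D(2), of alg_of] by (simp add: alg_of_csmult alg_of_mult alg_of_cpow_mat e_def)
    ultimately show ?thesis by simp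
  qed
  show ?thesis
  proof (rule that [of a G])
    fix x assume x: "Re x > R"
    have "exp (sc (Ln x) * alg_of M) * exp (- (sc (Ln x) * alg_of M)) = 1" by (rule exp_minus_inverse)
    then have inv: "e x * exp (- (sc (Ln x) * alg_of M)) = 1" by (simp add: e_def)
    have "(G x + alg_of (F x) * alg_of M) * (e x * exp (- (sc (Ln x) * alg_of M))) =
        alg_of (ratm_eval A x) * alg_of (F x) * (e x * exp (- (sc (Ln x) * alg_of M)))"
      using ode [OF x] by (simp add: mult.assoc [symmetric])
    then show "G x = alg_of (ratm_eval A x) * alg_of (F x) - alg_of (F x) * alg_of M"
      unfolding inv by (simp add: algebra_simps)
    fix i j
    show "((\<lambda>z. ent (alg_of (F z ** cpow_mat z M)) i j) has_field_derivative
      ent (sc (1 / x) * (alg_of (ratm_eval A x) * alg_of (F x ** cpow_mat x M))) i j) (at x)"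
      using prod [OF x, of i j] unfolding ode [OF x] by (simp add: alg_of_mult alg_of_cpow_mat e_def)
  qed (use a(1) aF G1 G2 in auto)
qed

text \<open>For h = 0 composition with \<open>recip_fps 0\<close> is the identity and
  \<open>Qdiff\<close> is differentiation, so the differential equation for F is the same recursion
  as for h > 0.\<close>

lemma frobenius_fps_rec:
  fixes A :: "complex \<Rightarrow> ('n::finite) malg"
  assumes A: "uexp {0} (\<lambda>_. A) (\<lambda>_. \<alpha>)"
    and F: "\<And>x. cmod x > R \<Longrightarrow> (\<lambda>s. sc (1 / x ^ s) * a s) sums F x"
    and G: "\<And>x. cmod x > R \<Longrightarrow> (\<lambda>s. sc (1 / x ^ s) * (- of_nat s * a s)) sums G x"
    and eq: "\<And>x. Re x > R \<Longrightarrow> G x = A x * F x - F x * fps_nth \<alpha> 0"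
  shows "fps_rec 0 \<alpha> (Abs_fps a)"
proof -
  have "uexp {0} (\<lambda>_. G) (\<lambda>_. Abs_fps (\<lambda>s. - of_nat s * a s))" by (rule uexp_power_series [OF G])
  moreover have "uexp {0} (\<lambda>_ x. A x * F x - F x * fps_nth \<alpha> 0) (\<lambda>_. \<alpha> * Abs_fps a - Abs_fps a * fps_const (fps_nth \<alpha> 0))"
    by (intro uexp_diff uexp_mult A uexp_power_series [OF F] uexp_const [OF order_refl])
  then have "uexp {0} (\<lambda>_. G) (\<lambda>_. \<alpha> * Abs_fps a - Abs_fps a * fps_const (fps_nth \<alpha> 0))"
    by (rule uexp_cong [where R = "R + 1"]) (use eq in auto)
  ultimately have e: "Abs_fps (\<lambda>s. - of_nat s * a s) = \<alpha> * Abs_fps a - Abs_fps a * fps_const (fps_nth \<alpha> 0)"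
    using uexp_unique by blast
  have comp: "fps_compose f (recip_fps 0) = f" for f :: "'n malg fps"
    using fps_compose_recip_fps [of f 0] by simp
  have "Qdiff (Abs_fps a) 0 = fps_X * Abs_fps (\<lambda>s. - of_nat s * a s)"
  proof (rule fps_ext)
    fix n
    show "fps_nth (Qdiff (Abs_fps a) 0) n = fps_nth (fps_X * Abs_fps (\<lambda>s. - of_nat s * a s)) n"
    proof (cases n)
      case 0
      then show ?thesis by (simp add: Qdiff_def)
    next
      case (Suc k)
      have qc: "fps_nth (qc j 0 :: 'n malg fps) n = (if j = k then - of_nat k else 0)" for j
        unfolding qc_0 using Suc by (simp add: fps_X_power_mult_right_nth del: power_Suc flip: fps_of_nat)
      have "fps_nth (Qdiff (Abs_fps a) 0) n = (\<Sum>j\<le>n. a j * (if j = k then - of_nat k else 0))"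
        by (simp add: Qdiff_def qc)
      also have "\<dots> = a k * - of_nat k"
        using Suc by (subst sum.mono_neutral_right [of _ "{k}"]) auto
      finally show ?thesis using Suc by (simp add: mult_of_nat_commute)
    qed
  qed
  then show ?thesis unfolding fps_rec_def comp e .
qed

text \<open>Both sides are holomorphic on the connected region and agree on a right half-plane,
  where the solution is given by its series.\<close>

lemma frobenius_solution_ode:
  fixes A :: "('n::finite) ratmat"
  assumes "frobenius_solution A M E" and x: "x \<in> Omega_plus A"
  shows "deriv (\<lambda>z. ent (alg_of (E z)) i j) x = ent (sc (1 / x) * (alg_of (ratm_eval A x) * alg_of (E x))) i j"
proof -
  have hol: "(\<lambda>z. ent (alg_of (E z)) i j) holomorphic_on Omega_plus A" for i j
    using assms by (simp add: frobenius_solution_def)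
  obtain R F where F: "frobenius_series A M R F" "\<And>x. Re x > R \<Longrightarrow> E x = F x ** cpow_mat x M"
    using assms unfolding frobenius_solution_def by blast
  obtain a G where der: "\<And>x i j. Re x > R \<Longrightarrow> ((\<lambda>z. ent (alg_of (F z ** cpow_mat z M)) i j) has_field_derivative
      ent (sc (1 / x) * (alg_of (ratm_eval A x) * alg_of (F x ** cpow_mat x M))) i j) (at x)"
    by (rule frobenius_series_ode [OF F(1)]) blast
  obtain X where X: "\<And>x. Re x > X \<Longrightarrow> x \<in> Omega_plus A" by (rule right_half_plane_Omega_plus [where A = A]) blast
  define U where "U = {x. Re x > max R X}"
  have "open U" unfolding U_def by (rule open_halfspace_Re_gt)
  have eqU: "deriv (\<lambda>z. ent (alg_of (E z)) i j) z = ent (sc (1 / z) * (alg_of (ratm_eval A z) * alg_of (E z))) i j" if "z \<in> U" for z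
  proof (rule DERIV_imp_deriv)
    have "((\<lambda>z. ent (alg_of (F z ** cpow_mat z M)) i j) has_field_derivative
      ent (sc (1 / z) * (alg_of (ratm_eval A z) * alg_of (E z))) i j) (at z)"
      using der [of z i j] that F(2) by (simp add: U_def)
    then show "((\<lambda>z. ent (alg_of (E z)) i j) has_field_derivative
      ent (sc (1 / z) * (alg_of (ratm_eval A z) * alg_of (E z))) i j) (at z)"
      by (rule has_field_derivative_transform_within_open [OF _ \<open>open U\<close> that]) (use F(2) in \<open>auto simp: U_def\<close>)
  qed
  define \<xi> where "\<xi> = complex_of_real (\<bar>R\<bar> + \<bar>X\<bar> + 1)"
  have "\<xi> \<in> U" by (auto simp: \<xi>_def U_def)
  have nz: "z \<noteq> 0" "z \<notin> ratm_poles A" if "z \<in> Omega_plus A" for z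
    using Omega_plus_not_pole [OF that] by auto
  have "deriv (\<lambda>z. ent (alg_of (E z)) i j) x - ent (sc (1 / x) * (alg_of (ratm_eval A x) * alg_of (E x))) i j = 0"
  proof (rule analytic_continuation [where S = "Omega_plus A" and U = U and \<xi> = \<xi> and
      f = "\<lambda>z. deriv (\<lambda>z. ent (alg_of (E z)) i j) z - ent (sc (1 / z) * (alg_of (ratm_eval A z) * alg_of (E z))) i j"])
    have "Omega_plus A \<inter> ratm_poles A = {}" using nz by blast
    then show "(\<lambda>z. deriv (\<lambda>z. ent (alg_of (E z)) i j) z - ent (sc (1 / z) * (alg_of (ratm_eval A z) * alg_of (E z))) i j) holomorphic_on Omega_plus A"
      unfolding ent_sc_mult unfolding ent_mult
      by (intro holomorphic_intros holomorphic_deriv hol open_Omega_plus ratm_eval_entry_holomorphic) (use nz in auto)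
    show "\<xi> islimpt U" using \<open>\<xi> \<in> U\<close> \<open>open U\<close> by (simp add: interior_limit_point interior_open)
  qed (use open_Omega_plus connected_Omega_plus X \<open>\<xi> \<in> U\<close> eqU x in \<open>auto simp: U_def\<close>)
  then show ?thesis by simp
qed

subsection \<open>Norms and limits of matrices\<close>

text \<open>Multiplying \<open>M\<close> by matrix units isolates an entry, so an algebra norm bounds the entries without an
  appeal to compactness.\<close>

lemma algebra_norm_bound:
  fixes N :: "('n::finite) cmat \<Rightarrow> real"
  assumes "algebra_norm N"
  obtains c where "c \<ge> 0" "\<And>M. norm (alg_of M) \<le> c * N M"
proof -
  have N0: "N M = 0 \<longleftrightarrow> M = 0" and Nc: "N (c *\<^sub>C M) = cmod c * N M"
    and Nt: "N (M + M') \<le> N M + N M'" and Nm: "N (M ** M') \<le> N M * N M'" for c M M'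
    using assms by (auto simp: algebra_norm_def)
  have nonneg: "N M \<ge> 0" for M
  proof -
    have "N ((-1) *\<^sub>C M) = N M" by (simp add: Nc)
    moreover have "M + (-1) *\<^sub>C M = 0" by (simp add: csmult_def vec_eq_iff)
    ultimately show ?thesis using Nt [of M "(-1) *\<^sub>C M"] N0 [of 0] by simp
  qed
  define U :: "'n \<Rightarrow> 'n \<Rightarrow> 'n cmat" where "U i j = (\<chi> k l. if k = i \<and> l = j then 1 else 0)" for i j
  have U: "N (U i j) > 0" for i j
  proof -
    have "U i j $ i $ j \<noteq> 0" by (simp add: U_def)
    then have "U i j \<noteq> 0" by auto
    then show ?thesis using N0 [of "U i j"] nonneg [of "U i j"] by simp
  qed
  have entry: "cmod (M $ i $ j) \<le> N (U i i) * N (U j j) / N (U i j) * N M" for M i j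
  proof -
    have 1: "(U i i ** M) $ k $ l = (if k = i then M $ i $ l else 0)" for k l
    proof -
      have "(U i i ** M) $ k $ l = (\<Sum>m\<in>UNIV. U i i $ k $ m * M $ m $ l)"
        by (simp add: matrix_matrix_mult_def)
      also have "\<dots> = (\<Sum>m\<in>UNIV. if m = i then (if k = i then M $ i $ l else 0) else 0)"
        by (intro sum.cong) (auto simp: U_def)
      finally show ?thesis by simp
    qed
    have "((U i i ** M) ** U j j) $ k $ l = (M $ i $ j *\<^sub>C U i j) $ k $ l" for k l
    proof -
      have "((U i i ** M) ** U j j) $ k $ l = (\<Sum>m\<in>UNIV. (U i i ** M) $ k $ m * U j j $ m $ l)"
        by (simp add: matrix_matrix_mult_def)
      also have "\<dots> = (\<Sum>m\<in>UNIV. if m = j then (if k = i \<and> l = j then M $ i $ j else 0) else 0)"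
        unfolding 1 by (intro sum.cong) (auto simp: U_def)
      finally show ?thesis by (simp add: csmult_def U_def)
    qed
    then have "(U i i ** M) ** U j j = M $ i $ j *\<^sub>C U i j" by (simp add: vec_eq_iff)
    then have "cmod (M $ i $ j) * N (U i j) = N ((U i i ** M) ** U j j)" by (simp add: Nc)
    also have "\<dots> \<le> N (U i i) * N M * N (U j j)"
      by (intro order.trans [OF Nm] mult_right_mono Nm nonneg)
    finally show ?thesis using U [of i j] by (simp add: pos_le_divide_eq mult_ac)
  qed
  show ?thesis
  proof (rule that [of "\<Sum>i\<in>UNIV. \<Sum>j\<in>UNIV. N (U i i) * N (U j j) / N (U i j)"])
    show "0 \<le> (\<Sum>i\<in>UNIV. \<Sum>j\<in>UNIV. N (U i i) * N (U j j) / N (U i j))"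
      by (intro sum_nonneg divide_nonneg_nonneg mult_nonneg_nonneg nonneg)
    fix M
    show "norm (alg_of M) \<le> (\<Sum>i\<in>UNIV. \<Sum>j\<in>UNIV. N (U i i) * N (U j j) / N (U i j)) * N M"
      unfolding sum_distrib_right
      by (rule order.trans [OF norm_le_sum_ent]) (intro sum_mono, simp only: ent_alg_of entry)
  qed
qed

lemma bounded_linear_alg_of: "bounded_linear (alg_of :: ('n::finite) cmat \<Rightarrow> 'n malg)"
proof (rule bounded_linear_intro)
  show "norm (alg_of M) \<le> norm M * real CARD('n) ^ 2" for M :: "'n cmat"
    using norm_malg_le [of "alg_of M"] by (simp add: alg_of_inverse mult.commute)
qed (simp_all add: alg_of_add scaleR_malg.abs_eq)

lemma bounded_linear_mat_of: "bounded_linear (mat_of :: ('n::finite) malg \<Rightarrow> 'n cmat)"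
proof (rule bounded_linear_intro)
  show "norm (mat_of m) \<le> norm m * real CARD('n) ^ 2" for m :: "'n malg"
    using norm_mat_of_le [of m] by (simp add: mult.commute)
qed (simp_all add: plus_malg.rep_eq scaleR_malg.rep_eq)

lemma uniform_limit_alg_of_iff:
  "uniform_limit K (\<lambda>h x. alg_of (f h x)) (\<lambda>x. alg_of (g x)) F \<longleftrightarrow> uniform_limit K f g F"
proof
  assume "uniform_limit K (\<lambda>h x. alg_of (f h x)) (\<lambda>x. alg_of (g x)) F"
  from bounded_linear.uniform_limit [OF bounded_linear_mat_of this] show "uniform_limit K f g F"
    by (simp add: alg_of_inverse)
qed (rule bounded_linear.uniform_limit [OF bounded_linear_alg_of])

lemma norm_power_diff_le:
  fixes X Y :: "'a::real_normed_algebra_1"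
  assumes "norm X \<le> r" "norm Y \<le> r"
  shows "norm (X ^ n - Y ^ n) \<le> real n * r ^ (n - 1) * norm (X - Y)"
proof (induction n)
  case (Suc n)
  have r: "r \<ge> 0" using assms(1) norm_ge_zero order.trans by blast
  have Yn: "norm (Y ^ n) \<le> r ^ n"
    using norm_power_ineq [of Y n] power_mono [OF assms(2), of n] by simp
  have "X ^ Suc n - Y ^ Suc n = X * (X ^ n - Y ^ n) + (X - Y) * Y ^ n" by (simp add: algebra_simps)
  also have "norm \<dots> \<le> r * (real n * r ^ (n - 1) * norm (X - Y)) + norm (X - Y) * r ^ n"
    using assms r Yn Suc by (intro norm_triangle_mono order.trans [OF norm_mult_ineq] mult_mono) auto
  also have "r * (real n * r ^ (n - 1) * norm (X - Y)) = real n * r ^ n * norm (X - Y)"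
    by (cases n) auto
  finally show ?case by (simp add: algebra_simps)
qed simp

text \<open>X and Y need not commute, so the powers are compared by telescoping, term by term in the
  series.\<close>

lemma norm_exp_diff_le:
  fixes X Y :: "'a::{real_normed_algebra_1,banach}"
  assumes "norm X \<le> r" "norm Y \<le> r"
  shows "norm (exp X - exp Y) \<le> exp r * norm (X - Y)"
proof -
  have sums: "(\<lambda>n. (X ^ n - Y ^ n) /\<^sub>R fact n) sums (exp X - exp Y)"
    using sums_diff [OF exp_converges exp_converges, of X Y] by (simp add: scaleR_right_diff_distrib)
  define g where "g n = real n * r ^ (n - 1) / fact n * norm (X - Y)" for n
  have "(\<lambda>n. g (Suc n)) = (\<lambda>n. r ^ n /\<^sub>R fact n * norm (X - Y))"
    by (auto simp: g_def fun_eq_iff divide_inverse fact_Suc simp del: of_nat_Suc)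
  then have "(\<lambda>n. g (Suc n)) sums (exp r * norm (X - Y))"
    using sums_mult2 [OF exp_converges [of r]] by simp
  then have g: "g sums (exp r * norm (X - Y))" by (subst (asm) sums_Suc_iff) (simp add: g_def)
  have "norm ((X ^ n - Y ^ n) /\<^sub>R fact n) \<le> g n" for n
    using norm_power_diff_le [OF assms, of n] by (simp add: g_def divide_inverse mult_ac mult_left_mono)
  then have "norm (\<Sum>n. (X ^ n - Y ^ n) /\<^sub>R fact n) \<le> (\<Sum>n. g n)"
    using g by (intro norm_suminf_le) (auto simp: sums_iff)
  then show ?thesis using sums g by (simp add: sums_iff)
qed

subsection \<open>Extension of the canonical solution by the functional equation\<close>

text \<open>A bounded function has no pole, and away from poles a nicely meromorphic function
  already has its removable singularities filled.\<close>

lemma nicely_meromorphic_bounded_imp_analytic: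
  assumes nm: "f nicely_meromorphic_on UNIV" and bd: "\<forall>\<^sub>F y in at x. cmod (f y) \<le> B"
  shows "f analytic_on {x}"
proof (rule nicely_meromorphic_on_imp_analytic_at [OF nm UNIV_I])
  show "\<not> is_pole f x"
  proof
    assume "is_pole f x"
    then have "\<forall>\<^sub>F y in at x. \<bar>B\<bar> + 1 \<le> cmod (f y)"
      unfolding is_pole_def by (auto simp: filterlim_at_infinity [of 0])
    with bd have "\<forall>\<^sub>F y in at x. False" by eventually_elim auto
    then show False by simp
  qed
qed

lemma nicely_meromorphic_eq_analytic:
  assumes nm: "f nicely_meromorphic_on UNIV" and g: "g analytic_on {x}" and eq: "\<forall>\<^sub>F y in at x. f y = g y"
  shows "f analytic_on {x}" "f x = g x"
proof -
  have "g \<midarrow>x\<rightarrow> g x" using analytic_at_imp_isCont [OF g] by (simp add: isCont_def)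
  then have lim: "f \<midarrow>x\<rightarrow> g x" by (rule Lim_transform_eventually) (use eq in eventually_elim, simp)
  show "f analytic_on {x}"
  proof (rule nicely_meromorphic_on_imp_analytic_at [OF nm UNIV_I])
    show "\<not> is_pole f x"
      using not_tendsto_and_filterlim_at_infinity [OF _ lim] unfolding is_pole_def by auto
  qed
  then have "f \<midarrow>x\<rightarrow> f x" using analytic_at_imp_isCont isCont_def by blast
  then show "f x = g x" using lim by (rule LIM_unique)
qed

lemma ratm_eval_entry_analytic:
  fixes A :: "('n::finite) ratmat"
  assumes "x \<notin> ratm_poles A"
  shows "(\<lambda>x. ent (alg_of (ratm_eval A x)) i j) analytic_on {x}"
proof -
  have "open (- ratm_poles A)" using finite_ratm_poles [of A] by (simp add: finite_imp_closed open_Compl)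
  moreover have "(\<lambda>x. ent (alg_of (ratm_eval A x)) i j) holomorphic_on - ratm_poles A"
    by (rule ratm_eval_entry_holomorphic) auto
  ultimately show ?thesis using assms by (meson ComplI analytic_on_holomorphic insert_subset empty_subsetI)
qed

text \<open>Solved for E(x), the equation has an analytic right-hand side \<open>g\<close> near x.
  It is known only off a sparse set, but agreement in a punctured neighbourhood suffices: the value
  of a nicely meromorphic function at x is then forced to be g(x).\<close>

lemma functional_extension_step:
  fixes A :: "('n::finite) ratmat" and E :: "complex \<Rightarrow> 'n cmat"
  assumes h: "h > 0" and nm: "\<And>i j. (\<lambda>x. E x $ i $ j) nicely_meromorphic_on UNIV"
    and de: "\<forall>\<^sub>\<approx>x. delta_minus h E x = ratm_eval A x ** E x"
    and an: "\<And>i j. (\<lambda>x. E x $ i $ j) analytic_on {x + of_real h}"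
    and x: "x \<noteq> 0" "x + of_real h \<notin> ratm_poles A"
  shows "(\<lambda>x. E x $ i $ j) analytic_on {x}"
    and "alg_of (E (x + of_real h)) - alg_of (E x) =
      sc (of_real h) * (sc (1 / x) * (alg_of (ratm_eval A (x + of_real h)) * alg_of (E (x + of_real h))))"
proof -
  define g where "g y = alg_of (E (y + of_real h)) -
    sc (of_real h) * (sc (1 / y) * (alg_of (ratm_eval A (y + of_real h)) * alg_of (E (y + of_real h))))" for y
  have shift: "(\<lambda>y. f (y + of_real h)) analytic_on {x}" if "f analytic_on {x + of_real h}" for f :: "complex \<Rightarrow> complex"
  proof -
    have "(\<lambda>y. y + of_real h) analytic_on {x}" by (intro analytic_intros)
    then show ?thesis
      using that analytic_on_compose [of "\<lambda>y. y + of_real h" "{x}" f] by (simp add: o_def)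
  qed
  have gan: "(\<lambda>y. ent (g y) i j) analytic_on {x}" for i j
    unfolding g_def ent_diff ent_sc_mult unfolding ent_mult
    by (intro analytic_intros shift ratm_eval_entry_analytic x) (use an x in auto)
  have "\<forall>\<^sub>F z in at (x + of_real h). delta_minus h E z = ratm_eval A z ** E z"
    by (rule eventually_cosparse_imp_eventually_at [OF de UNIV_I])
  then obtain d where d: "d > 0" "\<And>z. z \<noteq> x + of_real h \<Longrightarrow> dist z (x + of_real h) < d \<Longrightarrow> delta_minus h E z = ratm_eval A z ** E z"
    unfolding eventually_at by auto
  have ev: "\<forall>\<^sub>F y in at x. alg_of (E y) = g y"
    unfolding eventually_at
  \<comment> \<open>The radius \<open>cmod x\<close> keeps y away from 0, where the equation cannot
    be divided by y.\<close>
  proof (intro exI [of _ "min d (cmod x)"] conjI ballI impI)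
    show "min d (cmod x) > 0" using d x by simp
    fix y assume y: "y \<noteq> x \<and> dist y x < min d (cmod x)"
    then have y0: "y \<noteq> 0" by (auto simp: dist_norm)
    have "delta_minus h E (y + of_real h) = ratm_eval A (y + of_real h) ** E (y + of_real h)"
      using y by (intro d(2)) (auto simp: dist_norm)
    then have "sc (y / of_real h) * (alg_of (E (y + of_real h)) - alg_of (E y)) =
        alg_of (ratm_eval A (y + of_real h)) * alg_of (E (y + of_real h))"
      by (simp add: delta_minus_def alg_of_csmult [symmetric] alg_of_diff [symmetric] alg_of_mult [symmetric])
    then have "sc (of_real h) * (sc (1 / y) * (sc (y / of_real h) * (alg_of (E (y + of_real h)) - alg_of (E y)))) =
        sc (of_real h) * (sc (1 / y) * (alg_of (ratm_eval A (y + of_real h)) * alg_of (E (y + of_real h))))" by simp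
    moreover have "sc (of_real h) * (sc (1 / y) * (sc (y / of_real h) * X)) = X" for X :: "'n malg"
      using y0 h by (simp add: mult.assoc [symmetric] sc_mult [symmetric])
    ultimately show "alg_of (E y) = g y" by (simp add: g_def algebra_simps)
  qed
  have ev': "\<forall>\<^sub>F y in at x. E y $ i $ j = ent (g y) i j" for i j
    using ev by eventually_elim (metis ent_alg_of)
  show "(\<lambda>x. E x $ i $ j) analytic_on {x}"
    by (rule nicely_meromorphic_eq_analytic(1) [OF nm gan ev'])
  have "alg_of (E x) = g x"
    by (rule malg_eqI) (simp only: ent_alg_of nicely_meromorphic_eq_analytic(2) [OF nm gan ev'])
  then show "alg_of (E (x + of_real h)) - alg_of (E x) =
      sc (of_real h) * (sc (1 / x) * (alg_of (ratm_eval A (x + of_real h)) * alg_of (E (x + of_real h))))"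
    by (simp add: g_def)
qed

text \<open>S is stable under the shift by h, so finitely many steps lead from any of its points
  into the half-plane where analyticity is known; the induction runs back along them.\<close>

lemma functional_extension:
  fixes A :: "('n::finite) ratmat" and E :: "complex \<Rightarrow> 'n cmat"
  assumes h: "h > 0" and nm: "\<And>i j. (\<lambda>x. E x $ i $ j) nicely_meromorphic_on UNIV"
    and de: "\<forall>\<^sub>\<approx>x. delta_minus h E x = ratm_eval A x ** E x"
    and base: "\<And>x i j. Re x > R \<Longrightarrow> (\<lambda>x. E x $ i $ j) analytic_on {x}"
    and S: "\<And>x. x \<in> S \<Longrightarrow> x \<noteq> 0 \<and> x + of_real h \<in> S \<and> x + of_real h \<notin> ratm_poles A"
    and x: "x \<in> S"
  shows "(\<lambda>x. E x $ i $ j) analytic_on {x}"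
    and "alg_of (E (x + of_real h)) - alg_of (E x) =
      sc (of_real h) * (sc (1 / x) * (alg_of (ratm_eval A (x + of_real h)) * alg_of (E (x + of_real h))))"
proof -
  have an: "\<forall>i j. (\<lambda>x. E x $ i $ j) analytic_on {y}" if "y \<in> S" "Re y + real n * h > R" for y n
    using that
  proof (induction n arbitrary: y)
    case 0
    then show ?case using base by simp
  next
    case (Suc n)
    note Sy = S [OF Suc.prems(1)]
    have "\<forall>i j. (\<lambda>x. E x $ i $ j) analytic_on {y + of_real h}"
      using Suc.prems(2) Sy by (intro Suc.IH) (auto simp: algebra_simps)
    then show ?case using functional_extension_step(1) [OF h nm de, of y] Sy by blast
  qed
  have all: "(\<lambda>x. E x $ i $ j) analytic_on {y}" if y: "y \<in> S" for y i j
  proof -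
    obtain n where "real n * h > R - Re y" using ex_less_of_nat_mult [OF h] by blast
    then show ?thesis using an [OF y, of n] by auto
  qed
  show "(\<lambda>x. E x $ i $ j) analytic_on {x}" by (rule all [OF x])
  show "alg_of (E (x + of_real h)) - alg_of (E x) =
      sc (of_real h) * (sc (1 / x) * (alg_of (ratm_eval A (x + of_real h)) * alg_of (E (x + of_real h))))"
    by (rule functional_extension_step(2) [OF h nm de]) (use S [OF x] all in auto)
qed

lemma in_M_fact_expansion:
  fixes F :: "complex \<Rightarrow> ('n::finite) cmat"
  assumes "in_M_fact h F"
  obtains a R where "\<And>x. Re x > R \<Longrightarrow> (\<lambda>s. sc (1 / rising h s x) * a s) sums alg_of (F x)"
proof -
  have "\<forall>i j. \<exists>a R. \<forall>x. Re x > R \<longrightarrow> (\<lambda>s. a s / rising h s x) sums (F x $ i $ j)"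
    using assms unfolding in_M_fact_def in_O_fact_def by blast
  then obtain a R where aR: "\<And>i j x. Re x > R i j \<Longrightarrow> (\<lambda>s. a i j s / rising h s x) sums (F x $ i $ j)"
    by metis
  define R0 where "R0 = (\<Sum>i\<in>UNIV. \<Sum>j\<in>UNIV. \<bar>R i j\<bar>)"
  have R0: "R i j \<le> R0" for i j
  proof -
    have "R i j \<le> \<bar>R i j\<bar>" by simp
    also have "\<dots> \<le> (\<Sum>j\<in>UNIV. \<bar>R i j\<bar>)" by (intro member_le_sum) auto
    also have "\<dots> \<le> R0" unfolding R0_def
      by (intro member_le_sum [of i UNIV "\<lambda>i. \<Sum>j\<in>UNIV. \<bar>R i j\<bar>"]) (auto intro: sum_nonneg)
    finally show ?thesis .
  qed
  show ?thesis
  proof (rule that [of R0 "\<lambda>s. alg_of (\<chi> i j. a i j s)"])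
    fix x assume "Re x > R0"
    then have "(\<lambda>s. a i j s / rising h s x) sums (F x $ i $ j)" for i j
      using R0 [of i j] by (intro aR) simp
    then show "(\<lambda>s. sc (1 / rising h s x) * alg_of (\<chi> i j. a i j s)) sums alg_of (F x)"
      unfolding sums_malg_iff by simp
  qed
qed

text \<open>The definition controls F on a half-plane depending on h, whereas a common one is
  required. For Re x \<ge> 1 the matrix e is invertible, being the exponential times a matrix near
  1; so F is continued as E times the inverse of e, and the equation of E for Re x \<ge>
  \<open>R0\<close> becomes that of F. Far to the right F is bounded and e locally bounded, hence E
  has no poles there.\<close>

lemma canonical_solution_data:
  fixes A :: "('n::{finite,linorder}) ratmat" and E :: "complex \<Rightarrow> 'n cmat"
  assumes can: "canonical_solution h A M E" and h: "0 < h" "h \<le> 1" and J: "jordan_reduction M Q b c"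
    and asym: "\<And>x. Re x \<ge> 1 \<Longrightarrow> \<exists>K. alg_of (e_matrix h M x) = exp (sc (Ln x) * alg_of M) * K \<and> norm (K - 1) \<le> 1 / 2"
    and R0: "R0 \<ge> 1" and np: "\<And>x. Re x \<ge> R0 \<Longrightarrow> x \<notin> ratm_poles A"
    and A: "uexp {h} (\<lambda>_ x. alg_of (ratm_eval A x)) (\<lambda>_. \<alpha>)" and \<alpha>: "fps_nth \<alpha> 0 = alg_of M"
  obtains F \<phi> R where "uexp {h} (\<lambda>_. F) (\<lambda>_. \<phi>)" "fps_nth \<phi> 0 = 1" "fps_rec h \<alpha> \<phi>"
    "\<And>x. Re x \<ge> R0 \<Longrightarrow> alg_of (E x) = F x * alg_of (e_matrix h M x)"
    "\<And>x. Re x \<ge> R0 \<Longrightarrow> F (x + of_real h) - F x =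
      sc (of_real h) * (sc (1 / x) * (alg_of (ratm_eval A (x + of_real h)) * F (x + of_real h) - F x * alg_of M))"
    "\<And>x i j. Re x > R \<Longrightarrow> (\<lambda>x. E x $ i $ j) analytic_on {x}"
proof -
  have nm: "\<And>i j. (\<lambda>x. E x $ i $ j) nicely_meromorphic_on UNIV"
    and de: "\<forall>\<^sub>\<approx>x. delta_minus h E x = ratm_eval A x ** E x"
    using can by (auto simp: canonical_solution_def)
  obtain F R1 where F: "in_M_fact h F" "((\<lambda>t. F (of_real t)) \<longlongrightarrow> mat 1) at_top"
    "\<And>x. Re x > R1 \<Longrightarrow> E x = F x ** e_matrix h M x"
    using can unfolding canonical_solution_def in_GL_fact_def by blast
  obtain a R2 where aR: "\<And>x. Re x > R2 \<Longrightarrow> (\<lambda>s. sc (1 / rising h s x) * a s) sums alg_of (F x)"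
    by (rule in_M_fact_expansion [OF F(1)]) blast
  define \<phi> where "\<phi> = fact_fps h a"
  have uF: "uexp {h} (\<lambda>_ x. alg_of (F x)) (\<lambda>_. \<phi>)"
    using uexp_factorial_series_single [OF h aR] by (rule uexp_cong) (auto simp: \<phi>_def)
  define e where "e x = alg_of (e_matrix h M x)" for x
  have "\<exists>V. e x * V = 1 \<and> V * e x = 1" if x: "Re x \<ge> 1" for x
  proof -
    obtain K where K: "e x = exp (sc (Ln x) * alg_of M) * K" "norm (K - 1) \<le> 1 / 2"
      using asym [OF x] by (auto simp: e_def)
    have "norm (K - 1) < 1" using K(2) by simp
    then obtain K' where K': "K * K' = 1" "K' * K = 1" by (rule invertible_near_1)
    define G where "G = exp (sc (Ln x) * alg_of M)"
    define G' where "G' = exp (- (sc (Ln x) * alg_of M))"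
    have G: "G * G' = 1" "G' * G = 1"
      using exp_minus_inverse [of "sc (Ln x) * alg_of M"] exp_minus_inverse [of "- (sc (Ln x) * alg_of M)"]
      by (simp_all add: G_def G'_def)
    have "(G * K) * (K' * G') = G * (K * K') * G'" "(K' * G') * (G * K) = K' * (G' * G) * K"
      by (simp_all add: mult.assoc)
    then show ?thesis using G K' K(1) by (intro exI [of _ "K' * G'"]) (simp add: G_def)
  qed
  then obtain V where V: "\<And>x. Re x \<ge> 1 \<Longrightarrow> e x * V x = 1" "\<And>x. Re x \<ge> 1 \<Longrightarrow> V x * e x = 1" by metis
  define F' where "F' x = alg_of (E x) * V x" for x
  have EF: "alg_of (E x) = F' x * e x" if "Re x \<ge> 1" for x
    using V(2) [OF that] by (simp add: F'_def mult.assoc)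
  have F'F: "F' x = alg_of (F x)" if "Re x \<ge> max 1 (R1 + 1)" for x
  proof -
    have "alg_of (E x) = alg_of (F x) * e x" using F(3) [of x] that by (simp add: alg_of_mult e_def)
    then show ?thesis using V(1) [of x] that by (simp add: F'_def mult.assoc)
  qed
  have uF': "uexp {h} (\<lambda>_. F') (\<lambda>_. \<phi>)"
    using uF by (rule uexp_cong [where R = "max 1 (R1 + 1)"]) (use F'F in auto)
  have \<phi>0: "fps_nth \<phi> 0 = 1"
    by (rule uexp_limit [OF uF]) (use F(2) tendsto_alg_of_iff [of "\<lambda>t. F (of_real t)" "mat 1" at_top] in simp)
  obtain Kb Rb where Kb: "Kb \<ge> 0" "Rb \<ge> 1" "\<And>h' x. h' \<in> {h} \<Longrightarrow> Re x \<ge> Rb \<Longrightarrow> norm (F' x) \<le> Kb"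
    by (rule uexp_bounded [OF uF']) blast
  have base: "(\<lambda>x. E x $ i $ j) analytic_on {x}" if x: "Re x > Rb" for x i j
  proof (rule nicely_meromorphic_bounded_imp_analytic [OF nm])
    have xn: "x \<notin> \<real>\<^sub>\<le>\<^sub>0" using x Kb(2) by (auto simp: complex_nonpos_Reals_iff)
    have "isCont Ln x" by (rule continuous_at_Ln [OF xn])
    then have "((\<lambda>y. cmod (Ln y)) \<longlongrightarrow> cmod (Ln x)) (at x)" by (auto simp: isCont_def intro: tendsto_norm)
    then have "\<forall>\<^sub>F y in at x. cmod (Ln y) < cmod (Ln x) + 1" by (rule order_tendstoD) simp
    moreover have "\<forall>\<^sub>F y in at x. Re y > Rb"
      by (rule order_tendstoD(1) [OF _ x]) (intro tendsto_intros)
    ultimately show "\<forall>\<^sub>F y in at x. cmod (E y $ i $ j) \<le> Kb * (exp ((cmod (Ln x) + 1) * norm (alg_of M)) * 2)"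
    proof eventually_elim
      case (elim y)
      have y: "Re y \<ge> 1" using elim Kb(2) by simp
      obtain K where K: "e y = exp (sc (Ln y) * alg_of M) * K" "norm (K - 1) \<le> 1 / 2"
        using asym [OF y] by (auto simp: e_def)
      have "norm K \<le> 2" using K(2) norm_triangle_sub [of K 1] by simp
      moreover have "norm (exp (sc (Ln y) * alg_of M)) \<le> exp ((cmod (Ln x) + 1) * norm (alg_of M))"
        using elim by (intro order.trans [OF norm_exp]) (auto intro: mult_right_mono)
      ultimately have "norm (e y) \<le> exp ((cmod (Ln x) + 1) * norm (alg_of M)) * 2"
        unfolding K(1) by (intro order.trans [OF norm_mult_ineq] mult_mono) auto
      moreover have "norm (F' y) \<le> Kb" using Kb(3) [of h y] elim by simp
      ultimately have "norm (alg_of (E y)) \<le> Kb * (exp ((cmod (Ln x) + 1) * norm (alg_of M)) * 2)"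
        unfolding EF [OF y] using Kb(1) by (intro order.trans [OF norm_mult_ineq] mult_mono) auto
      then show ?case using norm_ent_le [of "alg_of (E y)" i j] by simp
    qed
  qed
  have eqE: "alg_of (E (x + of_real h)) - alg_of (E x) =
      sc (of_real h) * (sc (1 / x) * (alg_of (ratm_eval A (x + of_real h)) * alg_of (E (x + of_real h))))" if "Re x \<ge> R0" for x
    by (rule functional_extension(2) [OF h(1) nm de base, of Rb "{x. Re x \<ge> R0}"])
      (use that np h R0 in \<open>auto simp: complex_eq_iff\<close>)
  have eqF: "F' (x + of_real h) - F' x =
      sc (of_real h) * (sc (1 / x) * (alg_of (ratm_eval A (x + of_real h)) * F' (x + of_real h) - F' x * alg_of M))" if x: "Re x \<ge> R0" for x
  proof -
    have x1: "Re x \<ge> 1" "Re (x + of_real h) \<ge> 1" "Re x > 0" using x R0 h by auto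
    define x' where "x' = x + of_real h"
    define W where "W = alg_of (ratm_eval A x')"
    have e: "e x = (1 - sc (of_real h / x) * alg_of M) * e x'"
      unfolding e_def x'_def by (rule e_matrix_step [OF h(1) x1(3) J])
    have "F' x' * e x' - F' x * ((1 - sc (of_real h / x) * alg_of M) * e x') =
        sc (of_real h) * (sc (1 / x) * (W * (F' x' * e x')))"
      using eqE [OF x] EF [OF x1(1)] EF [OF x1(2)] e by (simp add: x'_def W_def)
    then have "(F' x' - F' x * (1 - sc (of_real h / x) * alg_of M)) * e x' * V x' =
        (sc (of_real h) * (sc (1 / x) * (W * F' x'))) * e x' * V x'"
      by (simp add: left_diff_distrib mult.assoc)
    then have 1: "F' x' - F' x * (1 - sc (of_real h / x) * alg_of M) = sc (of_real h) * (sc (1 / x) * (W * F' x'))"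
      using V(1) [of x'] x1(2) by (simp add: mult.assoc x'_def)
    have "F' x * (sc (of_real h / x) * alg_of M) = sc (of_real h) * (sc (1 / x) * (F' x * alg_of M))"
    proof -
      have "sc (of_real h / x) = sc (of_real h) * (sc (1 / x) :: 'n malg)" by (simp add: sc_mult [symmetric])
      moreover have "F' x * (sc (of_real h / x) * alg_of M) = sc (of_real h / x) * (F' x * alg_of M)"
        by (metis mult.assoc sc_commute)
      ultimately show ?thesis by (simp add: mult.assoc)
    qed
    then have "F' x' - F' x = sc (of_real h) * (sc (1 / x) * (W * F' x')) - sc (of_real h) * (sc (1 / x) * (F' x * alg_of M))"
      using 1 by (simp add: right_diff_distrib algebra_simps)
    then show ?thesis by (simp add: x'_def W_def right_diff_distrib)
  qed
  have "fps_rec h \<alpha> \<phi>"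
    by (rule fps_rec_of_equation [OF h uF' A, of R0]) (use eqF \<alpha> in simp)
  then show ?thesis
    using uF' \<phi>0 EF eqF base R0 by (intro that [of F' \<phi> Rb]) (auto simp: e_def)
qed

text \<open>Since Re x \<ge> 1, the quotient Re x / h exceeds any bound for small h, and the
  asymptotic factor tends to 1 uniformly. The exponentials converge by the Lipschitz estimate on
  bounded sets.\<close>

lemma e_matrix_uniform_limit:
  fixes M :: "real \<Rightarrow> ('n::{finite,linorder}) cmat"
  assumes K: "compact K" "K \<subseteq> {x. Re x \<ge> 1}"
    and J: "\<forall>\<^sub>F h in at_right 0. \<exists>Q b c. jordan_reduction (M h) Q b c"
    and lim: "((\<lambda>h. alg_of (M h)) \<longlongrightarrow> M0) (at_right 0)"
  shows "uniform_limit K (\<lambda>h x. alg_of (e_matrix h (M h) x)) (\<lambda>x. exp (sc (Ln x) * M0)) (at_right 0)"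
proof (rule uniform_limitI)
  fix \<epsilon> :: real assume \<epsilon>: "\<epsilon> > 0"
  define \<rho> where "\<rho> = norm M0 + 1"
  have \<rho>: "\<rho> > 0" by (simp add: \<rho>_def add_nonneg_pos)
  have "continuous_on K Ln" using K by (intro continuous_on_Ln) (auto simp: complex_nonpos_Reals_iff)
  then have "bounded (Ln ` K)" using K by (intro compact_imp_bounded compact_continuous_image)
  then obtain \<Lambda> where \<Lambda>: "\<Lambda> > 0" "\<And>x. x \<in> K \<Longrightarrow> cmod (Ln x) \<le> \<Lambda>" unfolding bounded_pos by auto
  define G where "G = exp (\<Lambda> * \<rho>)"
  have G: "G > 0" by (simp add: G_def)
  have e1: "\<epsilon> / (3 * G) > 0" using \<epsilon> G by simp
  obtain Y where Y: "Y > 0" "\<And>h x M Q b c. h > 0 \<Longrightarrow> Re x \<ge> Y * h \<Longrightarrow> jordan_reduction (M :: 'n cmat) Q b c \<Longrightarrow>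
    norm (alg_of M) \<le> \<rho> \<Longrightarrow>
    \<exists>K. alg_of (e_matrix h M x) = exp (sc (Ln x) * alg_of M) * K \<and> norm (K - 1) \<le> \<epsilon> / (3 * G)"
    by (rule e_matrix_asymp [OF \<rho> e1]) blast
  have "\<forall>\<^sub>F h in at_right (0::real). Y * h < 1 \<and> 0 < h"
    using Y(1) by (intro eventually_conj eventually_at_rightI [of 0 "1 / Y"]) (auto simp: eventually_at_right_less field_simps)
  moreover have "\<forall>\<^sub>F h in at_right 0. norm (alg_of (M h)) < \<rho>"
    using tendsto_norm [OF lim] by (rule order_tendstoD) (simp add: \<rho>_def)
  moreover have "\<forall>\<^sub>F h in at_right 0. dist (alg_of (M h)) M0 < \<epsilon> / (3 * G * \<Lambda>)"
    using lim \<epsilon> G \<Lambda> by (intro tendstoD) auto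
  ultimately show "\<forall>\<^sub>F h in at_right 0. \<forall>x\<in>K. dist (alg_of (e_matrix h (M h) x)) (exp (sc (Ln x) * M0)) < \<epsilon>"
    using J
  proof eventually_elim
    case (elim h)
    show ?case
    proof
      fix x assume x: "x \<in> K"
      obtain Q b c where "jordan_reduction (M h) Q b c" using elim by blast
      then obtain k where k: "alg_of (e_matrix h (M h) x) = exp (sc (Ln x) * alg_of (M h)) * k" "norm (k - 1) \<le> \<epsilon> / (3 * G)"
        using Y(2) [of h x "M h" Q b c] elim x K(2) by fastforce
      have n1: "norm (sc (Ln x) * alg_of (M h)) \<le> \<Lambda> * \<rho>"
        using \<Lambda>(2) [OF x] \<Lambda>(1) elim by (simp add: mult_mono)
      have n2: "norm (sc (Ln x) * M0) \<le> \<Lambda> * \<rho>"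
        using \<Lambda>(2) [OF x] \<Lambda>(1) by (simp add: \<rho>_def mult_mono)
      have "norm (exp (sc (Ln x) * alg_of (M h)) - exp (sc (Ln x) * M0)) \<le> G * norm (sc (Ln x) * alg_of (M h) - sc (Ln x) * M0)"
        unfolding G_def by (rule norm_exp_diff_le [OF n1 n2])
      also have "\<dots> = G * (cmod (Ln x) * norm (alg_of (M h) - M0))"
        by (simp flip: right_diff_distrib)
      also have "\<dots> \<le> G * (\<Lambda> * (\<epsilon> / (3 * G * \<Lambda>)))"
        using G \<Lambda>(1) \<Lambda>(2) [OF x] elim by (intro mult_left_mono mult_mono) (auto simp: dist_norm less_imp_le)
      also have "\<dots> = \<epsilon> / 3" using G \<Lambda>(1) by simp
      finally have 1: "norm (exp (sc (Ln x) * alg_of (M h)) - exp (sc (Ln x) * M0)) \<le> \<epsilon> / 3" .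
      have "norm (exp (sc (Ln x) * alg_of (M h))) \<le> G"
        unfolding G_def using n1 by (intro order.trans [OF norm_exp]) simp
      then have "norm (exp (sc (Ln x) * alg_of (M h)) * (k - 1)) \<le> G * (\<epsilon> / (3 * G))"
        using k(2) G by (intro order.trans [OF norm_mult_ineq] mult_mono) auto
      then have 2: "norm (exp (sc (Ln x) * alg_of (M h)) * (k - 1)) \<le> \<epsilon> / 3" using G by simp
      have "alg_of (e_matrix h (M h) x) - exp (sc (Ln x) * M0) =
          exp (sc (Ln x) * alg_of (M h)) * (k - 1) + (exp (sc (Ln x) * alg_of (M h)) - exp (sc (Ln x) * M0))"
        by (simp add: k(1) right_diff_distrib)
      also have "norm \<dots> \<le> \<epsilon> / 3 + \<epsilon> / 3" using 1 2 by (intro norm_triangle_mono)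
      finally show "dist (alg_of (e_matrix h (M h) x)) (exp (sc (Ln x) * M0)) < \<epsilon>"
        using \<epsilon> by (simp add: dist_norm)
    qed
  qed
qed

subsection \<open>Convergence of the canonical solutions\<close>

lemma eventually_greaterThanLessThan: "d > 0 \<Longrightarrow> \<forall>\<^sub>F h in at_right (0::real). h \<in> {0<..<d}"
  by (rule eventually_at_rightI [of 0 d]) auto

lemma right_half_plane_limit:
  fixes N :: "('n::{finite,linorder}) cmat \<Rightarrow> real"
    and h0 C l :: real
    and A :: "real \<Rightarrow> 'n ratmat"
    and A' :: "'n ratmat"
    and a :: "real \<Rightarrow> nat \<Rightarrow> 'n cmat"
    and a' :: "nat \<Rightarrow> 'n cmat"
    and E :: "real \<Rightarrow> complex \<Rightarrow> 'n cmat"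
    and E' :: "complex \<Rightarrow> 'n cmat"
  assumes N: "algebra_norm N" and h0: "h0 > 0"
    and expn: "\<And>h. h \<in> {0<..<h0} \<Longrightarrow> fact_expansion h (A h) (a h)"
    and C: "C \<ge> 0" and l: "l \<ge> 0" and type: "of_type_C_lambda N h0 a C l"
    and exp_inf: "expansion_at_infinity A' a'"
    and lim: "\<And>s. ((\<lambda>h. a h s) \<longlongrightarrow> a' s) (at_right 0)"
    and unf: "jordan_unfolding h0 (\<lambda>h. a h 0) (a' 0)"
    and nonres: "non_resonant (a' 0)"
    and unif: "\<And>K. compact K \<Longrightarrow> K \<inter> ratm_poles A' = {} \<Longrightarrow>
           uniform_limit K (\<lambda>h. ratm_eval (A h)) (ratm_eval A') (at_right 0)"
    and can: "\<forall>\<^sub>F h in at_right 0. canonical_solution h (A h) (a h 0) (E h)"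
    and frob: "frobenius_solution A' (a' 0) E'"
  obtains R where "R \<ge> 1"
    "\<And>K. compact K \<Longrightarrow> K \<subseteq> {x. Re x \<ge> R} \<Longrightarrow> uniform_limit K (\<lambda>h x. alg_of (E h x)) (\<lambda>x. alg_of (E' x)) (at_right 0)"
    "\<forall>\<^sub>F h in at_right 0. \<forall>x. Re x \<ge> R \<longrightarrow> x \<notin> ratm_poles (A h)"
    "\<forall>\<^sub>F h in at_right 0. \<exists>Rb. \<forall>x i j. Re x > Rb \<longrightarrow> (\<lambda>x. E h x $ i $ j) analytic_on {x}"
proof -

  \<comment> \<open>Constants and the range of h\<close>
  define ah where "ah h s = alg_of (a h s)" for h s
  define Ah where "Ah h x = alg_of (ratm_eval (A h) x)" for h x
  define A0 where "A0 x = alg_of (ratm_eval A' x)" for x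
  define M0 where "M0 = alg_of (a' 0)"
  obtain c where c: "c \<ge> 0" "\<And>M. norm (alg_of M) \<le> c * N M"
    by (rule algebra_norm_bound [OF N]) blast
  obtain h1 where h1: "h1 \<in> {0<..<h0}" "\<And>h s. h \<in> {0<..<h1} \<Longrightarrow> s \<ge> 1 \<Longrightarrow> N (a h s) \<le> C * rising h (s - 1) l"
    using type unfolding of_type_C_lambda_def by blast
  obtain B where B: "\<And>h. h \<in> {0<..<h0} \<Longrightarrow> N (a h 0) \<le> B"
    using type unfolding of_type_C_lambda_def by blast
  have bd: "norm (ah h s) \<le> c * C * rising h (s - 1) l" if "h \<in> {0<..<h1}" "s \<ge> 1" for h s
    using order.trans [OF c(2) mult_left_mono [OF h1(2) [OF that] c(1)]] by (simp add: ah_def mult.assoc)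
  have bd0: "norm (ah h 0) \<le> c * B" if "h \<in> {0<..<h0}" for h
    using order.trans [OF c(2) mult_left_mono [OF B [OF that] c(1)]] by (simp add: ah_def)
  have cC: "c * C \<ge> 0" using c C by simp
  define \<rho> where "\<rho> = \<bar>c * B\<bar> + 1"
  have \<rho>: "\<rho> > 0" by (simp add: \<rho>_def)
  obtain Y where Y: "Y > 0" "\<And>h x M Q b c. h > 0 \<Longrightarrow> Re x \<ge> Y * h \<Longrightarrow> jordan_reduction (M :: 'n cmat) Q b c \<Longrightarrow>
    norm (alg_of M) \<le> \<rho> \<Longrightarrow>
    \<exists>K. alg_of (e_matrix h M x) = exp (sc (Ln x) * alg_of M) * K \<and> norm (K - 1) \<le> 1 / 2"
    by (rule e_matrix_asymp [OF \<rho>, of "1 / 2"]) auto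
  obtain h3 where h3: "h3 > 0" "\<And>h. 0 < h \<Longrightarrow> h < h3 \<Longrightarrow> canonical_solution h (A h) (a h 0) (E h)"
    using can unfolding eventually_at_right_field by blast
  obtain Qt bt ct where Jt: "jordan_reduction (a' 0) Qt bt ct"
    using unf unfolding jordan_unfolding_def by blast
  have Jh: "\<exists>Q b c. jordan_reduction (a h 0) Q b c" if "h \<in> {0<..<h0}" for h
    using unf that unfolding jordan_unfolding_def by blast
  \<comment> \<open>\<open>h1\<close> is for the type condition, 1 for the uniform expansions,
    \<open>h3\<close> for the existence of the canonical solution, and 1/Y ensures Y h \<le> 1 \<le>
    Re x in the asymptotics of e.\<close>
  define h2 where "h2 = Min {h1, 1, h3, 1 / Y}"
  have h2: "h2 > 0" "h2 \<le> h1" "h2 \<le> 1" "h2 \<le> h3" "h2 \<le> 1 / Y"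
    using h1 h3 Y by (auto simp: h2_def)
  define H where "H = {0<..<h2}"
  have H: "H \<subseteq> {0<..1}" "H \<subseteq> {0<..<h1}" "H \<subseteq> {0<..<h0}" "\<And>h. h \<in> H \<Longrightarrow> 0 < h \<and> h < h3 \<and> Y * h \<le> 1"
  proof -
    show "H \<subseteq> {0<..1}" "H \<subseteq> {0<..<h1}" "H \<subseteq> {0<..<h0}" using h2 h1 by (auto simp: H_def)
    fix h assume h: "h \<in> H"
    have "h \<le> 1 / Y" using h h2 by (simp add: H_def)
    then have "Y * h \<le> 1" using Y(1) by (simp add: pos_le_divide_eq mult.commute)
    then show "0 < h \<and> h < h3 \<and> Y * h \<le> 1" using h h2 by (simp add: H_def)
  qed
  have evH: "\<forall>\<^sub>F h in at_right 0. h \<in> H" unfolding H_def by (rule eventually_greaterThanLessThan [OF h2(1)])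
  have half: "x \<notin> ratm_poles (A h)" "(\<lambda>s. sc (1 / rising h s x) * ah h s) sums Ah h x" if "h \<in> H" "Re x > l" for h x
  proof -
    have "h \<in> {0<..<h0}" "h \<in> {0<..<h1}" using that H by blast+
    then have "fact_expansion h (A h) (a h)" "h > 0" "\<And>s. s \<ge> 1 \<Longrightarrow> norm (alg_of (a h s)) \<le> c * C * rising h (s - 1) l"
      using expn bd by (auto simp: ah_def)
    from fact_expansion_half_plane [OF this(1,2) l cC this(3) that(2)]
    show "x \<notin> ratm_poles (A h)" "(\<lambda>s. sc (1 / rising h s x) * ah h s) sums Ah h x"
      by (simp_all add: ah_def Ah_def)
  qed

  \<comment> \<open>Expansion of the coefficients and the factors F for each h\<close>
  define \<alpha> where "\<alpha> h = fact_fps h (ah h)" for h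
  have \<alpha>0: "fps_nth (\<alpha> h) 0 = ah h 0" for h by (simp add: \<alpha>_def fact_fps_nth_0)
  have uA: "uexp H Ah \<alpha>"
    unfolding \<alpha>_def
    by (rule uexp_factorial_series [OF H(1) l cC, where B = "c * B" and R = l]) (use bd bd0 half H in auto)
  \<comment> \<open>All data attached to one h, bundled so that they can be chosen simultaneously as
    functions of h.\<close>
  define P where "P h F \<phi> R \<longleftrightarrow> uexp {h} (\<lambda>_. F) (\<lambda>_. \<phi>) \<and> fps_nth \<phi> 0 = 1 \<and> fps_rec h (\<alpha> h) \<phi> \<and>
    (\<forall>x. Re x \<ge> l + 1 \<longrightarrow> alg_of (E h x) = F x * alg_of (e_matrix h (a h 0) x)) \<and>
    (\<forall>x. Re x \<ge> l + 1 \<longrightarrow> F (x + of_real h) - F x =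
      sc (of_real h) * (sc (1 / x) * (Ah h (x + of_real h) * F (x + of_real h) - F x * ah h 0))) \<and>
    (\<forall>x i j. Re x > R \<longrightarrow> (\<lambda>x. E h x $ i $ j) analytic_on {x})" for h F \<phi> R
  have "\<exists>F \<phi> R. P h F \<phi> R" if h: "h \<in> H" for h
  proof -
    have hh: "0 < h" "h \<le> 1" "h \<in> {0<..<h0}" using h H by auto
    obtain Q b d where J: "jordan_reduction (a h 0) Q b d" using Jh [OF hh(3)] by blast
    have asym: "\<exists>K. alg_of (e_matrix h (a h 0) x) = exp (sc (Ln x) * alg_of (a h 0)) * K \<and> norm (K - 1) \<le> 1 / 2"
      if "Re x \<ge> 1" for x
    proof (rule Y(2) [OF hh(1) _ J])
      show "Y * h \<le> Re x" using that H(4) [OF h] by linarith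
      show "norm (alg_of (a h 0)) \<le> \<rho>" using bd0 [OF hh(3)] by (simp add: ah_def \<rho>_def)
    qed
    have uAh: "uexp {h} (\<lambda>_ x. alg_of (ratm_eval (A h) x)) (\<lambda>_. \<alpha> h)"
    proof (rule uexp_cong)
      show "uexp {h} Ah \<alpha>" by (rule uexp_subset [OF uA]) (use h in simp)
    qed (simp_all add: Ah_def)
    have can': "canonical_solution h (A h) (a h 0) (E h)" using h3(2) H(4) [OF h] by blast
    have l1: "l + 1 \<ge> 1" using l by simp
    have np: "x \<notin> ratm_poles (A h)" if "Re x \<ge> l + 1" for x using half(1) [OF h, of x] that by simp
    have \<alpha>h: "fps_nth (\<alpha> h) 0 = alg_of (a h 0)" by (simp add: \<alpha>0 ah_def)
    obtain F \<phi> R where d: "uexp {h} (\<lambda>_. F) (\<lambda>_. \<phi>)" "fps_nth \<phi> 0 = 1" "fps_rec h (\<alpha> h) \<phi>"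
      "\<And>x. Re x \<ge> l + 1 \<Longrightarrow> alg_of (E h x) = F x * alg_of (e_matrix h (a h 0) x)"
      "\<And>x. Re x \<ge> l + 1 \<Longrightarrow> F (x + of_real h) - F x =
        sc (of_real h) * (sc (1 / x) * (alg_of (ratm_eval (A h) (x + of_real h)) * F (x + of_real h) - F x * alg_of (a h 0)))"
      "\<And>x i j. Re x > R \<Longrightarrow> (\<lambda>x. E h x $ i $ j) analytic_on {x}"
      by (rule canonical_solution_data [OF can' hh(1,2) J asym l1 np uAh \<alpha>h]; (assumption | (rule that; assumption)))
    have "P h F \<phi> R"
      unfolding P_def Ah_def ah_def by (intro conjI allI impI d)
    then show ?thesis by blast
  qed
  then obtain F \<phi> Rb where P: "\<And>h. h \<in> H \<Longrightarrow> P h (F h) (\<phi> h) (Rb h)" by metis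
  have uF: "uexp {h} (\<lambda>_. F h) (\<lambda>_. \<phi> h)" and \<phi>1: "fps_nth (\<phi> h) 0 = 1" and rec: "fps_rec h (\<alpha> h) (\<phi> h)"
    and EF: "Re x \<ge> l + 1 \<Longrightarrow> alg_of (E h x) = F h x * alg_of (e_matrix h (a h 0) x)"
    and eqF: "Re x \<ge> l + 1 \<Longrightarrow> F h (x + of_real h) - F h x =
      sc (of_real h) * (sc (1 / x) * (Ah h (x + of_real h) * F h (x + of_real h) - F h x * ah h 0))"
    and an: "Re x > Rb h \<Longrightarrow> (\<lambda>x. E h x $ i $ j) analytic_on {x}" if "h \<in> H" for h x i j
    using P [OF that] unfolding P_def by blast+

  \<comment> \<open>The limit system and convergence of the coefficients of F\<close>
  have limM: "((\<lambda>h. ah h 0) \<longlongrightarrow> M0) (at_right 0)"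
    unfolding ah_def M0_def by (intro bounded_linear.tendsto [OF bounded_linear_alg_of] lim)
  define \<alpha>' where "\<alpha>' = Abs_fps (\<lambda>s. alg_of (a' s))"
  have ct\<alpha>: "ctend \<alpha> \<alpha>'"
    unfolding \<alpha>_def \<alpha>'_def ah_def by (intro ctend_fact_fps bounded_linear.tendsto [OF bounded_linear_alg_of] lim)
  obtain RE where RE: "\<And>x. cmod x > RE \<Longrightarrow> (\<lambda>s. (1 / x ^ s) *\<^sub>C a' s) sums ratm_eval A' x"
    using exp_inf unfolding expansion_at_infinity_def by blast
  have uA0: "uexp {0} (\<lambda>_. A0) (\<lambda>_. \<alpha>')"
    unfolding \<alpha>'_def
  proof (rule uexp_power_series)
    fix x assume "cmod x > RE"
    then show "(\<lambda>s. sc (1 / x ^ s) * alg_of (a' s)) sums A0 x"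
      using RE by (simp add: A0_def alg_of_csmult [symmetric] sums_alg_of_iff)
  qed
  obtain RF Fs where RF: "frobenius_series A' (a' 0) RF Fs" "\<And>x. Re x > RF \<Longrightarrow> E' x = Fs x ** cpow_mat x (a' 0)"
    using frob unfolding frobenius_solution_def by blast
  define F0 where "F0 x = alg_of (Fs x)" for x
  obtain af G where af: "af 0 = mat 1" "\<And>x. cmod x > RF \<Longrightarrow> (\<lambda>s. sc (1 / x ^ s) * alg_of (af s)) sums alg_of (Fs x)"
    "\<And>x. cmod x > RF \<Longrightarrow> (\<lambda>s. sc (1 / x ^ s) * (- of_nat s * alg_of (af s))) sums G x"
    "\<And>x i j. cmod x > RF \<Longrightarrow> ((\<lambda>x. ent (alg_of (Fs x)) i j) has_field_derivative ent (sc (1 / x) * G x) i j) (at x)"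
    "\<And>x. Re x > RF \<Longrightarrow> G x = alg_of (ratm_eval A' x) * alg_of (Fs x) - alg_of (Fs x) * alg_of (a' 0)"
    by (rule frobenius_series_ode [OF RF(1)]) blast
  define \<phi>' where "\<phi>' = Abs_fps (\<lambda>s. alg_of (af s))"
  have \<alpha>'0: "fps_nth \<alpha>' 0 = M0" by (simp add: \<alpha>'_def M0_def)
  have uF0: "uexp {0} (\<lambda>_. F0) (\<lambda>_. \<phi>')"
    unfolding \<phi>'_def F0_def by (rule uexp_power_series [OF af(2)])
  have rec0: "fps_rec 0 \<alpha>' \<phi>'"
    unfolding \<phi>'_def
    by (rule frobenius_fps_rec [OF uA0 af(2,3)]) (use af(5) \<alpha>'0 in \<open>auto simp: A0_def M0_def\<close>)
  have ct\<phi>: "ctend \<phi> \<phi>'"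
  proof (rule fps_rec_tendsto [OF ct\<alpha> _ rec0])
    show "\<forall>\<^sub>F h in at_right 0. fps_rec h (\<alpha> h) (\<phi> h)" using evH by eventually_elim (rule rec)
    show "\<forall>\<^sub>F h in at_right 0. fps_nth (\<phi> h) 0 = fps_nth \<phi>' 0"
      using evH by eventually_elim (simp add: \<phi>1 \<phi>'_def af(1))
    show "\<exists>\<kappa>>0. \<forall>Y. \<kappa> * norm Y \<le> norm (- (of_nat s * Y) - fps_nth \<alpha>' 0 * Y + Y * fps_nth \<alpha>' 0)" if "s \<ge> 1" for s
      unfolding \<alpha>'0 M0_def by (rule sylvester_bounded_below [OF Jt nonres that])
  qed

  \<comment> \<open>Uniform truncation error\<close>
  have "\<exists>b. \<forall>m\<ge>b. \<forall>H'\<subseteq>H. (\<forall>s\<le>m. \<exists>B. \<forall>h\<in>H'. norm (fps_nth (\<phi> h) s) \<le> B) \<longrightarrow>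
      (\<exists>K R. \<forall>h\<in>H'. \<forall>x. Re x \<ge> R \<longrightarrow> norm (F h x - trunc m (\<phi> h) x) \<le> K / Re x ^ (m + 1))"
    by (rule truncation_error [OF H(1) uA, where ?R0.0 = "l + 1"]) (simp_all add: uF rec eqF \<alpha>0)
  then obtain b where b: "\<forall>m\<ge>b. \<forall>H'\<subseteq>H. (\<forall>s\<le>m. \<exists>B. \<forall>h\<in>H'. norm (fps_nth (\<phi> h) s) \<le> B) \<longrightarrow>
      (\<exists>K R. \<forall>h\<in>H'. \<forall>x. Re x \<ge> R \<longrightarrow> norm (F h x - trunc m (\<phi> h) x) \<le> K / Re x ^ (m + 1))" ..
  have trunc: "\<exists>K R. \<forall>\<^sub>F h in at_right 0. \<forall>x. Re x \<ge> R \<longrightarrow>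
      norm (F h x - trunc m (\<phi> h) x) \<le> K / Re x ^ (m + 1)" if m: "m \<ge> b" for m
  proof -
    have "\<forall>\<^sub>F h in at_right 0. norm (fps_nth (\<phi> h) s) < norm (fps_nth \<phi>' s) + 1" for s
      using ct\<phi> unfolding ctend_def by (intro order_tendstoD(2) [OF tendsto_norm]) auto
    then have "\<forall>\<^sub>F h in at_right 0. \<forall>s\<in>{..m}. norm (fps_nth (\<phi> h) s) < norm (fps_nth \<phi>' s) + 1"
      by (intro eventually_ball_finite) auto
    then obtain h5 where h5: "h5 > 0" "\<And>h. 0 < h \<Longrightarrow> h < h5 \<Longrightarrow> \<forall>s\<in>{..m}. norm (fps_nth (\<phi> h) s) < norm (fps_nth \<phi>' s) + 1"
      unfolding eventually_at_right_field by blast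
    \<comment> \<open>Convergence of the coefficients bounds those of index at most m, but only
      below a threshold depending on m.\<close>
    define H' where "H' = H \<inter> {0<..<h5}"
    have bdd: "\<forall>s\<le>m. \<exists>B. \<forall>h\<in>H'. norm (fps_nth (\<phi> h) s) \<le> B"
    proof (intro allI impI)
      fix s assume s: "s \<le> m"
      have "norm (fps_nth (\<phi> h) s) \<le> norm (fps_nth \<phi>' s) + 1" if "h \<in> H'" for h
        using h5(2) [of h] that s by (auto simp: H'_def less_imp_le)
      then show "\<exists>B. \<forall>h\<in>H'. norm (fps_nth (\<phi> h) s) \<le> B" by blast
    qed
    have "H' \<subseteq> H" by (simp add: H'_def)
    from b [THEN spec, THEN mp, OF m, THEN spec, THEN mp, OF this, THEN mp, OF bdd]
    obtain K R where KR: "\<forall>h\<in>H'. \<forall>x. Re x \<ge> R \<longrightarrow>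
        norm (F h x - trunc m (\<phi> h) x) \<le> K / Re x ^ (m + 1)"
      by (elim exE)
    have "\<forall>\<^sub>F h in at_right 0. h \<in> H'"
      using evH eventually_greaterThanLessThan [OF h5(1)] by eventually_elim (simp add: H'_def)
    then have "\<forall>\<^sub>F h in at_right 0. \<forall>x. Re x \<ge> R \<longrightarrow>
        norm (F h x - trunc m (\<phi> h) x) \<le> K / Re x ^ (m + 1)"
      by (rule eventually_mono) (rule bspec [OF KR])
    then show ?thesis by (intro exI)
  qed

  \<comment> \<open>Convergence of F and of E on a common half-plane\<close>
  obtain GA RA where GA: "GA \<ge> 0" "RA \<ge> 1" "\<And>h x. h \<in> H \<Longrightarrow> Re x \<ge> RA \<Longrightarrow> norm (Ah h x) \<le> GA"
    by (rule uexp_bounded [OF uA]) blast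
  obtain X0 where X0: "\<And>x. Re x > X0 \<Longrightarrow> x \<in> Omega_plus A'" by (rule right_half_plane_Omega_plus [where A = A']) blast
  \<comment> \<open>To the right of this, factorial series, the bound on the coefficients, the
    Frobenius series and the absence of poles of the limit are all available. The extra 1 leaves
    room for the open set \<open>U\<close> around the closed half-plane.\<close>
  define R1 where "R1 = Max {l + 1, RA, RF + 1, X0 + 1, 1}"
  have R1: "R1 \<ge> l + 1" "R1 \<ge> RA" "R1 \<ge> RF + 1" "R1 \<ge> X0 + 1" "R1 \<ge> 1" by (auto simp: R1_def)
  define g where "g = max GA (c * B)"
  have g: "g \<ge> 0" "g \<ge> GA" "g \<ge> c * B" using GA by (auto simp: g_def)
  define U where "U = {x. Re x > R1 - 1}"
  have U: "open U" "0 \<notin> U" "U \<inter> ratm_poles A' = {}" "\<And>x. x \<in> U \<Longrightarrow> cmod x > RF \<and> Re x > RF"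
  proof -
    show "open U" unfolding U_def by (rule open_halfspace_Re_gt)
    show "0 \<notin> U" using R1 by (simp add: U_def)
    have "x \<notin> ratm_poles A'" if "x \<in> U" for x
    proof -
      have "Re x > X0" using that R1(4) by (simp add: U_def)
      then show ?thesis using Omega_plus_not_pole [OF X0] by blast
    qed
    then show "U \<inter> ratm_poles A' = {}" by blast
    show "cmod x > RF \<and> Re x > RF" if "x \<in> U" for x
      using that R1 complex_Re_le_cmod [of x] by (simp add: U_def)
  qed
  have F0hol: "(\<lambda>z. ent (F0 z) i j) holomorphic_on U" for i j
    unfolding F0_def holomorphic_on_open [OF U(1)]
  proof
    fix x assume "x \<in> U"
    then have "cmod x > RF" using U(4) by blast
    from af(4) [OF this] show "\<exists>f'. ((\<lambda>z. ent (alg_of (Fs z)) i j) has_field_derivative f') (at x)" by blast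
  qed
  have F0ode: "deriv (\<lambda>z. ent (F0 z) i j) x = ent (sc (1 / x) * (A0 x * F0 x - F0 x * M0)) i j" if "x \<in> U" for x i j
    using DERIV_imp_deriv [OF af(4)] af(5) U(4) [OF that] by (simp add: F0_def A0_def M0_def)
  have A0c: "continuous_on U A0"
    unfolding continuous_on_malg_iff A0_def
    using ratm_eval_entry_holomorphic [OF U(3)] holomorphic_on_imp_continuous_on by blast
  have Aunif: "uniform_limit L Ah A0 (at_right 0)" if "compact L" "L \<subseteq> U" for L
    unfolding Ah_def A0_def uniform_limit_alg_of_iff using that U(3) by (intro unif) auto
  \<comment> \<open>The bound 2 g is what allows the implicit step to be solved for all h \<le>
    1.\<close>
  define R2 where "R2 = max R1 (2 * g)"
  have convF: "uniform_limit K F F0 (at_right 0)" if K: "compact K" "K \<subseteq> {x. Re x \<ge> R2}" for K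
  proof (rule half_plane_convergence [where A = Ah and B = "\<lambda>h. ah h 0" and R = R1 and a = g and \<phi> = \<phi> and ?\<phi>0.0 = \<phi>'])
    show "\<forall>\<^sub>F h in at_right 0. (\<forall>x. R1 \<le> Re x \<longrightarrow> norm (Ah h x) \<le> g) \<and> norm (ah h 0) \<le> g"
      using evH
    proof eventually_elim
      case (elim h)
      have "norm (Ah h x) \<le> g" if "Re x \<ge> R1" for x
        using GA(3) [OF elim, of x] that R1(2) g(2) by linarith
      moreover have "norm (ah h 0) \<le> g" using bd0 [of h] elim H(3) g(3) by fastforce
      ultimately show ?case by blast
    qed
    show "\<forall>\<^sub>F h in at_right 0. \<forall>x. R1 \<le> Re x \<longrightarrow> F h (x + of_real h) - F h x =
        sc (of_real h) * (sc (1 / x) * (Ah h (x + of_real h) * F h (x + of_real h) - F h x * ah h 0))"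
      using evH by eventually_elim (use eqF R1(1) in auto)
    show "\<exists>b. \<forall>m\<ge>b. \<exists>K R. \<forall>\<^sub>F h in at_right 0. \<forall>x. R \<le> Re x \<longrightarrow>
        norm (F h x - trunc m (\<phi> h) x) \<le> K / Re x ^ (m + 1)"
      using trunc by blast
    fix K :: "complex set" and \<epsilon> :: real
    assume K: "compact K" "K \<subseteq> {x. R1 \<le> Re x}" and \<epsilon>: "\<epsilon> > 0"
    have KU: "K \<subseteq> U" using K(2) by (auto simp: U_def)
    show "\<forall>\<^sub>F h in at_right 0. \<forall>x\<in>K. norm (F0 (x + of_real h) - F0 x -
        sc (of_real h) * (sc (1 / x) * (Ah h (x + of_real h) * F0 (x + of_real h) - F0 x * ah h 0))) \<le> \<epsilon> * h"
      by (rule scheme_consistent [OF U(1,2) K(1) KU F0hol F0ode A0c Aunif limM \<epsilon>])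
  qed (use R1 g ct\<phi> uF0 K in \<open>auto simp: R2_def\<close>)
  have convE: "uniform_limit K (\<lambda>h x. alg_of (E h x)) (\<lambda>x. alg_of (E' x)) (at_right 0)"
    if K: "compact K" "K \<subseteq> {x. Re x \<ge> R2}" for K
  proof -
    have KU: "K \<subseteq> U" using K(2) by (auto simp: U_def R2_def)
    have K1: "K \<subseteq> {x. Re x \<ge> 1}" using K(2) R1 by (auto simp: R2_def)
    have "\<forall>\<^sub>F h in at_right 0. \<exists>Q b c. jordan_reduction (a h 0) Q b c"
      using evH by eventually_elim (use Jh H(3) in blast)
    then have conve: "uniform_limit K (\<lambda>h x. alg_of (e_matrix h (a h 0) x)) (\<lambda>x. exp (sc (Ln x) * M0)) (at_right 0)"
      using limM unfolding ah_def by (rule e_matrix_uniform_limit [OF K(1) K1])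
    have "continuous_on K F0"
      unfolding continuous_on_malg_iff using F0hol KU holomorphic_on_imp_continuous_on continuous_on_subset by blast
    then have bF: "bounded (F0 ` K)" using K by (intro compact_imp_bounded compact_continuous_image)
    have "continuous_on K (\<lambda>x. exp (sc (Ln x) * M0))"
      unfolding continuous_on_malg_iff
    proof (intro allI continuous_at_imp_continuous_on ballI)
      fix i j x assume "x \<in> K"
      then have "x \<notin> \<real>\<^sub>\<le>\<^sub>0" using K1 by (auto simp: complex_nonpos_Reals_iff)
      then show "isCont (\<lambda>x. ent (exp (sc (Ln x) * M0)) i j) x"
        by (intro DERIV_isCont [OF ent_exp_Ln_has_derivative])
    qed
    then have be: "bounded ((\<lambda>x. exp (sc (Ln x) * M0)) ` K)"
      using K by (intro compact_imp_bounded compact_continuous_image)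
    have lim: "uniform_limit K (\<lambda>h x. F h x * alg_of (e_matrix h (a h 0) x)) (\<lambda>x. F0 x * exp (sc (Ln x) * M0)) (at_right 0)"
      by (rule bounded_bilinear.bounded_uniform_limit [OF bounded_bilinear_mult convF [OF K] conve be bF])
    have E': "F0 x * exp (sc (Ln x) * M0) = alg_of (E' x)" if "x \<in> K" for x
    proof -
      have "Re x > RF" using U(4) KU that by blast
      then show ?thesis by (simp add: RF(2) alg_of_mult alg_of_cpow_mat F0_def M0_def)
    qed
    have ev: "\<forall>\<^sub>F h in at_right 0. \<forall>x\<in>K. F h x * alg_of (e_matrix h (a h 0) x) = alg_of (E h x)"
      using evH
    proof eventually_elim
      case (elim h)
      show ?case
      proof
        fix x assume "x \<in> K"
        then have "Re x \<ge> l + 1" using K(2) R1(1) by (auto simp: R2_def)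
        then show "F h x * alg_of (e_matrix h (a h 0) x) = alg_of (E h x)" using EF [OF elim] by simp
      qed
    qed
    show ?thesis
      by (rule uniform_limit_cong [THEN iffD1, OF ev _ lim]) (rule E')
  qed
  show ?thesis
  proof (rule that [of R2])
    show "R2 \<ge> 1" using R1 by (simp add: R2_def)
    show "\<forall>\<^sub>F h in at_right 0. \<forall>x. Re x \<ge> R2 \<longrightarrow> x \<notin> ratm_poles (A h)"
      using evH
    proof eventually_elim
      case (elim h)
      show ?case using half(1) [OF elim] R1(1) by (auto simp: R2_def)
    qed
    show "\<forall>\<^sub>F h in at_right 0. \<exists>Rb. \<forall>x i j. Re x > Rb \<longrightarrow> (\<lambda>x. E h x $ i $ j) analytic_on {x}"
      using evH by eventually_elim (use an in blast)
  qed (use convE in blast)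
qed

text \<open>Finitely many of the neighbourhoods cover \<open>T\<close>, so the smallness conditions
  on h can be met simultaneously.\<close>

lemma eventually_no_poles:
  fixes A :: "real \<Rightarrow> ('n::finite) ratmat"
  assumes T: "compact T" "T \<inter> ratm_poles A' = {}"
    and np: "\<And>x0. x0 \<notin> ratm_poles A' \<Longrightarrow>
           \<exists>U. open U \<and> x0 \<in> U \<and> (\<forall>\<^sub>F h in at_right 0. U \<inter> ratm_poles (A h) = {})"
  shows "\<forall>\<^sub>F h in at_right 0. T \<inter> ratm_poles (A h) = {}"
proof -
  define \<U> where "\<U> = {U. open U \<and> (\<forall>\<^sub>F h in at_right 0. U \<inter> ratm_poles (A h) = {})}"
  have "T \<subseteq> \<Union> \<U>" using np T(2) unfolding \<U>_def by blast
  moreover have "\<And>U. U \<in> \<U> \<Longrightarrow> open U" by (simp add: \<U>_def)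
  ultimately obtain \<V> where \<V>: "\<V> \<subseteq> \<U>" "finite \<V>" "T \<subseteq> \<Union> \<V>"
    by (rule compactE [OF T(1)])
  have "\<forall>\<^sub>F h in at_right 0. \<forall>U\<in>\<V>. U \<inter> ratm_poles (A h) = {}"
    using \<V> by (intro eventually_ball_finite) (auto simp: \<U>_def)
  then show ?thesis by eventually_elim (use \<V>(3) in blast)
qed

text \<open>Convergence on the region is understood as locally uniform. Analyticity of
  \<open>E h\<close> near each compact set for small h is part of the claim, so that no conventional
  value at a pole enters.\<close>

theorem mainTheorem3:
  fixes N :: "('n::{finite,linorder}) cmat \<Rightarrow> real"
    and h0 C l :: real
    and A :: "real \<Rightarrow> 'n ratmat"
    and A' :: "'n ratmat"
    and a :: "real \<Rightarrow> nat \<Rightarrow> 'n cmat"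
    and a' :: "nat \<Rightarrow> 'n cmat"
    and E :: "real \<Rightarrow> complex \<Rightarrow> 'n cmat"
    and E' :: "complex \<Rightarrow> 'n cmat"
  assumes "algebra_norm N" and "h0 > 0"
    and "\<And>h. h \<in> {0<..<h0} \<Longrightarrow> fact_expansion h (A h) (a h)"
    and "C \<ge> 0" and "l \<ge> 0" and "of_type_C_lambda N h0 a C l"
    and "expansion_at_infinity A' a'"
    and "\<And>s. ((\<lambda>h. a h s) \<longlongrightarrow> a' s) (at_right 0)"
    and "jordan_unfolding h0 (\<lambda>h. a h 0) (a' 0)"
    and "non_resonant (a' 0)"
    and "\<And>K. compact K \<Longrightarrow> K \<inter> ratm_poles A' = {} \<Longrightarrow>
           uniform_limit K (\<lambda>h. ratm_eval (A h)) (ratm_eval A') (at_right 0)"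
    and "\<And>x0. x0 \<notin> ratm_poles A' \<Longrightarrow>
           \<exists>U. open U \<and> x0 \<in> U \<and> (\<forall>\<^sub>F h in at_right 0. U \<inter> ratm_poles (A h) = {})"
    and "\<forall>\<^sub>F h in at_right 0. canonical_solution h (A h) (a h 0) (E h)"
    and "frobenius_solution A' (a' 0) E'"
  shows "\<forall>K. compact K \<and> K \<subseteq> Omega_plus A' \<longrightarrow>
           (\<forall>\<^sub>F h in at_right 0. \<forall>i j. (\<lambda>x. E h x $ i $ j) analytic_on K) \<and>
           uniform_limit K E E' (at_right 0)"
proof (intro allI impI)
  fix K assume "compact K \<and> K \<subseteq> Omega_plus A'"
  then have K: "compact K" "K \<subseteq> Omega_plus A'" by auto
  obtain R where R: "R \<ge> 1"
    "\<And>K. compact K \<Longrightarrow> K \<subseteq> {x. Re x \<ge> R} \<Longrightarrow> uniform_limit K (\<lambda>h x. alg_of (E h x)) (\<lambda>x. alg_of (E' x)) (at_right 0)"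
    "\<forall>\<^sub>F h in at_right 0. \<forall>x. Re x \<ge> R \<longrightarrow> x \<notin> ratm_poles (A h)"
    "\<forall>\<^sub>F h in at_right 0. \<exists>Rb. \<forall>x i j. Re x > Rb \<longrightarrow> (\<lambda>x. E h x $ i $ j) analytic_on {x}"
    by (rule right_half_plane_limit [OF assms(1-11,13,14)]; (assumption | (rule that; assumption)))
  obtain Bd where Bd: "Bd > 0" "\<And>x. x \<in> K \<Longrightarrow> cmod x \<le> Bd"
    using compact_imp_bounded [OF K(1)] unfolding bounded_pos by blast
  \<comment> \<open>Since R \<ge> 1, this lies to the right of K and inside the half-plane of known
    convergence.\<close>
  define X where "X = R + Bd"
  \<comment> \<open>The segments from K to the right, long enough to reach real part X + 1 even from
    real part - Bd. As an image of a compact set T is compact.\<close>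
  define T where "T = (\<lambda>(x, t). x + complex_of_real t) ` (K \<times> {0..X + 1 + Bd})"
  have "compact T"
    unfolding T_def by (intro compact_continuous_image compact_Times K compact_Icc)
      (auto simp: case_prod_unfold intro!: continuous_intros)
  have T_Omega: "T \<subseteq> Omega_plus A'" using K(2) by (auto simp: T_def intro!: Omega_plus_add)
  have inT: "x + of_real t \<in> T" if "x \<in> K" "0 \<le> t" "Re x + t \<le> X + 1" for x t
    unfolding T_def using that Bd(2) [OF that(1)] complex_Re_le_cmod [of "- x"]
    by (intro image_eqI [of _ _ "(x, t)"]) auto
  \<comment> \<open>The full rays, stable under every shift to the right. Poles are excluded on S in
    two ways: by compactness on the part in T, by the common half-plane on the rest.\<close>
  define S where "S = {z. \<exists>x\<in>K. \<exists>t\<ge>0. z = x + of_real t}"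
  have S: "x \<in> S \<Longrightarrow> t \<ge> 0 \<Longrightarrow> x + of_real t \<in> S" "K \<subseteq> S" "T \<subseteq> S" "S \<subseteq> Omega_plus A'" for x t
  proof -
    show "x + of_real t \<in> S" if x: "x \<in> S" "t \<ge> 0"
    proof -
      obtain y u where "y \<in> K" "u \<ge> 0" "x = y + of_real u" using x(1) unfolding S_def by blast
      then have "x + of_real t = y + of_real (u + t)" "u + t \<ge> 0" using x(2) by auto
      then show ?thesis using \<open>y \<in> K\<close> unfolding S_def by blast
    qed
    show "K \<subseteq> S" unfolding S_def by (auto intro!: exI [of _ "0::real"] bexI)
    show "T \<subseteq> S" unfolding S_def T_def by fastforce
    show "S \<subseteq> Omega_plus A'" using K(2) by (auto simp: S_def intro!: Omega_plus_add)
  qed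
  have SR: "x \<in> T" if "x \<in> S" "Re x \<le> R" for x
  proof -
    have "\<exists>y\<in>K. \<exists>u\<ge>0. x = y + complex_of_real u" using that(1) by (simp add: S_def)
    then obtain y u where y: "y \<in> K" "u \<ge> 0" "x = y + of_real u" by blast
    then show ?thesis using that(2) Bd(1) by (auto intro!: inT simp: X_def)
  qed
  have T_np: "\<forall>\<^sub>F h in at_right 0. T \<inter> ratm_poles (A h) = {}"
    using T_Omega Omega_plus_not_pole by (intro eventually_no_poles [OF \<open>compact T\<close> _ assms(12)]) auto
  have pos: "\<forall>\<^sub>F h in at_right (0::real). h > 0" by (rule eventually_at_right_less)
  \<comment> \<open>Analyticity and the pointwise equation on all of S. The equation of a canonical
    solution is only assumed off a sparse set, while the scheme uses it at every point of T.\<close>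
  have ext: "\<forall>\<^sub>F h in at_right 0. (\<forall>x\<in>S. \<forall>i j. (\<lambda>x. E h x $ i $ j) analytic_on {x}) \<and>
      (\<forall>x\<in>S. alg_of (E h (x + of_real h)) - alg_of (E h x) =
        sc (of_real h) * (sc (1 / x) * (alg_of (ratm_eval (A h) (x + of_real h)) * alg_of (E h (x + of_real h)))))"
    using assms(13) R(3,4) T_np pos
  proof eventually_elim
    case (elim h)
    obtain Rb where Rb: "\<And>x i j. Re x > Rb \<Longrightarrow> (\<lambda>x. E h x $ i $ j) analytic_on {x}" using elim(3) by blast
    have nm: "\<And>i j. (\<lambda>x. E h x $ i $ j) nicely_meromorphic_on UNIV"
      and de: "\<forall>\<^sub>\<approx>x. delta_minus h (E h) x = ratm_eval (A h) x ** E h x"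
      using elim(1) by (auto simp: canonical_solution_def)
    have Sh: "x \<noteq> 0 \<and> x + of_real h \<in> S \<and> x + of_real h \<notin> ratm_poles (A h)" if x: "x \<in> S" for x
    proof -
      have xh: "x + of_real h \<in> S" using S(1) [OF x, of h] elim(5) by simp
      have "x + of_real h \<notin> ratm_poles (A h)"
      proof (cases "Re (x + of_real h) \<le> R")
        case True
        then show ?thesis using SR [OF xh] elim(4) by blast
      next
        case False
        then show ?thesis using elim(2) by simp
      qed
      then show ?thesis using xh x S(4) Omega_plus_not_pole by blast
    qed
    show ?case
      using functional_extension [OF elim(5) nm de Rb Sh] by blast
  qed
  show "(\<forall>\<^sub>F h in at_right 0. \<forall>i j. (\<lambda>x. E h x $ i $ j) analytic_on K) \<and> uniform_limit K E E' (at_right 0)"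
  proof
    show "\<forall>\<^sub>F h in at_right 0. \<forall>i j. (\<lambda>x. E h x $ i $ j) analytic_on K"
      using ext
    proof eventually_elim
      case (elim h)
      then show ?case using S(2) analytic_on_analytic_at by blast
    qed
    have A0c: "continuous_on (Omega_plus A') (\<lambda>x. alg_of (ratm_eval A' x))"
      unfolding continuous_on_malg_iff
      using ratm_eval_entry_holomorphic [of "Omega_plus A'" A'] Omega_plus_not_pole holomorphic_on_imp_continuous_on by blast
    have Aunif: "uniform_limit L (\<lambda>h x. alg_of (ratm_eval (A h) x)) (\<lambda>x. alg_of (ratm_eval A' x)) (at_right 0)"
      if "compact L" "L \<subseteq> Omega_plus A'" for L
      unfolding uniform_limit_alg_of_iff using that Omega_plus_not_pole by (intro assms(11)) auto
    \<comment> \<open>A compact neighbourhood of T, because the coefficient is evaluated at x +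
      h.\<close>
    obtain L d where L: "d > 0" "compact L" "T \<subseteq> L" "L \<subseteq> Omega_plus A'" "\<And>x y. x \<in> T \<Longrightarrow> cmod y \<le> d \<Longrightarrow> x + y \<in> L"
      using compact_neighbourhood [OF \<open>compact T\<close> open_Omega_plus T_Omega] by metis
    have "continuous_on L (\<lambda>x. alg_of (ratm_eval A' x))" using A0c L(4) continuous_on_subset by blast
    then have "bounded ((\<lambda>x. alg_of (ratm_eval A' x)) ` L)"
      using L(2) by (intro compact_imp_bounded compact_continuous_image)
    then obtain g where g: "\<And>x. x \<in> L \<Longrightarrow> norm (alg_of (ratm_eval A' x)) \<le> g"
      unfolding bounded_iff by blast
    have "uniform_limit K (\<lambda>h x. alg_of (E h x)) (\<lambda>x. alg_of (E' x)) (at_right 0)"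
    proof (rule propagation [where X = X and T = T and A = "\<lambda>h x. alg_of (ratm_eval (A h) x)" and a = "g + 1"])
      show "Re x \<le> X" if "x \<in> K" for x
        using Bd(2) [OF that] complex_Re_le_cmod [of x] R(1) by (simp add: X_def)
      show "0 \<notin> T" using T_Omega Omega_plus_not_pole by blast
      have "X \<ge> R" using Bd by (simp add: X_def)
      then show "uniform_limit (T \<inter> {x. Re x \<ge> X}) (\<lambda>h x. alg_of (E h x)) (\<lambda>x. alg_of (E' x)) (at_right 0)"
        by (intro R(2) closed_Int_compact compact_Int_closed \<open>compact T\<close> closed_halfspace_Re_ge) auto
      have "\<forall>\<^sub>F h in at_right 0. \<forall>x\<in>L. dist (alg_of (ratm_eval (A h) x)) (alg_of (ratm_eval A' x)) < 1"
        using uniform_limitD [OF Aunif [OF L(2,4)], of 1] by simp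
      then show "\<forall>\<^sub>F h in at_right 0. \<forall>x\<in>T. norm (alg_of (ratm_eval (A h) (x + of_real h))) \<le> g + 1"
        using eventually_greaterThanLessThan [OF L(1)]
      proof eventually_elim
        case (elim h)
        show ?case
        proof
          fix x assume "x \<in> T"
          then have xL: "x + of_real h \<in> L" using elim(2) by (intro L(5)) auto
          then have "dist (alg_of (ratm_eval (A h) (x + of_real h))) (alg_of (ratm_eval A' (x + of_real h))) < 1"
            using elim(1) by blast
          then show "norm (alg_of (ratm_eval (A h) (x + of_real h))) \<le> g + 1"
            using g [OF xL] norm_triangle_sub [of "alg_of (ratm_eval (A h) (x + of_real h))" "alg_of (ratm_eval A' (x + of_real h))"]
            by (simp add: dist_norm)
        qed
      qed
      show "\<forall>\<^sub>F h in at_right 0. \<forall>x\<in>T. alg_of (E h (x + of_real h)) - alg_of (E h x) =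
          sc (of_real h) * (sc (1 / x) * (alg_of (ratm_eval (A h) (x + of_real h)) * alg_of (E h (x + of_real h))))"
        using ext by eventually_elim (use S(3) in blast)
      fix \<epsilon> :: real assume \<epsilon>: "\<epsilon> > 0"
      have hol: "(\<lambda>z. ent (alg_of (E' z)) i j) holomorphic_on Omega_plus A'" for i j
        using assms(14) by (simp add: frobenius_solution_def)
      \<comment> \<open>The product with 0 puts the equation in the form of
        \<open>scheme_consistent\<close> with right-hand factor B = 0.\<close>
      have ode: "deriv (\<lambda>z. ent (alg_of (E' z)) i j) x =
          ent (sc (1 / x) * (alg_of (ratm_eval A' x) * alg_of (E' x) - alg_of (E' x) * 0)) i j" if "x \<in> Omega_plus A'" for i j x
        using frobenius_solution_ode [OF assms(14) that] by simp
      have z: "0 \<notin> Omega_plus A'" using Omega_plus_not_pole by blast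
      show "\<forall>\<^sub>F h in at_right 0. \<forall>x\<in>T. norm (alg_of (E' (x + of_real h)) - alg_of (E' x) -
          sc (of_real h) * (sc (1 / x) * (alg_of (ratm_eval (A h) (x + of_real h)) * alg_of (E' (x + of_real h))))) \<le> \<epsilon> * h"
        using scheme_consistent [OF open_Omega_plus z \<open>compact T\<close> T_Omega hol ode A0c Aunif tendsto_const \<epsilon>] by simp
    qed (use K \<open>compact T\<close> inT in auto)
    then show "uniform_limit K E E' (at_right 0)" by (simp only: uniform_limit_alg_of_iff)
  qed
qed

end
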